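(* Let $p\in[1,2]$ and $N'>\frac n2$. Let $\{K(t,s):s,t>0\}$ be a uniformly bounded family of bounded linear operators on $L^2(\mathbb R^n;\mathbb C^N)$ for which there is $C>0$ such that for all Borel sets $E,F\subseteq\mathbb R^n$ and all $s,t>0$, $$\|\mathbf 1_EK(t,s)\mathbf 1_F\|_{L^p\to L^2}\le C\max\{t,s\}^{-n(\frac1p-\frac12)}\Big(1+\frac{\mathrm{dist}(E,F)}{\max\{t,s\}}\Big)^{-N'}.$$ Then the following holds. (1) Given $\alpha\in(0,\infty)$, we have $T_{K^-_\alpha}\in\mathcal L(T^{1,2}(\mathbb R^{n+1}_+;\mathbb C^N))$. (2) Given $\beta\in(\frac n{p'},\infty)$ and $\gamma\in\mathbb R$, we have $T_{K^+_{\beta+i\gamma}}\in\mathcal L(T^{1,2}(\mathbb R^{n+1}_+;\mathbb C^N))$ with $$\sup_{\gamma\in\mathbb R}\|T_{K^+_{\beta+i\gamma}}\|_{\mathcal L(T^{1,2})}<\infty.$$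
   Context: $n,N$ are positive integers, $\frac1{p'}=1-\frac1p$ (so $\frac n{p'}=0$ if $p=1$), $\mathrm{dist}(E,F)=\inf\{|x-y|:x\in E,y\in F\}$, $\mathbf 1_E$ is multiplication by the indicator function. For a kernel $K$ and $z\in\mathbb C$, $s,t>0$: $K_z^+(t,s)=\mathbf 1_{(0,\infty)}(t-s)\big(\frac st\big)^zK(t,s)$ and $K_z^-(t,s)=\mathbf 1_{(0,\infty)}(s-t)\big(\frac ts\big)^zK(t,s)$. The integral operator with kernel $K$ is $T_KF(t,x)=\int_0^\infty K(t,s)F(s,\cdot)(x)\,\frac{ds}s$ (kernels are implicitly measurable in $(t,s)$ so that this makes sense; boundedness on a tent space means that $T_K$, defined on a dense subspace such as the intersection with $T^{2,2}$, extends to a bounded operator). $T^{1,2}(\mathbb R^{n+1}_+;\mathbb C^N)$ is the completion of $C_c^\infty(\mathbb R^{n+1}_+;\mathbb C^N)$ for $\|F\|_{T^{1,2}}=\int_{\mathbb R^n}\big(\int_0^\infty\int_{B(x,t)}|F(t,y)|^2\frac{dy\,dt}{t^{n+1}}\big)^{1/2}dx$; $T^{2,2}$ is defined analogously with $\|F\|_{T^{2,2}}=\big(\int_{\mathbb R^n}\int_0^\infty\int_{B(x,t)}|F(t,y)|^2\frac{dy\,dt}{t^{n+1}}dx\big)^{1/2}$. *)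

theory Defs
  imports "HOL-Analysis.Analysis"
begin

text \<open>
  Elements of Lebesgue and tent spaces are represented by measurable functions; equality in
  these spaces is equality almost everywhere. Norms are extended nonnegative reals.
\<close>

type_synonym ('n, 'm) vfun = "real ^ 'n \<Rightarrow> complex ^ 'm"
type_synonym ('n, 'm) tfun = "real \<times> (real ^ 'n) \<Rightarrow> complex ^ 'm"

text \<open>Only used for exponents \<open>a > 0\<close>.\<close>

definition epowr :: "ennreal \<Rightarrow> real \<Rightarrow> ennreal" where
  "epowr x a = (if x = \<infinity> then \<infinity> else ennreal (enn2real x powr a))"

definition op_norm ::
  "('a \<Rightarrow> 'b) set \<Rightarrow> (('a \<Rightarrow> 'b) \<Rightarrow> ennreal) \<Rightarrow> (('a \<Rightarrow> 'b) \<Rightarrow> ennreal) \<Rightarrow>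
   (('a \<Rightarrow> 'b) \<Rightarrow> ('a \<Rightarrow> 'b)) \<Rightarrow> ennreal" where
  "op_norm X norm1 norm2 A = Inf {c. \<forall>f\<in>X. norm2 (A f) \<le> c * norm1 f}"

text \<open>
  The complex-linear bounded operators on the space of (classes modulo \<open>M\<close>-null sets of)
  functions in \<open>X\<close>. If \<open>nrm\<close> vanishes only on null functions, then linearity and boundedness
  imply that \<open>A\<close> is compatible with almost everywhere equality.
\<close>

definition bounded_ops ::
  "'a measure \<Rightarrow> ('a \<Rightarrow> complex ^ 'm) set \<Rightarrow> (('a \<Rightarrow> complex ^ 'm) \<Rightarrow> ennreal) \<Rightarrow>
   (('a \<Rightarrow> complex ^ 'm) \<Rightarrow> ('a \<Rightarrow> complex ^ 'm)) set" where
  "bounded_ops M X nrm = {A.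
     (\<forall>f\<in>X. A f \<in> X) \<and>
     (\<forall>f\<in>X. \<forall>g\<in>X. AE z in M. A (\<lambda>x. f x + g x) z = A f z + A g z) \<and>
     (\<forall>c. \<forall>f\<in>X. AE z in M. A (\<lambda>x. c *s f x) z = c *s A f z) \<and>
     op_norm X nrm nrm A < \<infinity>}"


definition Lp_norm :: "real \<Rightarrow> ('n::finite, 'm::finite) vfun \<Rightarrow> ennreal" where
  "Lp_norm p f = epowr (\<integral>\<^sup>+ x. ennreal (norm (f x) powr p) \<partial>lborel) (1 / p)"

definition Lp :: "real \<Rightarrow> ('n::finite, 'm::finite) vfun set" where
  "Lp p = {f. f \<in> borel_measurable lborel \<and> Lp_norm p f < \<infinity>}"

text \<open>
  The norm of an operator on \<open>L\<^sup>2\<close>, regarded as an operator from \<open>L\<^sup>p\<close> to \<open>L\<^sup>2\<close>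
  with initial domain \<open>L\<^sup>p \<inter> L\<^sup>2\<close>.
\<close>

definition Lp_L2_norm ::
  "real \<Rightarrow> (('n::finite, 'm::finite) vfun \<Rightarrow> ('n, 'm) vfun) \<Rightarrow> ennreal" where
  "Lp_L2_norm p A = op_norm (Lp p \<inter> Lp 2) (Lp_norm p) (Lp_norm 2) A"

definition cutoff :: "(real ^ 'n::finite) set \<Rightarrow> ('n, 'm::finite) vfun \<Rightarrow> ('n, 'm) vfun" where
  "cutoff E f = (\<lambda>x. indicator E x *\<^sub>R f x)"


definition upper_half :: "(real \<times> (real ^ 'n::finite)) set" where
  "upper_half = {0<..} \<times> UNIV"

definition half_measure :: "(real \<times> (real ^ 'n::finite)) measure" where
  "half_measure = restrict_space lborel upper_half"

definition tent_norm :: "real \<Rightarrow> ('n::finite, 'm::finite) tfun \<Rightarrow> ennreal" where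
  "tent_norm q F = epowr
     (\<integral>\<^sup>+ x. epowr
        (\<integral>\<^sup>+ t\<in>{0<..}. (\<integral>\<^sup>+ y\<in>ball x t.
           ennreal ((norm (F (t, y)))\<^sup>2 / t ^ (CARD('n) + 1)) \<partial>lborel) \<partial>lborel) (q / 2)
      \<partial>lborel) (1 / q)"

text \<open>
  On a finite-dimensional space, \<open>f\<close> is of class \<open>C\<^sup>k\<^sup>+\<^sup>1\<close> iff it is differentiable
  and all of its directional derivatives are of class \<open>C\<^sup>k\<close>.
\<close>

primrec Ck :: "nat \<Rightarrow> ('a::euclidean_space \<Rightarrow> 'b::real_normed_vector) \<Rightarrow> bool" where
  "Ck 0 f \<longleftrightarrow> continuous_on UNIV f"
| "Ck (Suc k) f \<longleftrightarrow> (\<forall>x. f differentiable (at x)) \<and>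
     (\<forall>v. Ck k (\<lambda>x. frechet_derivative f (at x) v))"

text \<open>Functions on the half-space are identified with their extension by zero.\<close>

definition test_functions :: "('n::finite, 'm::finite) tfun set" where
  "test_functions = {\<phi>. (\<forall>k. Ck k \<phi>) \<and>
     compact (closure {z. \<phi> z \<noteq> 0}) \<and> closure {z. \<phi> z \<noteq> 0} \<subseteq> upper_half}"

text \<open>
  \<open>T\<^sup>q\<^sup>,\<^sup>2\<close>: the completion of the test functions, realised as the space of measurable functions
  that are limits of test functions. This is a model of the completion since the norm controls
  \<open>L\<^sup>2\<close>-norms on compact subsets of the half-space.
\<close>

definition tent_space :: "real \<Rightarrow> ('n::finite, 'm::finite) tfun set" where
  "tent_space q = {F. F \<in> borel_measurable half_measure \<and>
     (\<exists>\<phi>. (\<forall>k::nat. \<phi> k \<in> test_functions) \<and>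
        (\<lambda>k. tent_norm q (\<lambda>z. F z - \<phi> k z)) \<longlonglongrightarrow> 0)}"

abbreviation tent_ops ::
  "real \<Rightarrow> (('n::finite, 'm::finite) tfun \<Rightarrow> ('n, 'm) tfun) set" where
  "tent_ops q \<equiv> bounded_ops half_measure (tent_space q) (tent_norm q)"

definition tent_op_norm ::
  "real \<Rightarrow> (('n::finite, 'm::finite) tfun \<Rightarrow> ('n, 'm) tfun) \<Rightarrow> ennreal" where
  "tent_op_norm q S = op_norm (tent_space q) (tent_norm q) (tent_norm q) S"


type_synonym ('n, 'm) kernel = "real \<Rightarrow> real \<Rightarrow> ('n, 'm) vfun \<Rightarrow> ('n, 'm) vfun"

text \<open>
  \<open>H\<close> is a version of the \<open>L\<^sup>2\<close>-valued function \<open>(t, s) \<mapsto> u t s\<close> on \<open>(0,\<infinity>)\<^sup>2\<close> that is jointly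
  measurable in \<open>(t, s, x)\<close>. For locally square-integrable \<open>u\<close>, such a version exists iff \<open>u\<close> is
  (strongly or, equivalently, weakly) measurable.
\<close>

definition measurable_version ::
  "(real \<Rightarrow> real \<Rightarrow> ('n::finite, 'm::finite) vfun) \<Rightarrow>
   (real \<times> real \<times> (real ^ 'n) \<Rightarrow> complex ^ 'm) \<Rightarrow> bool" where
  "measurable_version u H \<longleftrightarrow> H \<in> borel_measurable lborel \<and>
     (AE ts in lborel. 0 < fst ts \<and> 0 < snd ts \<longrightarrow>
        (AE x in lborel. H (fst ts, snd ts, x) = u (fst ts) (snd ts) x))"

definition measurable_kernel :: "('n::finite, 'm::finite) kernel \<Rightarrow> bool" where
  "measurable_kernel K \<longleftrightarrow> (\<forall>f\<in>Lp 2. \<exists>H. measurable_version (\<lambda>t s. K t s f) H)"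

definition kernel_plus :: "complex \<Rightarrow> ('n::finite, 'm::finite) kernel \<Rightarrow> ('n, 'm) kernel" where
  "kernel_plus z K t s f =
     (\<lambda>x. (indicator {0<..} (t - s) * complex_of_real (s / t) powr z) *s K t s f x)"

definition kernel_minus :: "complex \<Rightarrow> ('n::finite, 'm::finite) kernel \<Rightarrow> ('n, 'm) kernel" where
  "kernel_minus z K t s f =
     (\<lambda>x. (indicator {0<..} (s - t) * complex_of_real (t / s) powr z) *s K t s f x)"

text \<open>
  \<open>G = T\<^sub>K F\<close>, that is, \<open>G(t,x) = \<integral>\<^sub>0\<^sup>\<infinity> K(t,s)F(s,\<cdot>)(x) ds/s\<close> for almost all \<open>(t,x)\<close> as an
  absolutely convergent integral. The version \<open>H\<close> of \<open>K(t,s)F(s,\<cdot>)(x)\<close> is unique up to null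
  sets, so \<open>G\<close> is determined almost everywhere by \<open>F\<close>.
\<close>

definition integral_op ::
  "('n::finite, 'm::finite) kernel \<Rightarrow> ('n, 'm) tfun \<Rightarrow> ('n, 'm) tfun \<Rightarrow> bool" where
  "integral_op K F G \<longleftrightarrow>
     (\<exists>H. measurable_version (\<lambda>t s. K t s (\<lambda>y. F (s, y))) H \<and>
        (AE z in half_measure.
           set_integrable lborel {0<..} (\<lambda>s. (1 / s) *\<^sub>R H (fst z, s, snd z)) \<and>
           G z = (LINT s:{0<..}|lborel. (1 / s) *\<^sub>R H (fst z, s, snd z))))"

text \<open>\<open>S\<close> extends \<open>T\<^sub>K\<close>, which is defined on \<open>T\<^sup>q\<^sup>,\<^sup>2 \<inter> T\<^sup>2\<^sup>,\<^sup>2\<close>.\<close>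

definition extends_integral_op ::
  "real \<Rightarrow> ('n::finite, 'm::finite) kernel \<Rightarrow> (('n, 'm) tfun \<Rightarrow> ('n, 'm) tfun) \<Rightarrow> bool" where
  "extends_integral_op q K S \<longleftrightarrow>
     (\<forall>F\<in>tent_space q \<inter> tent_space 2. integral_op K F (S F))"

end

theory Submission
  imports Defs
begin

text \<open>
  A function with finite \<open>T\<^sup>1\<^sup>,\<^sup>2\<close> norm splits into disjointly supported atoms \<open>a\<^sub>l\<close>, each living on
  \<open>(0, r\<^sub>l) \<times> B(x\<^sub>l, r\<^sub>l)\<close>, with \<open>\<Sum> r\<^sub>l\<^bsup>n/2\<^esup> \<parallel>a\<^sub>l\<parallel>\<close> controlled by the norm (norms of atoms in \<open>L\<^sup>2(dy dt/t)\<close>).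
  A dyadic stopping time on the partial sums of the square function gives this without maximal
  functions. For one atom at scale \<open>r\<close> the image is cut into the regions \<open>t ~ 2^k r\<close>,
  \<open>|x - x\<^sub>0| ~ 2^(k + j) r\<close>. There the off-diagonal bound, Hoelder's inequality on \<open>B(x\<^sub>0, r)\<close> and a Schur
  test in the scales give an \<open>L\<^sup>2\<close> bound which, multiplied by the square root of the volume of the
  region, decays like \<open>2^(k (n/p' - \<sigma>)) 2^(j (n/2 - N'))\<close>; both exponents are negative.

  The estimate is proved for the integral with absolute values inside. Hence the defining integral
  converges absolutely for every \<open>F\<close> in \<open>T\<^sup>1\<^sup>,\<^sup>2\<close>, and the extension is given by the integral itself.
  That the image lies in \<open>T\<^sup>1\<^sup>,\<^sup>2\<close> then amounts to the density of test functions among measurable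
  functions of finite norm.
\<close>

section \<open>Square roots and Minkowski inequalities\<close>

text \<open>A uniform bound on atoms does not by itself bound an operator, since the action on an
  infinite atomic sum must be identified. Here disjointness of the atoms gives |K u| \<le> \<Sum> |K
  u_l| almost everywhere, a domination that survives the absolute integral in s. The threshold n/p'
  is a balance in k: the square root of the volume costs 2^(kn/2), passing from L^p to L^2 gains
  2^(-kn(1/p - 1/2)), the weight gains 2^(-k\<sigma>), and n/2 - n(1/p - 1/2) = n(1 - 1/p). The
  Schur test needs a further \<delta> > 0, hence \<beta> = \<sigma> + \<delta>. For t < s no large k
  occurs on an atom with s < r, so \<alpha> is spent on \<delta> alone. A second obstacle is
  measurability. The kernel is measurable in (t, s) only on a fixed f, while F(s, .) moves with s,
  so a jointly measurable version of K(t, s)F(s, .)(x) has to be constructed. It makes sense because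
  almost every slice of F lies in L^2, although F itself may have infinite energy.\<close>

abbreviation esqrt :: "ennreal \<Rightarrow> ennreal" where
  "esqrt x \<equiv> epowr x (1 / 2)"

lemma esqrt_top [simp]: "esqrt top = top"
  by (simp add: epowr_def infinity_ennreal_def)

lemma esqrt_ennreal: "0 \<le> x \<Longrightarrow> esqrt (ennreal x) = ennreal (sqrt x)"
  by (simp add: epowr_def powr_half_sqrt)

lemma esqrt_0 [simp]: "esqrt 0 = 0"
  by (simp add: epowr_def infinity_ennreal_def)

lemma esqrt_power2 [simp]: "(esqrt x)\<^sup>2 = x"
proof (cases x)
  case (real r)
  then show ?thesis by (simp add: esqrt_ennreal ennreal_power)
qed (simp add: power2_eq_square ennreal_top_mult)

lemma ennreal_power2_mono_iff: "x\<^sup>2 \<le> y\<^sup>2 \<longleftrightarrow> x \<le> (y::ennreal)"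
proof
  assume "x\<^sup>2 \<le> y\<^sup>2"
  then show "x \<le> y"
  proof (cases x; cases y)
    fix a b assume "0 \<le> a" "x = ennreal a" "0 \<le> b" "y = ennreal b"
    with \<open>x\<^sup>2 \<le> y\<^sup>2\<close> show "x \<le> y"
      by (simp add: ennreal_power power2_le_iff_abs_le)
  qed (auto simp: power2_eq_square ennreal_top_mult ennreal_power top_unique
      simp flip: ennreal_mult)
qed (intro power_mono, auto)

lemma esqrt_square [simp]: "esqrt (x\<^sup>2) = x"
  by (metis esqrt_power2 ennreal_power2_mono_iff order.antisym order_refl)

lemma esqrt_le_iff: "esqrt x \<le> y \<longleftrightarrow> x \<le> y\<^sup>2"
  by (metis ennreal_power2_mono_iff esqrt_power2)

lemma le_esqrt_iff: "x \<le> esqrt y \<longleftrightarrow> x\<^sup>2 \<le> y"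
  by (metis ennreal_power2_mono_iff esqrt_power2)

lemma esqrt_le_cancel [simp]: "esqrt x \<le> esqrt y \<longleftrightarrow> x \<le> y"
  by (simp add: esqrt_le_iff)

lemma esqrt_mult: "esqrt (x * y) = esqrt x * esqrt y"
  by (metis esqrt_power2 esqrt_square power_mult_distrib)

lemma esqrt_eq_0_iff [simp]: "esqrt x = 0 \<longleftrightarrow> x = 0"
  by (metis esqrt_0 esqrt_power2)

lemma esqrt_less_top_iff [simp]: "esqrt x < top \<longleftrightarrow> x < top"
proof (cases x)
  case (real r)
  then show ?thesis by (simp add: esqrt_ennreal)
qed simp

lemma borel_measurable_esqrt [measurable (raw)]:
  assumes [measurable]: "f \<in> borel_measurable M"
  shows "(\<lambda>x. esqrt (f x)) \<in> borel_measurable M"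
  unfolding epowr_def by measurable

lemma ennreal_add_power2_le: "(x + y)\<^sup>2 \<le> 2 * x\<^sup>2 + 2 * (y::ennreal)\<^sup>2"
proof (cases x; cases y)
  fix a b assume ab: "0 \<le> a" "x = ennreal a" "0 \<le> b" "y = ennreal b"
  have "(a + b)\<^sup>2 \<le> 2 * a\<^sup>2 + 2 * b\<^sup>2"
    using zero_le_power2[of "a - b"] by (simp add: power2_eq_square algebra_simps)
  then have "ennreal ((a + b)\<^sup>2) \<le> ennreal (2 * a\<^sup>2 + 2 * b\<^sup>2)"
    by (rule ennreal_leI)
  also have "\<dots> = 2 * ennreal (a\<^sup>2) + 2 * ennreal (b\<^sup>2)"
    by (simp add: ennreal_mult')
  finally have "ennreal ((a + b)\<^sup>2) \<le> 2 * ennreal (a\<^sup>2) + 2 * ennreal (b\<^sup>2)" .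
  then show ?thesis
    using ab by (simp add: ennreal_power flip: ennreal_plus)
qed (auto simp: power2_eq_square ennreal_top_mult ennreal_mult_top)

lemma Cauchy_Schwarz_nn_integral_esqrt:
  assumes [measurable]: "f \<in> borel_measurable M" "g \<in> borel_measurable M"
  shows "(\<integral>\<^sup>+x. f x * g x \<partial>M) \<le> esqrt (\<integral>\<^sup>+x. (f x)\<^sup>2 \<partial>M) * esqrt (\<integral>\<^sup>+x. (g x)\<^sup>2 \<partial>M)"
  unfolding esqrt_mult[symmetric] le_esqrt_iff
  by (rule Cauchy_Schwarz_nn_integral) auto

text \<open>The square of the sum is a double sum of integrals of \<open>f i * f j\<close>.
  Cauchy-Schwarz bounds each by a product of norms, and the products sum to the square of the sum of
  norms. Values in \<open>ennreal\<close> spare any finiteness condition.\<close>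

lemma Minkowski_suminf:
  assumes [measurable]: "\<And>i::nat. f i \<in> borel_measurable M"
  shows "esqrt (\<integral>\<^sup>+x. (\<Sum>i. f i x)\<^sup>2 \<partial>M) \<le> (\<Sum>i. esqrt (\<integral>\<^sup>+x. (f i x)\<^sup>2 \<partial>M))"
proof -
  let ?n = "\<lambda>i. esqrt (\<integral>\<^sup>+x. (f i x)\<^sup>2 \<partial>M)"
  have "(\<integral>\<^sup>+x. (\<Sum>i. f i x)\<^sup>2 \<partial>M) = (\<integral>\<^sup>+x. (\<Sum>i. \<Sum>j. f i x * f j x) \<partial>M)"
    by (simp add: power2_eq_square mult.commute flip: ennreal_suminf_multc ennreal_suminf_cmult)
  also have "\<dots> = (\<Sum>i. \<Sum>j. \<integral>\<^sup>+x. f i x * f j x \<partial>M)"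
    by (simp add: nn_integral_suminf del: ennreal_suminf_cmult ennreal_suminf_multc)
  also have "\<dots> \<le> (\<Sum>i. \<Sum>j. ?n i * ?n j)"
    by (intro suminf_le Cauchy_Schwarz_nn_integral_esqrt) auto
  also have "\<dots> = (\<Sum>i. ?n i)\<^sup>2"
    by (simp add: power2_eq_square)
  finally show ?thesis
    by (simp add: esqrt_le_iff)
qed

text \<open>As for sums: the squared inner integral is an integral over
  \<open>N \<Otimes>\<^sub>M N\<close>, which is interchanged with \<open>M\<close> before
  Cauchy-Schwarz is applied.\<close>

lemma Minkowski_nn_integral:
  assumes "sigma_finite_measure M" "sigma_finite_measure N"
    and f[measurable]: "case_prod f \<in> borel_measurable (M \<Otimes>\<^sub>M N)"
  shows "(\<integral>\<^sup>+x. (\<integral>\<^sup>+y. f x y \<partial>N)\<^sup>2 \<partial>M) \<le> (\<integral>\<^sup>+y. esqrt (\<integral>\<^sup>+x. (f x y)\<^sup>2 \<partial>M) \<partial>N)\<^sup>2"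
proof -
  interpret M: sigma_finite_measure M by fact
  interpret N: sigma_finite_measure N by fact
  interpret pair_sigma_finite M N ..
  have [measurable]: "(\<lambda>p. f (fst p) (fst (snd p))) \<in> borel_measurable (M \<Otimes>\<^sub>M (N \<Otimes>\<^sub>M N))"
    "(\<lambda>p. f (fst p) (snd (snd p))) \<in> borel_measurable (M \<Otimes>\<^sub>M (N \<Otimes>\<^sub>M N))"
    by measurable
  let ?n = "\<lambda>y. esqrt (\<integral>\<^sup>+x. (f x y)\<^sup>2 \<partial>M)"
  interpret N2: pair_sigma_finite N N ..
  interpret MN2: pair_sigma_finite M "N \<Otimes>\<^sub>M N" ..
  have m: "(\<lambda>y. \<integral>\<^sup>+x. (f x y)\<^sup>2 \<partial>M) \<in> borel_measurable N"
    by measurable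
  have "(\<integral>\<^sup>+x. (\<integral>\<^sup>+y. f x y \<partial>N)\<^sup>2 \<partial>M)
      = (\<integral>\<^sup>+x. (\<integral>\<^sup>+y. (\<integral>\<^sup>+z. f x y * f x z \<partial>N) \<partial>N) \<partial>M)"
    by (intro nn_integral_cong)
      (simp add: power2_eq_square nn_integral_cmult nn_integral_multc)
  also have "\<dots> = (\<integral>\<^sup>+x. (\<integral>\<^sup>+q. f x (fst q) * f x (snd q) \<partial>(N \<Otimes>\<^sub>M N)) \<partial>M)"
    by (intro nn_integral_cong) (simp add: N.nn_integral_fst[symmetric])
  also have "\<dots> = (\<integral>\<^sup>+q. (\<integral>\<^sup>+x. f x (fst q) * f x (snd q) \<partial>M) \<partial>(N \<Otimes>\<^sub>M N))"
    by (rule MN2.Fubini'[symmetric]) measurable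
  also have "\<dots> \<le> (\<integral>\<^sup>+q. ?n (fst q) * ?n (snd q) \<partial>(N \<Otimes>\<^sub>M N))"
    by (intro nn_integral_mono Cauchy_Schwarz_nn_integral_esqrt)
      (auto simp: space_pair_measure)
  also have "\<dots> = (\<integral>\<^sup>+y. (\<integral>\<^sup>+z. ?n y * ?n z \<partial>N) \<partial>N)"
    using m by (simp add: N.nn_integral_fst[symmetric])
  also have "\<dots> = (\<integral>\<^sup>+y. ?n y \<partial>N)\<^sup>2"
    using m by (simp add: power2_eq_square nn_integral_cmult nn_integral_multc)
  finally show ?thesis .
qed

section \<open>Conical square functions\<close>

text \<open>The cone and the factor \<open>1 / t^(n + 1)\<close> are put into a weight, so that the
  inner iterated set integral of the tent norm becomes one integral over the whole space, ready for
  Tonelli.\<close>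

definition cone_weight :: "real ^ 'n::finite \<Rightarrow> real \<times> (real ^ 'n) \<Rightarrow> ennreal" where
  "cone_weight x z = indicator {z. 0 < fst z \<and> dist x (snd z) < fst z} z *
     ennreal (1 / fst z ^ (CARD('n) + 1))"

definition cone_energy :: "(real \<times> (real ^ 'n::finite) \<Rightarrow> ennreal) \<Rightarrow> real ^ 'n \<Rightarrow> ennreal" where
  "cone_energy G x = (\<integral>\<^sup>+ z. (G z)\<^sup>2 * cone_weight x z \<partial>lborel)"

definition tent1 :: "(real \<times> (real ^ 'n::finite) \<Rightarrow> ennreal) \<Rightarrow> ennreal" where
  "tent1 G = (\<integral>\<^sup>+ x. esqrt (cone_energy G x) \<partial>lborel)"

definition inv_weight :: "real \<Rightarrow> ennreal" where
  "inv_weight t = indicator {0<..} t * ennreal (1 / t)"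

definition energy :: "(real \<times> (real ^ 'n::finite) \<Rightarrow> ennreal) \<Rightarrow> ennreal" where
  "energy G = (\<integral>\<^sup>+ z. (G z)\<^sup>2 * inv_weight (fst z) \<partial>lborel)"

text \<open>Elements of the tent space are unconstrained off the half-space; after extension by zero
  they are Borel functions on the whole space.\<close>

definition ext0 :: "('n::finite, 'm::finite) tfun \<Rightarrow> ('n, 'm) tfun" where
  "ext0 F z = indicator upper_half z *\<^sub>R F z"

abbreviation enorm :: "'a::real_normed_vector \<Rightarrow> ennreal" where
  "enorm x \<equiv> ennreal (norm x)"

lemma borel_measurable_fst_raw [measurable (raw)]:
  fixes f :: "'a \<Rightarrow> 'b::second_countable_topology \<times> 'c::second_countable_topology"
  assumes [measurable]: "f \<in> borel_measurable M"
  shows "(\<lambda>x. fst (f x)) \<in> borel_measurable M"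
  by (rule measurable_compose[OF assms]) (simp add: borel_measurable_continuous_onI continuous_on_fst)

lemma borel_measurable_snd_raw [measurable (raw)]:
  fixes f :: "'a \<Rightarrow> 'b::second_countable_topology \<times> 'c::second_countable_topology"
  assumes [measurable]: "f \<in> borel_measurable M"
  shows "(\<lambda>x. snd (f x)) \<in> borel_measurable M"
  by (rule measurable_compose[OF assms]) (simp add: borel_measurable_continuous_onI continuous_on_snd)

lemma measurable_lborel_prod:
  fixes f :: "'a::euclidean_space \<times> 'b::euclidean_space \<Rightarrow> 'c::topological_space"
  assumes "f \<in> borel_measurable borel"
  shows "f \<in> borel_measurable (lborel \<Otimes>\<^sub>M lborel)"
  using assms by (simp add: lborel_prod)

lemma nn_integral_lborel_fst:
  fixes f :: "'a::euclidean_space \<times> 'b::euclidean_space \<Rightarrow> ennreal"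
  assumes "f \<in> borel_measurable borel"
  shows "(\<integral>\<^sup>+ x. \<integral>\<^sup>+ y. f (x, y) \<partial>lborel \<partial>lborel) = (\<integral>\<^sup>+ z. f z \<partial>lborel)"
  by (subst lborel.nn_integral_fst[OF measurable_lborel_prod[OF assms]]) (simp add: lborel_prod)

lemma nn_integral_lborel_swap:
  fixes f :: "'a::euclidean_space \<Rightarrow> 'b::euclidean_space \<Rightarrow> ennreal"
  assumes "(\<lambda>p. f (fst p) (snd p)) \<in> borel_measurable borel"
  shows "(\<integral>\<^sup>+ x. \<integral>\<^sup>+ y. f x y \<partial>lborel \<partial>lborel) = (\<integral>\<^sup>+ y. \<integral>\<^sup>+ x. f x y \<partial>lborel \<partial>lborel)"
  using lborel_pair.Fubini'[of f] measurable_lborel_prod[OF assms] by (simp add: case_prod_beta')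

lemma borel_measurable_inv_weight [measurable]: "inv_weight \<in> borel_measurable borel"
  unfolding inv_weight_def by measurable

lemma borel_measurable_cone_weight [measurable (raw)]:
  assumes [measurable]: "f \<in> borel_measurable M" "g \<in> borel_measurable M"
  shows "(\<lambda>x. cone_weight (f x) (g x)) \<in> borel_measurable M"
  unfolding cone_weight_def by measurable

lemma borel_measurable_cone [measurable (raw)]:
  assumes [measurable]: "G \<in> borel_measurable borel" and f: "f \<in> borel_measurable M"
  shows "(\<lambda>x. cone_energy G (f x)) \<in> borel_measurable M"
proof -
  have "cone_energy G \<in> borel_measurable borel"
    unfolding cone_energy_def[abs_def] by measurable
  from measurable_compose[OF f this] show ?thesis .
qed

lemma upper_half_measurable [measurable]: "(upper_half :: (real \<times> (real ^ 'n::finite)) set) \<in> sets borel"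
proof -
  have "upper_half = {z :: real \<times> (real ^ 'n). 0 < fst z}" by (auto simp: upper_half_def)
  also have "\<dots> \<in> sets borel" by measurable
  finally show ?thesis .
qed

lemma AE_half_measure: "(AE z in half_measure. P z) \<longleftrightarrow> (AE z in lborel. 0 < fst z \<longrightarrow> P z)"
  unfolding half_measure_def
  by (subst AE_restrict_space_iff)
    (use upper_half_measurable in \<open>auto simp: upper_half_def mem_Times_iff\<close>)

lemma borel_measurable_half_measure_iff:
  fixes F :: "('n::finite, 'm::finite) tfun"
  shows "F \<in> borel_measurable half_measure \<longleftrightarrow> ext0 F \<in> borel_measurable borel"
  unfolding half_measure_def ext0_def
  by (subst borel_measurable_restrict_space_iff) (auto simp: cong: measurable_cong_sets)

lemma tent_norm_1:
  fixes F :: "('n::finite, 'm::finite) tfun"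
  assumes "F \<in> borel_measurable half_measure"
  shows "tent_norm 1 F = tent1 (\<lambda>z. enorm (ext0 F z))"
proof -
  have [measurable]: "ext0 F \<in> borel_measurable borel"
    using assms by (simp add: borel_measurable_half_measure_iff)
  have *: "(\<integral>\<^sup>+ t\<in>{0<..}. (\<integral>\<^sup>+ y\<in>ball x t.
           ennreal ((norm (F (t, y)))\<^sup>2 / t ^ (CARD('n) + 1)) \<partial>lborel) \<partial>lborel) =
         cone_energy (\<lambda>z. enorm (ext0 F z)) x" (is "?l = _") for x
  proof -
    have "?l = (\<integral>\<^sup>+ t. (\<integral>\<^sup>+ y. (enorm (ext0 F (t, y)))\<^sup>2 * cone_weight x (t, y) \<partial>lborel) \<partial>lborel)"
    proof (intro nn_integral_cong, goal_cases)
      case (1 t)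
      show ?case
      proof (cases "0 < t")
        case True
        then show ?thesis
          by (auto intro!: nn_integral_cong simp: ext0_def upper_half_def cone_weight_def
              indicator_def ennreal_power divide_inverse ennreal_mult')
      qed (simp add: cone_weight_def)
    qed
    also have "\<dots> = cone_energy (\<lambda>z. enorm (ext0 F z)) x"
      unfolding cone_energy_def by (rule nn_integral_lborel_fst) measurable
    finally show ?thesis .
  qed
  have [simp]: "epowr x 1 = x" for x
    by (cases x) (auto simp: epowr_def)
  show ?thesis
    unfolding tent_norm_def * tent1_def by simp
qed

text \<open>The cone at \<open>x\<close> contains \<open>(t, y)\<close> iff \<open>x\<close> lies in
  the ball of radius \<open>t\<close> about \<open>y\<close>; the volume of that ball reduces
  \<open>1 / t^(n + 1)\<close> to a multiple of \<open>1 / t\<close>.\<close>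

lemma nn_integral_cone:
  fixes G :: "real \<times> (real ^ 'n::finite) \<Rightarrow> ennreal"
  assumes [measurable]: "G \<in> borel_measurable borel"
  shows "(\<integral>\<^sup>+ x. cone_energy G x \<partial>lborel) = ennreal (unit_ball_vol CARD('n)) * energy G"
proof -
  have "(\<integral>\<^sup>+ x. cone_energy G x \<partial>lborel) = (\<integral>\<^sup>+ z. \<integral>\<^sup>+ x. (G z)\<^sup>2 * cone_weight x z \<partial>lborel \<partial>lborel)"
    unfolding cone_energy_def
    by (rule nn_integral_lborel_swap) measurable
  also have "\<dots> = (\<integral>\<^sup>+ z. ennreal (unit_ball_vol CARD('n)) * ((G z)\<^sup>2 * inv_weight (fst z)) \<partial>lborel)"
  proof (intro nn_integral_cong, goal_cases)
    case (1 z)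
    have "(\<integral>\<^sup>+ x. cone_weight x z \<partial>lborel) = ennreal (unit_ball_vol CARD('n)) * inv_weight (fst z)"
    proof (cases "0 < fst z")
      case True
      have "(\<integral>\<^sup>+ x. cone_weight x z \<partial>lborel) =
          (\<integral>\<^sup>+ x. ennreal (1 / fst z ^ (CARD('n) + 1)) * indicator (ball (snd z) (fst z)) x \<partial>lborel)"
        using True by (intro nn_integral_cong) (auto simp: cone_weight_def indicator_def dist_commute)
      also have "\<dots> = ennreal (1 / fst z ^ (CARD('n) + 1)) * ennreal (unit_ball_vol CARD('n) * fst z ^ CARD('n))"
        using True by (subst nn_integral_cmult_indicator) (auto simp: emeasure_ball)
      also have "\<dots> = ennreal (unit_ball_vol CARD('n)) * inv_weight (fst z)"
        using True by (auto simp: inv_weight_def simp flip: ennreal_mult')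
      finally show ?thesis .
    qed (simp add: cone_weight_def inv_weight_def)
    then show ?case
      by (subst nn_integral_cmult) (simp_all add: mult_ac)
  qed
  also have "\<dots> = ennreal (unit_ball_vol CARD('n)) * energy G"
    unfolding energy_def by (rule nn_integral_cmult) measurable
  finally show ?thesis .
qed

text \<open>Only cones with vertex in \<open>ball x0 (\<rho> + \<rho>')\<close> meet the support, so
  Cauchy-Schwarz on that ball applies. This is the passage from L^2 bounds to tent bounds.\<close>

lemma tent1_local_le:
  fixes G :: "real \<times> (real ^ 'n::finite) \<Rightarrow> ennreal"
  assumes [measurable]: "G \<in> borel_measurable borel"
    and supp: "\<And>z. G z \<noteq> 0 \<Longrightarrow> 0 < fst z \<Longrightarrow> fst z < \<rho> \<and> dist (snd z) x0 < \<rho>'"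
  shows "tent1 G \<le> esqrt (emeasure lborel (ball x0 (\<rho> + \<rho>'))) *
    esqrt (ennreal (unit_ball_vol CARD('n)) * energy G)"
proof -
  have "tent1 G \<le> (\<integral>\<^sup>+ x. indicator (ball x0 (\<rho> + \<rho>')) x * esqrt (cone_energy G x) \<partial>lborel)"
    unfolding tent1_def
  proof (intro nn_integral_mono)
    fix x
    have "cone_energy G x = 0" if "x \<notin> ball x0 (\<rho> + \<rho>')"
    proof -
      have "(G z)\<^sup>2 * cone_weight x z = 0" for z
      proof (rule ccontr)
        assume "(G z)\<^sup>2 * cone_weight x z \<noteq> 0"
        then have "G z \<noteq> 0" "0 < fst z" "dist x (snd z) < fst z"
          by (auto simp: cone_weight_def indicator_def split: if_splits)
        with supp[of z] have "dist x0 x < \<rho> + \<rho>'"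
          using dist_triangle[of x x0 "snd z"] by (auto simp: dist_commute)
        with that show False by simp
      qed
      then show ?thesis unfolding cone_energy_def by (simp only: nn_integral_const) simp
    qed
    then show "esqrt (cone_energy G x) \<le> indicator (ball x0 (\<rho> + \<rho>')) x * esqrt (cone_energy G x)"
      by (auto simp: indicator_def)
  qed
  also have "\<dots> \<le> esqrt (\<integral>\<^sup>+ x. (indicator (ball x0 (\<rho> + \<rho>')) x)\<^sup>2 \<partial>lborel) *
      esqrt (\<integral>\<^sup>+ x. (esqrt (cone_energy G x))\<^sup>2 \<partial>lborel)"
    by (rule Cauchy_Schwarz_nn_integral_esqrt) (auto intro!: borel_measurable_indicator)
  also have "(\<integral>\<^sup>+ x. (indicator (ball x0 (\<rho> + \<rho>')) x)\<^sup>2 \<partial>lborel) =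
      (\<integral>\<^sup>+ x. indicator (ball x0 (\<rho> + \<rho>')) x \<partial>lborel)"
    by (intro nn_integral_cong) (auto simp: indicator_def)
  finally show ?thesis
    by (simp add: nn_integral_cone)
qed

section \<open>Monotonicity, subadditivity and dominated convergence for the tent norm\<close>

lemma tent1_mono_AE:
  assumes "AE z in lborel. 0 < fst z \<longrightarrow> G z \<le> H z"
  shows "tent1 G \<le> tent1 H"
proof -
  have "cone_energy G x \<le> cone_energy H x" for x
    unfolding cone_energy_def using assms
    by (intro nn_integral_mono_AE) (auto simp: cone_weight_def indicator_def intro!: mult_right_mono power_mono)
  then show ?thesis
    unfolding tent1_def by (intro nn_integral_mono) simp
qed

lemma tent1_suminf_le:
  assumes [measurable]: "\<And>i::nat. G i \<in> borel_measurable borel"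
  shows "tent1 (\<lambda>z. \<Sum>i. G i z) \<le> (\<Sum>i. tent1 (G i))"
proof -
  have "esqrt (cone_energy (\<lambda>z. \<Sum>i. G i z) x) \<le> (\<Sum>i. esqrt (cone_energy (G i) x))" for x
    using Minkowski_suminf[of G "density lborel (cone_weight x)"]
    by (simp add: cone_energy_def nn_integral_density mult.commute)
  then have "tent1 (\<lambda>z. \<Sum>i. G i z) \<le> (\<integral>\<^sup>+ x. (\<Sum>i. esqrt (cone_energy (G i) x)) \<partial>lborel)"
    unfolding tent1_def by (intro nn_integral_mono)
  also have "\<dots> = (\<Sum>i. tent1 (G i))"
    unfolding tent1_def by (rule nn_integral_suminf) measurable
  finally show ?thesis .
qed

lemma tent1_0 [simp]: "tent1 (\<lambda>z. 0) = 0"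
  by (simp add: tent1_def cone_energy_def)

lemma tent1_add_le:
  assumes [measurable]: "G \<in> borel_measurable borel" "H \<in> borel_measurable borel"
  shows "tent1 (\<lambda>z. G z + H z) \<le> tent1 G + tent1 H"
proof -
  define f where "f i = (if i = 0 then G else if i = Suc 0 then H else (\<lambda>z. 0))" for i :: nat
  have f: "f i \<in> borel_measurable borel" for i
    by (simp add: f_def)
  have "(\<Sum>i. f i z) = G z + H z" for z
    by (subst suminf_finite[of "{0, 1}"]) (auto simp: f_def)
  moreover have "(\<Sum>i. tent1 (f i)) = tent1 G + tent1 H"
    by (subst suminf_finite[of "{0, 1}"]) (auto simp: f_def)
  ultimately show ?thesis
    using tent1_suminf_le[of f] f by simp
qed

text \<open>Dominated convergence is used twice: on the cone at almost every \<open>x\<close>, where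
  the energy of \<open>H\<close> is finite, and then for the integral in \<open>x\<close>. Positive
  heights suffice in the assumptions because \<open>cone_weight\<close> vanishes elsewhere.\<close>

lemma tent1_dominated_convergence:
  assumes [measurable]: "\<And>i. G i \<in> borel_measurable borel" "H \<in> borel_measurable borel"
    and H: "tent1 H < top" "\<And>i z. 0 < fst z \<Longrightarrow> G i z \<le> H z"
    and lim: "\<And>z. 0 < fst z \<Longrightarrow> (\<lambda>i. G i z) \<longlonglongrightarrow> 0"
  shows "(\<lambda>i. tent1 (G i)) \<longlonglongrightarrow> 0"
proof -
  have sq: "(\<lambda>i. (a i)\<^sup>2) \<longlonglongrightarrow> 0" if "a \<longlonglongrightarrow> 0" for a :: "nat \<Rightarrow> ennreal"
    using tendsto_mult_ennreal[OF that that] by (simp add: power2_eq_square)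
  have esq: "(\<lambda>i. esqrt (a i)) \<longlonglongrightarrow> 0" if "a \<longlonglongrightarrow> 0" for a :: "nat \<Rightarrow> ennreal"
  proof (rule order_tendstoI)
    fix e :: ennreal assume "0 < e"
    then have "0 < e\<^sup>2" by (simp add: zero_less_iff_neq_zero)
    with that have "eventually (\<lambda>i. a i < e\<^sup>2) sequentially"
      by (rule order_tendstoD)
    then show "eventually (\<lambda>i. esqrt (a i) < e) sequentially"
      by eventually_elim (simp add: not_le[symmetric] le_esqrt_iff)
  qed simp
  have cle: "cone_energy (G i) x \<le> cone_energy H x" for i x
    unfolding cone_energy_def using H(2)
    by (intro nn_integral_mono) (auto simp: cone_weight_def indicator_def intro!: mult_right_mono power_mono)
  have "AE x in lborel. esqrt (cone_energy H x) \<noteq> \<infinity>"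
    using H(1) unfolding tent1_def by (intro nn_integral_PInf_AE) auto
  then have "AE x in lborel. cone_energy H x < top"
    by eventually_elim (metis esqrt_less_top_iff infinity_ennreal_def less_top)
  then have conv: "AE x in lborel. (\<lambda>i. esqrt (cone_energy (G i) x)) \<longlonglongrightarrow> 0"
  proof eventually_elim
    case (elim x)
    have "(\<lambda>i. \<integral>\<^sup>+ z. (G i z)\<^sup>2 * cone_weight x z \<partial>lborel) \<longlonglongrightarrow> (\<integral>\<^sup>+ z. 0 \<partial>(lborel :: (real \<times> (real ^ 'a)) measure))"
    proof (rule nn_integral_dominated_convergence[where w = "\<lambda>z. (H z)\<^sup>2 * cone_weight x z"])
      show "\<integral>\<^sup>+ z. (H z)\<^sup>2 * cone_weight x z \<partial>lborel < \<infinity>"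
        using elim by (simp add: cone_energy_def)
      show "AE z in lborel. (G j z)\<^sup>2 * cone_weight x z \<le> (H z)\<^sup>2 * cone_weight x z" for j
        using H(2) by (auto simp: cone_weight_def indicator_def intro!: mult_right_mono power_mono)
      show "AE z in lborel. (\<lambda>i. (G i z)\<^sup>2 * cone_weight x z) \<longlonglongrightarrow> 0"
      proof (rule AE_I2)
        fix z :: "real \<times> (real ^ 'a)"
        show "(\<lambda>i. (G i z)\<^sup>2 * cone_weight x z) \<longlonglongrightarrow> 0"
        proof (cases "0 < fst z")
          case True
          have "(\<lambda>i. (G i z)\<^sup>2 * cone_weight x z) \<longlonglongrightarrow> 0 * cone_weight x z"
            by (intro tendsto_mult_ennreal sq lim True tendsto_const)
              (auto simp: cone_weight_def indicator_def)
          then show ?thesis by simp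
        qed (simp add: cone_weight_def)
      qed
    qed measurable
    then show ?case
      by (intro esq) (simp add: cone_energy_def)
  qed
  have "(\<lambda>i. \<integral>\<^sup>+ x. esqrt (cone_energy (G i) x) \<partial>lborel) \<longlonglongrightarrow> (\<integral>\<^sup>+ z. 0 \<partial>(lborel :: (real ^ 'a) measure))"
    by (rule nn_integral_dominated_convergence[where w = "\<lambda>x. esqrt (cone_energy H x)"])
      (use H(1) conv cle in \<open>auto simp: tent1_def\<close>)
  then show ?thesis by (simp add: tent1_def)
qed

section \<open>Dyadic cubes\<close>

text \<open>Height \<open>t\<close> is matched with cubes of side about \<open>t / (n + 1)\<close>, so that every point of such a
  cube lies within distance less than \<open>t\<close> of every other one.\<close>

definition level :: "nat \<Rightarrow> real \<Rightarrow> int" where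
  "level n t = \<lfloor>log 2 (t / (real n + 1))\<rfloor>"

definition dcube :: "int \<Rightarrow> real ^ 'n::finite \<Rightarrow> int ^ 'n" where
  "dcube j x = (\<chi> i. \<lfloor>x $ i / 2 powr j\<rfloor>)"

text \<open>With \<open>Q\<^sub>i\<close> the dyadic cube of side \<open>2^i\<close> containing \<open>x\<close>, \<open>dyadic_energy G j x\<close> is the sum over
  \<open>i \<ge> j\<close> of \<open>|Q\<^sub>i|\<^sup>-\<^sup>1 \<integral> |G|\<^sup>2 dy dt/t\<close> over the Whitney box above \<open>Q\<^sub>i\<close>, written as one integral. It is
  constant on cubes of level \<open>j\<close> and decreasing in \<open>j\<close>.\<close>

definition dyadic_weight :: "real ^ 'n::finite \<Rightarrow> real \<times> (real ^ 'n) \<Rightarrow> ennreal" where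
  "dyadic_weight x z =
     (let j = level CARD('n) (fst z) in
      inv_weight (fst z) * indicator {z. dcube j (snd z) = dcube j x} z *
      ennreal (2 powr (- real_of_int j * real CARD('n))))"

definition dyadic_energy ::
  "(real \<times> (real ^ 'n::finite) \<Rightarrow> ennreal) \<Rightarrow> int \<Rightarrow> real ^ 'n \<Rightarrow> ennreal" where
  "dyadic_energy G j x =
     (\<integral>\<^sup>+ z. (G z)\<^sup>2 * dyadic_weight x z * indicator {z. j \<le> level CARD('n) (fst z)} z \<partial>lborel)"

lemma level_bounds:
  assumes "0 < t"
  shows "(real n + 1) * 2 powr level n t \<le> t" "t < (real n + 1) * 2 powr (level n t + 1)"
proof -
  let ?u = "t / (real n + 1)"
  have u: "0 < ?u" using assms by simp
  have "2 powr level n t \<le> 2 powr log 2 ?u"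
    unfolding level_def by (intro powr_mono) auto
  then have 1: "2 powr level n t \<le> ?u" using u by simp
  have "2 powr log 2 ?u < 2 powr (level n t + 1)"
    unfolding level_def by (intro powr_less_mono) (auto simp: floor_le_iff[symmetric] less_floor_iff)
  then have 2: "?u < 2 powr (level n t + 1)" using u by simp
  show "(real n + 1) * 2 powr level n t \<le> t" "t < (real n + 1) * 2 powr (level n t + 1)"
    using 1 2 by (simp_all add: field_simps)
qed

lemma borel_measurable_level_pred [measurable (raw)]:
  assumes [measurable]: "f \<in> borel_measurable M"
  shows "(\<lambda>x. level n (f x)) \<in> measurable M (count_space UNIV)"
  unfolding level_def by measurable

text \<open>Raising the level divides the integer coordinates by a power of two with rounding down,
  so the coarser coordinates are a function of the finer ones.\<close>

lemma dcube_mono: "dcube j x = dcube j y \<Longrightarrow> j \<le> j' \<Longrightarrow> dcube j' x = dcube j' y"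
proof -
  assume eq: "dcube j x = dcube j y" and le: "j \<le> j'"
  have *: "\<lfloor>a / 2 powr j'\<rfloor> = \<lfloor>a / 2 powr j\<rfloor> div 2 ^ nat (j' - j)" for a :: real
  proof -
    have "2 powr j' = 2 powr j * (2::real) powr (j' - j)"
      by (simp flip: powr_add)
    also have "(2::real) powr (j' - j) = of_int (2 ^ nat (j' - j))"
      using le by (simp add: powr_realpow[symmetric])
    finally have "\<lfloor>a / 2 powr j'\<rfloor> = \<lfloor>(a / 2 powr j) / of_int (2 ^ nat (j' - j))\<rfloor>"
      by (simp only: divide_divide_eq_left)
    also have "\<dots> = \<lfloor>a / 2 powr j\<rfloor> div 2 ^ nat (j' - j)"
      by (rule floor_divide_real_eq_div) simp
    finally show ?thesis .
  qed
  show ?thesis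
    using eq unfolding dcube_def vec_eq_iff by (simp add: *)
qed

lemma dcube_dist_le:
  fixes x y :: "real ^ 'n::finite"
  assumes "dcube j x = dcube j y"
  shows "dist x y \<le> real CARD('n) * 2 powr j"
proof -
  have "\<bar>(x - y) $ i\<bar> \<le> 2 powr j" for i
  proof -
    have "\<lfloor>x $ i / 2 powr j\<rfloor> = \<lfloor>y $ i / 2 powr j\<rfloor>"
      using assms by (simp add: dcube_def vec_eq_iff)
    then have "\<bar>x $ i / 2 powr j - y $ i / 2 powr j\<bar> \<le> 1"
      by linarith
    then show ?thesis
      by (simp add: diff_divide_distrib[symmetric] divide_le_eq)
  qed
  then have "(\<Sum>i\<in>UNIV. \<bar>(x - y) $ i\<bar>) \<le> (\<Sum>i\<in>(UNIV :: 'n set). 2 powr j)"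
    by (intro sum_mono)
  with norm_le_l1_cart[of "x - y"] show ?thesis
    by (simp add: dist_norm)
qed

lemma borel_measurable_dcube_nth:
  assumes f: "f \<in> borel_measurable M"
  shows "(\<lambda>x. real_of_int (dcube j (f x) $ i)) \<in> borel_measurable M"
proof -
  have [measurable]: "(\<lambda>x. f x $ i) \<in> borel_measurable M"
    by (rule measurable_compose[OF f])
      (simp add: borel_measurable_continuous_onI continuous_on_component)
  show ?thesis
    unfolding dcube_def by simp
qed

lemma pred_dcube_eq [measurable (raw)]:
  assumes "f \<in> borel_measurable M" "g \<in> borel_measurable M"
  shows "Measurable.pred M (\<lambda>x. dcube j (f x) = dcube j (g x))"
proof -
  have [measurable]: "(\<lambda>x. real_of_int (dcube j (f x) $ i)) \<in> borel_measurable M"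
    "(\<lambda>x. real_of_int (dcube j (g x) $ i)) \<in> borel_measurable M" for i
    using assms by (auto intro: borel_measurable_dcube_nth)
  have "Measurable.pred M (\<lambda>x. real_of_int (dcube j (f x) $ i) = real_of_int (dcube j (g x) $ i))" for i
    by measurable
  then have "Measurable.pred M (\<lambda>x. \<forall>i. real_of_int (dcube j (f x) $ i) = real_of_int (dcube j (g x) $ i))"
    by (intro pred_intros_countable) auto
  then show ?thesis by (simp add: vec_eq_iff)
qed

lemma pred_dcube_const [measurable (raw)]:
  assumes "f \<in> borel_measurable M"
  shows "Measurable.pred M (\<lambda>x. dcube j (f x) = m)"
proof -
  have [measurable]: "(\<lambda>x. real_of_int (dcube j (f x) $ i)) \<in> borel_measurable M" for i
    using assms by (rule borel_measurable_dcube_nth)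
  have "Measurable.pred M (\<lambda>x. real_of_int (dcube j (f x) $ i) = real_of_int (m $ i))" for i
    by measurable
  then have "Measurable.pred M (\<lambda>x. \<forall>i. real_of_int (dcube j (f x) $ i) = real_of_int (m $ i))"
    by (intro pred_intros_countable) auto
  then show ?thesis by (simp add: vec_eq_iff)
qed

lemma pred_dcube_level [measurable (raw)]:
  assumes [measurable]: "f \<in> borel_measurable M" "g \<in> borel_measurable M" "h \<in> borel_measurable M"
  shows "Measurable.pred M (\<lambda>x. dcube (level n (h x)) (f x) = dcube (level n (h x)) (g x))"
  by (rule measurable_compose_countable[where f = "\<lambda>j x. dcube j (f x) = dcube j (g x)"])
    measurable

lemma dcube_corner: "dcube j (\<chi> i. of_int (m $ i) * 2 powr j) = m"
  by (simp add: dcube_def vec_eq_iff)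

lemma emeasure_dcube:
  fixes m :: "int ^ 'n::finite"
  shows "emeasure lborel {x. dcube j x = m} = ennreal (2 powr (real_of_int j * real CARD('n)))"
proof -
  define l u :: "real ^ 'n" where "l = (\<chi> i. of_int (m $ i) * 2 powr j)" and "u = (\<chi> i. (of_int (m $ i) + 1) * 2 powr j)"
  have le: "\<forall>b\<in>Basis. l \<bullet> b \<le> u \<bullet> b"
    by (auto simp: Basis_vec_def inner_axis l_def u_def)
  have iff: "dcube j x = m \<longleftrightarrow> (\<forall>i. l $ i \<le> x $ i \<and> x $ i < u $ i)" for x
    by (auto simp: dcube_def vec_eq_iff floor_eq_iff l_def u_def field_simps)
  have c: "emeasure lborel (cbox l u) = ennreal (2 powr (real_of_int j * real CARD('n)))"
  proof -
    have "cbox l u \<noteq> {}" using le by (simp add: box_ne_empty)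
    then have "measure lborel (cbox l u) = (\<Prod>i\<in>UNIV. u $ i - l $ i)"
      by (rule content_cbox_cart)
    also have "\<dots> = (\<Prod>i\<in>(UNIV::'n set). 2 powr j)"
      by (intro prod.cong) (auto simp: l_def u_def algebra_simps)
    also have "\<dots> = 2 powr (real_of_int j * real CARD('n))"
      by (simp add: powr_powr[symmetric] powr_realpow)
    finally show ?thesis
      by (metis emeasure_eq_ennreal_measure emeasure_lborel_cbox_finite less_top infinity_ennreal_def top.not_eq_extremum)
  qed
  have b: "emeasure lborel (box l u) = emeasure lborel (cbox l u)"
    using le by (simp add: emeasure_lborel_box_eq emeasure_lborel_cbox_eq)
  have "emeasure lborel (box l u) \<le> emeasure lborel {x. dcube j x = m}"
    by (intro emeasure_mono) (auto simp: iff mem_box_cart less_imp_le)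
  moreover have "emeasure lborel {x. dcube j x = m} \<le> emeasure lborel (cbox l u)"
    by (intro emeasure_mono) (auto simp: iff mem_box_cart less_imp_le)
  ultimately show ?thesis using b c by simp
qed

lemma borel_measurable_dyadic_weight [measurable (raw)]:
  assumes [measurable]: "f \<in> borel_measurable M" "g \<in> borel_measurable M"
  shows "(\<lambda>x. dyadic_weight (f x) (g x)) \<in> borel_measurable M"
  unfolding dyadic_weight_def Let_def by measurable

lemma borel_measurable_dyadic_energy [measurable (raw)]:
  assumes [measurable]: "G \<in> borel_measurable borel" and f: "f \<in> borel_measurable M"
  shows "(\<lambda>x. dyadic_energy G j (f x)) \<in> borel_measurable M"
proof -
  have "dyadic_energy G j \<in> borel_measurable borel"
    unfolding dyadic_energy_def[abs_def] by measurable
  from measurable_compose[OF f this] show ?thesis .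
qed

lemma nn_integral_dyadic_weight:
  "(\<integral>\<^sup>+ x. dyadic_weight x z \<partial>lborel) = inv_weight (fst z)" for z :: "real \<times> (real ^ 'n::finite)"
proof -
  let ?j = "level CARD('n) (fst z)"
  have "(\<integral>\<^sup>+ x. dyadic_weight x z \<partial>lborel) =
     (\<integral>\<^sup>+ x. (inv_weight (fst z) * ennreal (2 powr (- real_of_int ?j * real CARD('n)))) *
        indicator {x. dcube ?j x = dcube ?j (snd z)} x \<partial>lborel)"
    by (intro nn_integral_cong) (auto simp: dyadic_weight_def Let_def indicator_def)
  also have "\<dots> = inv_weight (fst z) * ennreal (2 powr (- real_of_int ?j * real CARD('n))) *
      ennreal (2 powr (real_of_int ?j * real CARD('n)))"
    by (subst nn_integral_cmult_indicator) (auto simp: emeasure_dcube)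
  also have "\<dots> = inv_weight (fst z)"
    by (simp add: mult.assoc flip: ennreal_mult powr_add)
  finally show ?thesis .
qed

definition dyadic_const :: "nat \<Rightarrow> real" where
  "dyadic_const n = (2 * (real n + 1)) ^ n"

lemma dyadic_const_pos: "0 < dyadic_const n"
  by (simp add: dyadic_const_def add_nonneg_pos)

text \<open>Points of one cube of level \<open>j\<close> are at distance at most
  \<open>n * 2^j < (n + 1) * 2^j \<le> t\<close>, so the Whitney box lies in the cone. The upper
  bound \<open>t < 2 (n + 1) 2^j\<close> turns \<open>2^(-j n)\<close> into \<open>t^(-n)\<close> at
  the cost of \<open>dyadic_const\<close>.\<close>

lemma dyadic_weight_le:
  "dyadic_weight x z \<le> ennreal (dyadic_const CARD('n)) * cone_weight x z"
  for x :: "real ^ 'n::finite"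
proof (cases "0 < fst z \<and> dcube (level CARD('n) (fst z)) (snd z) = dcube (level CARD('n) (fst z)) x")
  case True
  let ?n = "CARD('n)" and ?t = "fst z"
  let ?j = "level ?n ?t"
  have t: "0 < ?t" and eq: "dcube ?j (snd z) = dcube ?j x" using True by auto
  have "dist x (snd z) \<le> real ?n * 2 powr ?j"
    using dcube_dist_le[OF eq] by (simp add: dist_commute)
  also have "\<dots> < (real ?n + 1) * 2 powr ?j" by simp
  also have "\<dots> \<le> ?t" by (rule level_bounds(1)[OF t])
  finally have d: "dist x (snd z) < ?t" .
  have "?t \<le> 2 * (real ?n + 1) * 2 powr ?j"
    using level_bounds(2)[OF t, of ?n] by (simp add: powr_add algebra_simps)
  then have "?t ^ ?n \<le> (2 * (real ?n + 1) * 2 powr ?j) ^ ?n"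
    using t by (intro power_mono) auto
  also have "\<dots> = dyadic_const ?n * 2 powr (real_of_int ?j * real ?n)"
    unfolding dyadic_const_def power_mult_distrib[of _ "2 powr ?j"]
    by (simp add: powr_powr[symmetric] powr_realpow)
  finally have "1 / ?t * 2 powr (- real_of_int ?j * real ?n) \<le> dyadic_const ?n * (1 / ?t ^ (?n + 1))"
    using t by (simp add: powr_minus field_simps)
  then have "ennreal (1 / ?t * 2 powr (- real_of_int ?j * real ?n)) \<le>
      ennreal (dyadic_const ?n * (1 / ?t ^ (?n + 1)))"
    by (rule ennreal_leI)
  then have "ennreal (1 / ?t) * ennreal (2 powr (- real_of_int ?j * real ?n)) \<le>
      ennreal (dyadic_const ?n) * ennreal (1 / ?t ^ (?n + 1))"
    using t dyadic_const_pos[of ?n]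
    by (subst (1 2) ennreal_mult[symmetric]) (auto simp: less_imp_le)
  then show ?thesis
    using t d eq by (simp add: dyadic_weight_def cone_weight_def inv_weight_def Let_def)
qed (auto simp: dyadic_weight_def inv_weight_def Let_def)

lemma dyadic_energy_cong:
  assumes "dcube j x = dcube j y"
  shows "dyadic_energy G j x = dyadic_energy G j y"
  unfolding dyadic_energy_def
proof (intro nn_integral_cong)
  fix z :: "real \<times> (real ^ 'a)"
  show "(G z)\<^sup>2 * dyadic_weight x z * indicator {z. j \<le> level CARD('a) (fst z)} z =
      (G z)\<^sup>2 * dyadic_weight y z * indicator {z. j \<le> level CARD('a) (fst z)} z"
    using dcube_mono[OF assms, of "level CARD('a) (fst z)"]
    by (auto simp: indicator_def dyadic_weight_def Let_def)
qed

text \<open>The levels with \<open>dyadic_energy G i x \<le> b\<close> form an upper set, so that they contribute at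
  most \<open>b\<close> to the sum over all levels.\<close>

lemma dyadic_energy_truncated_le:
  fixes G :: "real \<times> (real ^ 'n::finite) \<Rightarrow> ennreal"
  assumes [measurable]: "G \<in> borel_measurable borel"
  shows "(\<integral>\<^sup>+ z. (G z)\<^sup>2 * dyadic_weight x z *
     indicator {z. dyadic_energy G (level CARD('n) (fst z)) x \<le> b} z \<partial>lborel) \<le> b"
proof -
  let ?U = "{i. dyadic_energy G i x \<le> b}"
  \<comment> \<open>The admissible levels need not have a least element. Cutting them off at
    \<open>- N\<close> provides one, and monotone convergence removes the cutoff.\<close>
  let ?f = "\<lambda>N z. (G z)\<^sup>2 * dyadic_weight x z *
    indicator {z. level CARD('n) (fst z) \<in> ?U \<and> - int N \<le> level CARD('n) (fst z)} z"
  have m: "?f N \<in> borel_measurable lborel" for N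
    by measurable
  have "(\<integral>\<^sup>+ z. (G z)\<^sup>2 * dyadic_weight x z *
     indicator {z. dyadic_energy G (level CARD('n) (fst z)) x \<le> b} z \<partial>lborel) =
     (\<integral>\<^sup>+ z. (SUP N. ?f N z) \<partial>lborel)"
  proof (intro nn_integral_cong antisym)
    fix z :: "real \<times> (real ^ 'n)"
    let ?N = "nat (- level CARD('n) (fst z))"
    have "(G z)\<^sup>2 * dyadic_weight x z *
       indicator {z. dyadic_energy G (level CARD('n) (fst z)) x \<le> b} z \<le> ?f ?N z"
      by (auto simp: indicator_def)
    also have "\<dots> \<le> (SUP N. ?f N z)"
      by (rule SUP_upper) simp
    finally show "(G z)\<^sup>2 * dyadic_weight x z *
       indicator {z. dyadic_energy G (level CARD('n) (fst z)) x \<le> b} z \<le> (SUP N. ?f N z)" .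
  qed (auto intro!: SUP_least mult_left_mono simp: indicator_def)
  also have "\<dots> = (SUP N. \<integral>\<^sup>+ z. ?f N z \<partial>lborel)"
  proof (rule nn_integral_monotone_convergence_SUP[OF _ m])
    show "incseq ?f"
      by (auto simp: incseq_def le_fun_def indicator_def intro!: mult_left_mono)
  qed
  also have "\<dots> \<le> b"
  proof (rule SUP_least)
    fix N
    show "(\<integral>\<^sup>+ z. ?f N z \<partial>lborel) \<le> b"
    proof (cases "\<exists>i\<in>?U. - int N \<le> i")
      case True
      \<comment> \<open>The least admissible level above the cutoff, found through natural offsets
        because the integers are not well-ordered. The energy at \<open>i0\<close> covers all levels
        that remain and is itself at most \<open>b\<close>.\<close>
      define i0 where "i0 = - int N + int (LEAST k. - int N + int k \<in> ?U)"
      have "\<exists>k. - int N + int k \<in> ?U"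
        using True by (metis add_minus_cancel diff_add_cancel add.commute nat_0_le diff_ge_0_iff_ge)
      then have i0: "i0 \<in> ?U"
        unfolding i0_def by (rule LeastI_ex)
      have le: "i0 \<le> i" if "i \<in> ?U" "- int N \<le> i" for i
        unfolding i0_def using Least_le[of "\<lambda>k. - int N + int k \<in> ?U" "nat (i + int N)"] that by auto
      have "(\<integral>\<^sup>+ z. ?f N z \<partial>lborel) \<le> dyadic_energy G i0 x"
        unfolding dyadic_energy_def using le
        by (intro nn_integral_mono mult_left_mono) (auto simp: indicator_def dyadic_energy_def)
      then show ?thesis using i0 by auto
    next
      case False
      then have "?f N z = 0" for z by (auto simp: indicator_def)
      then have "(\<integral>\<^sup>+ z. ?f N z \<partial>lborel) = 0" by (simp only: nn_integral_const) simp
      then show ?thesis by (simp only:) simp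
    qed
  qed
  finally show ?thesis .
qed

text \<open>Induction on the largest exponent \<open>b\<close>: the others are distinct and at most
  \<open>b - 1\<close>, hence contribute at most \<open>2^b\<close>.\<close>

lemma sum_powr_2_le:
  assumes "finite K" "\<And>k. k \<in> K \<Longrightarrow> k \<le> (M::int)"
  shows "(\<Sum>k\<in>K. 2 powr real_of_int k) \<le> 2 * 2 powr real_of_int M"
  using assms
proof (induction K arbitrary: M rule: finite_linorder_max_induct)
  case (insert b A)
  have "(\<Sum>k\<in>A. 2 powr real_of_int k) \<le> 2 * 2 powr real_of_int (b - 1)"
    by (rule insert.IH) (use insert.hyps in force)
  also have "\<dots> = 2 powr real_of_int b"
    by (simp add: powr_diff)
  finally have "(\<Sum>k\<in>insert b A. 2 powr real_of_int k) \<le> 2 * 2 powr real_of_int b"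
    using insert.hyps by (subst sum.insert) auto
  also have "\<dots> \<le> 2 * 2 powr real_of_int M"
    using insert.prems by simp
  finally show ?case .
qed simp

section \<open>Atomic decomposition\<close>

definition dyadic_total ::
  "(real \<times> (real ^ 'n::finite) \<Rightarrow> ennreal) \<Rightarrow> real ^ 'n \<Rightarrow> ennreal" where
  "dyadic_total G x = (\<integral>\<^sup>+ z. (G z)\<^sup>2 * dyadic_weight x z \<partial>lborel)"

text \<open>The stopping cubes at height \<open>k\<close> are the maximal dyadic cubes with energy above \<open>4^k\<close>; a Whitney
  box whose energy lies between \<open>4^k\<close> and \<open>4^(k + 1)\<close> belongs to the atom of its stopping cube.\<close>

definition top_cube ::
  "(real \<times> (real ^ 'n::finite) \<Rightarrow> ennreal) \<Rightarrow> int \<Rightarrow> int \<Rightarrow> real ^ 'n \<Rightarrow> bool" where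
  "top_cube G k j y \<longleftrightarrow> ennreal (4 powr k) < dyadic_energy G j y \<and>
     (\<forall>i. j < i \<longrightarrow> dyadic_energy G i y \<le> ennreal (4 powr k))"

definition tent_atom ::
  "(real \<times> (real ^ 'n::finite) \<Rightarrow> ennreal) \<Rightarrow> int \<Rightarrow> int \<Rightarrow> int ^ 'n \<Rightarrow> (real \<times> (real ^ 'n)) set" where
  "tent_atom G k j m = {z. 0 < fst z \<and> level CARD('n) (fst z) \<le> j \<and>
     ennreal (4 powr k) < dyadic_energy G (level CARD('n) (fst z)) (snd z) \<and>
     dyadic_energy G (level CARD('n) (fst z)) (snd z) \<le> ennreal (4 powr (real_of_int k + 1)) \<and>
     dcube j (snd z) = m \<and> top_cube G k j (snd z)}"

lemma esqrt_4_powr: "esqrt (ennreal (4 powr k)) = ennreal (2 powr k)"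
  by (simp add: esqrt_ennreal powr_half_sqrt[symmetric] powr_powr)

lemma borel_measurable_dyadic_total [measurable (raw)]:
  assumes [measurable]: "G \<in> borel_measurable borel" and f: "f \<in> borel_measurable M"
  shows "(\<lambda>x. dyadic_total G (f x)) \<in> borel_measurable M"
proof -
  have "dyadic_total G \<in> borel_measurable borel"
    unfolding dyadic_total_def[abs_def] by measurable
  from measurable_compose[OF f this] show ?thesis .
qed

lemma borel_measurable_dyadic_energy_level [measurable (raw)]:
  assumes [measurable]: "G \<in> borel_measurable borel" "f \<in> borel_measurable M" "h \<in> borel_measurable M"
  shows "(\<lambda>x. dyadic_energy G (level n (h x)) (f x)) \<in> borel_measurable M"
  by (rule measurable_compose_countable[where f = "\<lambda>j x. dyadic_energy G j (f x)"]) measurable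

lemma dyadic_energy_le_total: "dyadic_energy G j x \<le> dyadic_total G x"
  unfolding dyadic_energy_def dyadic_total_def
  by (intro nn_integral_mono) (auto simp: indicator_def)

lemma dyadic_total_le:
  fixes G :: "real \<times> (real ^ 'n::finite) \<Rightarrow> ennreal"
  assumes [measurable]: "G \<in> borel_measurable borel"
  shows "dyadic_total G x \<le> ennreal (dyadic_const CARD('n)) * cone_energy G x"
proof -
  have "dyadic_total G x \<le> (\<integral>\<^sup>+ z. (G z)\<^sup>2 * (ennreal (dyadic_const CARD('n)) * cone_weight x z) \<partial>lborel)"
    unfolding dyadic_total_def
    by (intro nn_integral_mono mult_left_mono dyadic_weight_le) auto
  also have "\<dots> = (\<integral>\<^sup>+ z. ennreal (dyadic_const CARD('n)) * ((G z)\<^sup>2 * cone_weight x z) \<partial>lborel)"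
    by (simp add: mult_ac)
  also have "\<dots> = ennreal (dyadic_const CARD('n)) * cone_energy G x"
    unfolding cone_energy_def by (rule nn_integral_cmult) measurable
  finally show ?thesis .
qed

lemma nn_integral_dyadic_total_le:
  fixes G :: "real \<times> (real ^ 'n::finite) \<Rightarrow> ennreal"
  assumes [measurable]: "G \<in> borel_measurable borel"
  shows "(\<integral>\<^sup>+ x. esqrt (dyadic_total G x) \<partial>lborel) \<le> esqrt (ennreal (dyadic_const CARD('n))) * tent1 G"
proof -
  have "(\<integral>\<^sup>+ x. esqrt (dyadic_total G x) \<partial>lborel) \<le>
      (\<integral>\<^sup>+ x. esqrt (ennreal (dyadic_const CARD('n))) * esqrt (cone_energy G x) \<partial>lborel)"
    by (intro nn_integral_mono) (simp add: dyadic_total_le flip: esqrt_mult)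
  also have "\<dots> = esqrt (ennreal (dyadic_const CARD('n))) * tent1 G"
    unfolding tent1_def by (rule nn_integral_cmult) measurable
  finally show ?thesis .
qed

text \<open>In \<open>x\<close> the weight \<open>dyadic_weight x z\<close> integrates to
  \<open>inv_weight (fst z)\<close>. Bounds on truncated dyadic energies at a fixed \<open>x\<close>
  thereby become bounds on energies of regions.\<close>

lemma energy_eq_dyadic:
  fixes G :: "real \<times> (real ^ 'n::finite) \<Rightarrow> ennreal"
  assumes [measurable]: "G \<in> borel_measurable borel" "Measurable.pred borel P"
  shows "(\<integral>\<^sup>+ z. (G z)\<^sup>2 * inv_weight (fst z) * indicator {z. P z} z \<partial>lborel) =
     (\<integral>\<^sup>+ x. \<integral>\<^sup>+ z. (G z)\<^sup>2 * dyadic_weight x z * indicator {z. P z} z \<partial>lborel \<partial>lborel)"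
proof -
  have "(\<integral>\<^sup>+ x. \<integral>\<^sup>+ z. (G z)\<^sup>2 * dyadic_weight x z * indicator {z. P z} z \<partial>lborel \<partial>lborel) =
     (\<integral>\<^sup>+ z. \<integral>\<^sup>+ x. ((G z)\<^sup>2 * indicator {z. P z} z) * dyadic_weight x z \<partial>lborel \<partial>lborel)"
    by (subst nn_integral_lborel_swap) (measurable, simp add: mult_ac)
  also have "\<dots> = (\<integral>\<^sup>+ z. (G z)\<^sup>2 * indicator {z. P z} z * inv_weight (fst z) \<partial>lborel)"
    by (subst nn_integral_cmult) (auto simp: nn_integral_dyadic_weight)
  finally show ?thesis by (simp add: mult_ac)
qed

text \<open>On the cube of level \<open>j\<close> around \<open>x\<close> the energy of level
  \<open>j\<close> is constant and bounded by the total. As the right side does not depend on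
  \<open>j\<close>, large cubes carry small energy, which is what makes stopping cubes
  exist.\<close>

lemma dyadic_energy_cube_le:
  fixes G :: "real \<times> (real ^ 'n::finite) \<Rightarrow> ennreal"
  assumes [measurable]: "G \<in> borel_measurable borel"
  shows "ennreal (2 powr (real_of_int j * real CARD('n))) * esqrt (dyadic_energy G j x) \<le>
    (\<integral>\<^sup>+ y. esqrt (dyadic_total G y) \<partial>lborel)"
proof -
  have "ennreal (2 powr (real_of_int j * real CARD('n))) * esqrt (dyadic_energy G j x) =
    (\<integral>\<^sup>+ y. esqrt (dyadic_energy G j x) * indicator {y. dcube j y = dcube j x} y \<partial>lborel)"
    by (subst nn_integral_cmult_indicator) (auto simp: emeasure_dcube mult.commute)
  also have "\<dots> \<le> (\<integral>\<^sup>+ y. esqrt (dyadic_total G y) \<partial>lborel)"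
    by (intro nn_integral_mono)
      (auto simp: indicator_def dyadic_energy_le_total dest: dyadic_energy_cong[of _ _ _ G, symmetric])
  finally show ?thesis .
qed

lemma pred_top_cube [measurable (raw)]:
  assumes [measurable]: "G \<in> borel_measurable borel" "f \<in> borel_measurable M"
  shows "Measurable.pred M (\<lambda>x. top_cube G k j (f x))"
  unfolding top_cube_def by measurable

lemma tent_atom_measurable:
  assumes [measurable]: "G \<in> borel_measurable borel"
  shows "tent_atom G k j m \<in> sets borel"
  unfolding tent_atom_def by measurable

lemma top_cube_cong:
  assumes "dcube j x = dcube j y" shows "top_cube G k j x = top_cube G k j y"
  unfolding top_cube_def
  using dyadic_energy_cong[OF assms, of G] dyadic_energy_cong[OF dcube_mono[OF assms], of _ G]
  by (auto simp: less_imp_le)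

lemma top_cube_unique: "top_cube G k i x \<Longrightarrow> top_cube G k j x \<Longrightarrow> i = j"
  unfolding top_cube_def by (metis linorder_neq_iff not_less)

text \<open>Seen from a fixed \<open>x\<close>, all boxes of the atom have energy at most
  \<open>4^(k + 1)\<close>, and \<open>dyadic_energy_truncated_le\<close> bounds their joint
  contribution by the same number. Boxes of level at most \<open>j\<close> lie inside the stopping
  cube, so only \<open>x\<close> in that cube contribute.\<close>

lemma energy_tent_atom_le:
  fixes G :: "real \<times> (real ^ 'n::finite) \<Rightarrow> ennreal"
  assumes [measurable]: "G \<in> borel_measurable borel"
  shows "energy (\<lambda>z. indicator (tent_atom G k j m) z * G z) \<le>
    ennreal (4 powr (real_of_int k + 1)) * ennreal (2 powr (real_of_int j * real CARD('n)))"
proof -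
  note [measurable] = tent_atom_measurable[OF assms]
  have "energy (\<lambda>z. indicator (tent_atom G k j m) z * G z) =
     (\<integral>\<^sup>+ z. (G z)\<^sup>2 * inv_weight (fst z) * indicator {z. z \<in> tent_atom G k j m} z \<partial>lborel)"
    unfolding energy_def by (intro nn_integral_cong) (auto simp: indicator_def)
  also have "\<dots> = (\<integral>\<^sup>+ x. \<integral>\<^sup>+ z. (G z)\<^sup>2 * dyadic_weight x z * indicator {z. z \<in> tent_atom G k j m} z \<partial>lborel \<partial>lborel)"
    by (rule energy_eq_dyadic) measurable
  also have "\<dots> \<le> (\<integral>\<^sup>+ x. ennreal (4 powr (real_of_int k + 1)) * indicator {x. dcube j x = m} x \<partial>lborel)"
  proof (intro nn_integral_mono)
    fix x :: "real ^ 'n"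
    have *: "(G z)\<^sup>2 * dyadic_weight x z * indicator {z. z \<in> tent_atom G k j m} z \<le>
      (G z)\<^sup>2 * dyadic_weight x z *
         indicator {z. dyadic_energy G (level CARD('n) (fst z)) x \<le> ennreal (4 powr (real_of_int k + 1))} z *
         indicator {x. dcube j x = m} x" for z
    proof (cases "z \<in> tent_atom G k j m \<and> dcube (level CARD('n) (fst z)) (snd z) = dcube (level CARD('n) (fst z)) x")
      case True
      then have eq: "dcube (level CARD('n) (fst z)) (snd z) = dcube (level CARD('n) (fst z)) x"
        and z: "level CARD('n) (fst z) \<le> j" "dcube j (snd z) = m"
          "dyadic_energy G (level CARD('n) (fst z)) (snd z) \<le> ennreal (4 powr (real_of_int k + 1))"
        by (auto simp: tent_atom_def)
      then show ?thesis
        using dcube_mono[OF eq z(1)] dyadic_energy_cong[OF eq, of G]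
        by (auto simp: indicator_def)
    qed (auto simp: dyadic_weight_def Let_def)
    have "(\<integral>\<^sup>+ z. (G z)\<^sup>2 * dyadic_weight x z * indicator {z. z \<in> tent_atom G k j m} z \<partial>lborel) \<le>
      (\<integral>\<^sup>+ z. (G z)\<^sup>2 * dyadic_weight x z *
         indicator {z. dyadic_energy G (level CARD('n) (fst z)) x \<le> ennreal (4 powr (real_of_int k + 1))} z *
         indicator {x. dcube j x = m} x \<partial>lborel)"
      by (intro nn_integral_mono *)
    also have "\<dots> = (\<integral>\<^sup>+ z. (G z)\<^sup>2 * dyadic_weight x z *
         indicator {z. dyadic_energy G (level CARD('n) (fst z)) x \<le> ennreal (4 powr (real_of_int k + 1))} z \<partial>lborel) *
         indicator {x. dcube j x = m} x"
      by (rule nn_integral_multc) measurable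
    also have "\<dots> \<le> ennreal (4 powr (real_of_int k + 1)) * indicator {x. dcube j x = m} x"
      by (intro mult_right_mono dyadic_energy_truncated_le) auto
    finally show "(\<integral>\<^sup>+ z. (G z)\<^sup>2 * dyadic_weight x z * indicator {z. z \<in> tent_atom G k j m} z \<partial>lborel) \<le>
      ennreal (4 powr (real_of_int k + 1)) * indicator {x. dcube j x = m} x" .
  qed
  also have "\<dots> = ennreal (4 powr (real_of_int k + 1)) * ennreal (2 powr (real_of_int j * real CARD('n)))"
    by (subst nn_integral_cmult_indicator) (auto simp: emeasure_dcube)
  finally show ?thesis .
qed

lemma dyadic_energy_finite:
  fixes G :: "real \<times> (real ^ 'n::finite) \<Rightarrow> ennreal"
  assumes [measurable]: "G \<in> borel_measurable borel" and "tent1 G < top"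
  shows "dyadic_energy G j x < top"
proof -
  have "ennreal (2 powr (real_of_int j * real CARD('n))) * esqrt (dyadic_energy G j x) \<le>
      esqrt (ennreal (dyadic_const CARD('n))) * tent1 G"
    using dyadic_energy_cube_le nn_integral_dyadic_total_le by (rule order_trans) measurable
  also have "\<dots> < top"
    using assms(2) by (simp add: ennreal_mult_less_top)
  finally have "esqrt (dyadic_energy G j x) < top"
    by (auto simp: ennreal_mult_less_top)
  then show ?thesis by simp
qed

text \<open>The bands between powers of 4 never contain the value 0, so boxes of zero energy must be
  negligible. This is the truncation bound with \<open>b = 0\<close>, integrated in
  \<open>x\<close>.\<close>

lemma AE_dyadic_energy_pos:
  fixes G :: "real \<times> (real ^ 'n::finite) \<Rightarrow> ennreal"
  assumes [measurable]: "G \<in> borel_measurable borel"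
  shows "AE z in lborel. 0 < fst z \<longrightarrow> G z \<noteq> 0 \<longrightarrow>
    0 < dyadic_energy G (level CARD('n) (fst z)) (snd z)"
proof -
  let ?N = "\<lambda>z. dyadic_energy G (level CARD('n) (fst z)) (snd z) = 0"
  have "(\<integral>\<^sup>+ z. (G z)\<^sup>2 * inv_weight (fst z) * indicator {z. ?N z} z \<partial>lborel) =
     (\<integral>\<^sup>+ x. \<integral>\<^sup>+ z. (G z)\<^sup>2 * dyadic_weight x z * indicator {z. ?N z} z \<partial>lborel \<partial>lborel)"
    by (rule energy_eq_dyadic) measurable
  also have "\<dots> \<le> (\<integral>\<^sup>+ x. 0 \<partial>(lborel :: (real ^ 'n) measure))"
  proof (intro nn_integral_mono)
    fix x :: "real ^ 'n"
    have *: "(G z)\<^sup>2 * dyadic_weight x z * indicator {z. ?N z} z \<le>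
      (G z)\<^sup>2 * dyadic_weight x z * indicator {z. dyadic_energy G (level CARD('n) (fst z)) x \<le> 0} z" for z
      using dyadic_energy_cong[of "level CARD('n) (fst z)" "snd z" x G]
      by (auto simp: dyadic_weight_def Let_def indicator_def)
    show "(\<integral>\<^sup>+ z. (G z)\<^sup>2 * dyadic_weight x z * indicator {z. ?N z} z \<partial>lborel) \<le> 0"
      by (rule order_trans[OF nn_integral_mono[OF *] dyadic_energy_truncated_le]) measurable
  qed
  finally have "(\<integral>\<^sup>+ z. (G z)\<^sup>2 * inv_weight (fst z) * indicator {z. ?N z} z \<partial>lborel) = 0"
    by simp
  then have "AE z in lborel. (G z)\<^sup>2 * inv_weight (fst z) * indicator {z. ?N z} z = 0"
    by (subst (asm) nn_integral_0_iff_AE) measurable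
  then show ?thesis
    by eventually_elim (auto simp: inv_weight_def indicator_def zero_less_iff_neq_zero)
qed

lemma ex_dyadic_band:
  assumes "0 < s" "s < (top::ennreal)"
  obtains k :: int where "ennreal (4 powr k) < s" "s \<le> ennreal (4 powr (real_of_int k + 1))"
proof -
  obtain a where a: "s = ennreal a" "0 < a"
    using assms by (cases s) auto
  \<comment> \<open>Ceiling minus one, because the band is open below and closed above; the strict
    lower bound is the one demanded by \<open>top_cube\<close>.\<close>
  define k where "k = \<lceil>log 4 a\<rceil> - 1"
  have "4 powr k < 4 powr log 4 a"
    unfolding k_def by (intro powr_less_mono) linarith+
  moreover have "4 powr log 4 a \<le> 4 powr (real_of_int k + 1)"
    unfolding k_def by (intro powr_mono) linarith+
  ultimately show ?thesis
    using a by (intro that[of k]) (simp_all add: ennreal_less_iff)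
qed

text \<open>Energy above \<open>4^k\<close> on a cube of level \<open>j\<close> forces
  \<open>2^(j n) * 2^k \<le> J\<close>. Levels above the threshold are therefore bounded from above,
  and the largest one gives the stopping cube.\<close>

lemma ex_tent_atom:
  fixes G :: "real \<times> (real ^ 'n::finite) \<Rightarrow> ennreal"
  assumes [measurable]: "G \<in> borel_measurable borel" and fin: "tent1 G < top"
    and z: "0 < fst z" "0 < dyadic_energy G (level CARD('n) (fst z)) (snd z)"
  shows "\<exists>k j m. z \<in> tent_atom G k j m"
proof -
  let ?i = "level CARD('n) (fst z)"
  obtain k :: int where k: "ennreal (4 powr k) < dyadic_energy G ?i (snd z)"
    "dyadic_energy G ?i (snd z) \<le> ennreal (4 powr (real_of_int k + 1))"
    using ex_dyadic_band[OF z(2) dyadic_energy_finite[OF assms(1) fin]] .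
  let ?P = "\<lambda>j. ennreal (4 powr k) < dyadic_energy G j (snd z)"
  obtain J where J: "0 \<le> J" "(\<integral>\<^sup>+ y. esqrt (dyadic_total G y) \<partial>lborel) = ennreal J"
  proof -
    have "(\<integral>\<^sup>+ y. esqrt (dyadic_total G y) \<partial>lborel) < top"
      using fin by (intro order_le_less_trans[OF nn_integral_dyadic_total_le[OF assms(1)]])
        (simp add: ennreal_mult_less_top)
    then show ?thesis
      using that by (cases "\<integral>\<^sup>+ y. esqrt (dyadic_total G y) \<partial>lborel") auto
  qed
  \<comment> \<open>For \<open>0 \<le> j\<close> one has \<open>j \<le> j * n\<close>, so the bound
    on the volume bounds \<open>j\<close> itself. \<open>J\<close> may be 0; \<open>J + 1\<close>
    keeps the argument of the logarithm positive.\<close>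
  have bound: "real_of_int j \<le> log 2 (J + 1) - k" if "?P j" "0 \<le> j" for j
  proof -
    have "ennreal (2 powr (real_of_int j * real CARD('n))) * ennreal (2 powr k) \<le>
       ennreal (2 powr (real_of_int j * real CARD('n))) * esqrt (dyadic_energy G j (snd z))"
      using that by (intro mult_left_mono) (auto simp flip: esqrt_4_powr)
    also have "\<dots> \<le> ennreal J"
      using dyadic_energy_cube_le[OF assms(1), of j "snd z"] J by simp
    finally have "2 powr (real_of_int j * real CARD('n) + k) \<le> J"
      using J by (simp add: powr_add flip: ennreal_mult')
    also have "J < J + 1" by simp
    finally have "real_of_int j * real CARD('n) + k < log 2 (J + 1)"
      using J by (simp add: less_log_iff)
    moreover have "real_of_int j * 1 \<le> real_of_int j * real CARD('n)"
      using that by (intro mult_left_mono) (auto simp: Suc_le_eq)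
    ultimately show ?thesis by simp
  qed
  define B where "B = max 0 \<lceil>log 2 (J + 1) - k\<rceil>"
  have B: "j \<le> B" if "?P j" for j
    using bound[OF that] by (cases "0 \<le> j") (auto simp: B_def le_max_iff_disj; linarith)+
  \<comment> \<open>Starting at the level of \<open>z\<close> makes the set finite and places the
    box inside the stopping cube. Maximality is not weakened: a level above \<open>Max T\<close> is
    also above \<open>?i\<close>.\<close>
  define T where "T = {j. ?i \<le> j \<and> ?P j}"
  have "finite T"
    using B by (intro finite_subset[of T "{?i..B}"]) (auto simp: T_def)
  moreover have "?i \<in> T" using k by (simp add: T_def)
  ultimately have M: "Max T \<in> T" "\<And>j. j \<in> T \<Longrightarrow> j \<le> Max T"
    by (auto intro: Max_in)
  have "top_cube G k (Max T) (snd z)"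
    unfolding top_cube_def
  proof (intro conjI allI impI)
    show "?P (Max T)" using M(1) by (simp add: T_def)
    fix i assume "Max T < i"
    moreover have "i \<in> T" if "?P i"
      using that M(1) \<open>Max T < i\<close> by (auto simp: T_def)
    ultimately show "dyadic_energy G i (snd z) \<le> ennreal (4 powr k)"
      using M(2)[of i] by (auto simp: not_less[symmetric])
  qed
  then have "z \<in> tent_atom G k (Max T) (dcube (Max T) (snd z))"
    using M k z by (auto simp: tent_atom_def T_def)
  then show ?thesis by blast
qed

text \<open>For each height \<open>k\<close> at most one stopping cube contains \<open>x\<close>, so
  the heights that occur are distinct, and each satisfies \<open>2^k \<le> sqrt d\<close>. The
  geometric sum costs a factor 2, the exponent \<open>k + 1\<close> another.\<close>

lemma sum_top_cubes_le:
  fixes G :: "real \<times> (real ^ 'n::finite) \<Rightarrow> ennreal" and kj :: "nat \<Rightarrow> int \<times> int"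
  assumes "\<And>l. P l \<Longrightarrow> top_cube G (fst (kj l)) (snd (kj l)) x"
    and inj: "inj_on kj {l. P l}"
  shows "(\<Sum>l. if P l then ennreal (2 powr (real_of_int (fst (kj l)) + 1)) else 0) \<le> 4 * esqrt (dyadic_total G x)"
proof (cases "dyadic_total G x")
  case (real d)
  have inj': "inj_on (fst \<circ> kj) {l. P l}"
  proof (intro inj_onI)
    fix a b assume "a \<in> {l. P l}" "b \<in> {l. P l}" "(fst \<circ> kj) a = (fst \<circ> kj) b"
    then show "a = b"
      using assms(1)[of a] assms(1)[of b] top_cube_unique[of G "fst (kj a)"] inj_onD[OF inj, of a b]
      by (auto simp: prod_eq_iff)
  qed
  have le: "2 powr real_of_int (fst (kj l)) \<le> sqrt d" if "P l" for l
  proof -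
    have "ennreal (4 powr fst (kj l)) \<le> ennreal d"
      using assms(1)[OF that] dyadic_energy_le_total[of G "snd (kj l)" x]
      unfolding top_cube_def real(2) by (meson less_imp_le order_less_le_trans)
    then have "esqrt (ennreal (4 powr fst (kj l))) \<le> esqrt (ennreal d)"
      by simp
    then show ?thesis
      using real by (simp add: esqrt_4_powr esqrt_ennreal)
  qed
  have "(\<Sum>l<N. if P l then ennreal (2 powr (real_of_int (fst (kj l)) + 1)) else 0) \<le> 4 * esqrt (dyadic_total G x)" for N
  proof -
    let ?L = "{l. l < N \<and> P l}" and ?K = "(fst \<circ> kj) ` {l. l < N \<and> P l}"
    have "(\<Sum>l<N. if P l then ennreal (2 powr (real_of_int (fst (kj l)) + 1)) else 0) =
       (\<Sum>l\<in>?L. ennreal (2 powr (real_of_int (fst (kj l)) + 1)))"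
      by (intro sum.mono_neutral_cong_right) auto
    also have "\<dots> = (\<Sum>k\<in>?K. ennreal (2 powr (real_of_int k + 1)))"
      by (subst sum.reindex) (auto intro: inj_on_subset[OF inj'])
    also have "\<dots> = ennreal (2 * (\<Sum>k\<in>?K. 2 powr real_of_int k))"
      by (simp add: powr_add sum_distrib_left mult.commute)
    also have "\<dots> \<le> ennreal (4 * sqrt d)"
    proof (cases "?K = {}")
      case False
      have fin: "finite ?K" by auto
      have "Max ?K \<in> ?K" using False fin by (intro Max_in) auto
      then have "2 powr real_of_int (Max ?K) \<le> sqrt d"
        using le by auto
      moreover have "(\<Sum>k\<in>?K. 2 powr real_of_int k) \<le> 2 * 2 powr real_of_int (Max ?K)"
        by (rule sum_powr_2_le[OF fin]) (rule Max_ge[OF fin])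
      ultimately show ?thesis by (intro ennreal_leI) linarith
    next
      case True
      then show ?thesis using real by (simp only: True sum.empty) simp
    qed
    also have "\<dots> = 4 * esqrt (dyadic_total G x)"
      using real by (simp add: esqrt_ennreal ennreal_mult')
    finally show ?thesis .
  qed
  then show ?thesis
    by (auto simp: suminf_eq_SUP intro!: SUP_least)
qed (simp add: ennreal_mult_top)

text \<open>The centre is a corner of the stopping cube. The radius \<open>2 (n + 1) 2^j\<close> is
  dictated by the heights, whose level is at most \<open>j\<close>, and exceeds the bound
  \<open>n * 2^j\<close> for the diameter of the cube.\<close>

lemma tent_atom_subset:
  fixes m :: "int ^ 'n::finite"
  assumes "z \<in> tent_atom G k j m"
  shows "0 < fst z" "fst z < 2 * (real CARD('n) + 1) * 2 powr j"
    "dist (snd z) (\<chi> i. of_int (m $ i) * 2 powr j) < 2 * (real CARD('n) + 1) * 2 powr j"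
proof -
  let ?n = "CARD('n)"
  show t: "0 < fst z" using assms by (simp add: tent_atom_def)
  have "fst z < (real ?n + 1) * 2 powr (level ?n (fst z) + 1)"
    by (rule level_bounds[OF t])
  also have "\<dots> \<le> (real ?n + 1) * 2 powr (real_of_int j + 1)"
    using assms by (intro mult_left_mono powr_mono) (auto simp: tent_atom_def)
  finally show "fst z < 2 * (real ?n + 1) * 2 powr j"
    by (simp add: powr_add algebra_simps)
  have "dcube j (snd z) = dcube j (\<chi> i. of_int (m $ i) * 2 powr j)"
    using assms by (simp add: tent_atom_def dcube_corner)
  then have "dist (snd z) (\<chi> i. of_int (m $ i) * 2 powr j) \<le> real ?n * 2 powr j"
    by (rule dcube_dist_le)
  also have "\<dots> < 2 * (real ?n + 1) * 2 powr j"
    by (intro mult_strict_right_mono) auto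
  finally show "dist (snd z) (\<chi> i. of_int (m $ i) * 2 powr j) < 2 * (real CARD('n) + 1) * 2 powr j" .
qed

text \<open>The energy band determines \<open>k\<close>, uniqueness of the stopping cube at height
  \<open>k\<close> determines \<open>j\<close>, and the position determines
  \<open>m\<close>.\<close>

lemma tent_atom_disjoint:
  assumes "z \<in> tent_atom G k j m" "z \<in> tent_atom G k' j' m'"
  shows "(k, j, m) = (k', j', m')"
proof -
  have *: "\<not> k < k'" if "z \<in> tent_atom G k j m" "z \<in> tent_atom G k' j' m'" for k j m k' j' m'
  proof
    assume "k < k'"
    then have "ennreal (4 powr (real_of_int k + 1)) \<le> ennreal (4 powr real_of_int k')"
      by (intro ennreal_leI powr_mono) auto
    also have "\<dots> < dyadic_energy G (level CARD('a) (fst z)) (snd z)"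
      using that(2) by (simp add: tent_atom_def)
    also have "\<dots> \<le> ennreal (4 powr (real_of_int k + 1))"
      using that(1) by (simp add: tent_atom_def)
    finally show False by simp
  qed
  from *[OF assms] *[OF assms(2,1)] have k: "k = k'" by simp
  with assms top_cube_unique[of G k j "snd z" j'] show ?thesis
    by (auto simp: tent_atom_def)
qed

theorem atomic_decomposition:
  fixes G :: "real \<times> (real ^ 'n::finite) \<Rightarrow> ennreal"
  assumes G[measurable]: "G \<in> borel_measurable borel" and fin: "tent1 G < top"
  obtains A :: "nat \<Rightarrow> (real \<times> (real ^ 'n)) set" and x0 :: "nat \<Rightarrow> real ^ 'n" and r :: "nat \<Rightarrow> real"
  where "\<And>l. A l \<in> sets borel" "disjoint_family A" "\<And>l. 0 < r l"
    "\<And>l z. z \<in> A l \<Longrightarrow> 0 < fst z \<and> fst z < r l \<and> dist (snd z) (x0 l) < r l"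
    "AE z in lborel. 0 < fst z \<longrightarrow> G z \<noteq> 0 \<longrightarrow> (\<exists>l. z \<in> A l)"
    "(\<Sum>l. esqrt (ennreal (r l ^ CARD('n)) * energy (\<lambda>z. indicator (A l) z * G z))) \<le>
      ennreal (4 * dyadic_const CARD('n)) * tent1 G"
proof -
  let ?n = "CARD('n)"
  define dec where "dec l = (from_nat l :: int \<times> int \<times> (int ^ 'n))" for l
  define k j m where "k l = fst (dec l)" and "j l = fst (snd (dec l))" and "m l = snd (snd (dec l))" for l
  \<comment> \<open>\<open>from_nat\<close> may hit a triple more than once. Only the canonical code
    receives the atom, so that the family is disjoint.\<close>
  define A where "A l = (if to_nat (dec l) = l then tent_atom G (k l) (j l) (m l) else {})" for l
  define x0 where "x0 l = (\<chi> i. of_int (m l $ i) * 2 powr j l)" for l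
  define r where "r l = 2 * (real ?n + 1) * 2 powr j l" for l
  have A[measurable]: "A l \<in> sets borel" for l
    using tent_atom_measurable[OF G] by (simp add: A_def)
  have same: "l = l'" if "to_nat (dec l) = l" "to_nat (dec l') = l'" "k l = k l'" "j l = j l'" "m l = m l'" for l l'
    using that by (metis k_def j_def m_def prod.collapse)
  have "disjoint_family A"
    unfolding disjoint_family_on_def
  proof safe
    fix l l' a b assume ne: "l \<noteq> l'" and "(a, b) \<in> A l" "(a, b) \<in> A l'"
    then have "(a, b) \<in> tent_atom G (k l) (j l) (m l)" "(a, b) \<in> tent_atom G (k l') (j l') (m l')"
      "to_nat (dec l) = l" "to_nat (dec l') = l'"
      by (auto simp: A_def split: if_splits)
    with tent_atom_disjoint[OF this(1,2)] same[of l l'] ne show "(a, b) \<in> {}"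
      by auto
  qed
  moreover have "0 < r l" for l
    by (simp add: r_def add_nonneg_pos)
  moreover have "0 < fst z \<and> fst z < r l \<and> dist (snd z) (x0 l) < r l" if "z \<in> A l" for l z
    using that tent_atom_subset[of z G "k l" "j l" "m l"]
    by (auto simp: A_def r_def x0_def split: if_splits)
  moreover have "AE z in lborel. 0 < fst z \<longrightarrow> G z \<noteq> 0 \<longrightarrow> (\<exists>l. z \<in> A l)"
    using AE_dyadic_energy_pos[OF G]
  proof eventually_elim
    case (elim z)
    show ?case
    proof safe
      assume "0 < fst z" "G z \<noteq> 0"
      with ex_tent_atom[OF G fin, of z] elim obtain k' j' m' where "z \<in> tent_atom G k' j' m'"
        by auto
      then have "z \<in> A (to_nat (k', j', m'))"
        by (simp add: A_def k_def j_def m_def dec_def)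
      then show "\<exists>l. z \<in> A l" ..
    qed
  qed
  moreover have "(\<Sum>l. esqrt (ennreal (r l ^ ?n) * energy (\<lambda>z. indicator (A l) z * G z))) \<le>
      ennreal (4 * dyadic_const ?n) * tent1 G"
  proof -
    let ?c = "esqrt (ennreal (dyadic_const ?n))"
    let ?Q = "\<lambda>l. {x. dcube (j l) x = m l}"
    \<comment> \<open>\<open>dyadic_const\<close> is exactly the ratio of \<open>r^n\<close> to the
      volume of the stopping cube. Its square root \<open>?c\<close> enters here and once more when
      dyadic and conical square functions are compared, which restores \<open>dyadic_const\<close>
      in the final constant.\<close>
    have r: "ennreal (r l ^ ?n) = ennreal (dyadic_const ?n) * ennreal (2 powr (real_of_int (j l) * real ?n))" for l
      unfolding r_def dyadic_const_def power_mult_distrib[of _ "2 powr j l"]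
      by (simp add: powr_powr[symmetric] powr_realpow flip: ennreal_mult)
    have term_le: "esqrt (ennreal (r l ^ ?n) * energy (\<lambda>z. indicator (A l) z * G z)) \<le>
       ?c * (if A l \<noteq> {} then ennreal (2 powr (real_of_int (k l) + 1)) * ennreal (2 powr (real_of_int (j l) * real ?n)) else 0)" for l
    proof (cases "A l = {}")
      case False
      then have "A l = tent_atom G (k l) (j l) (m l)" by (auto simp: A_def)
      then have "ennreal (r l ^ ?n) * energy (\<lambda>z. indicator (A l) z * G z) \<le>
        ennreal (r l ^ ?n) * (ennreal (4 powr (real_of_int (k l) + 1)) * ennreal (2 powr (real_of_int (j l) * real ?n)))"
        by (intro mult_left_mono) (auto simp: energy_tent_atom_le)
      then have "esqrt (ennreal (r l ^ ?n) * energy (\<lambda>z. indicator (A l) z * G z)) \<le>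
        esqrt (ennreal (dyadic_const ?n) * ennreal (4 powr (real_of_int (k l) + 1)) *
          (ennreal (2 powr (real_of_int (j l) * real ?n)))\<^sup>2)"
        unfolding r by (simp add: power2_eq_square mult_ac)
      with False show ?thesis
        by (simp add: esqrt_mult esqrt_4_powr mult.assoc)
    qed (simp add: energy_def)
    have "(\<Sum>l. esqrt (ennreal (r l ^ ?n) * energy (\<lambda>z. indicator (A l) z * G z))) \<le>
       (\<Sum>l. ?c * (if A l \<noteq> {} then ennreal (2 powr (real_of_int (k l) + 1)) * ennreal (2 powr (real_of_int (j l) * real ?n)) else 0))"
      by (intro suminf_le term_le) auto
    \<comment> \<open>The volume of each stopping cube is written as an integral over the cube, so
      that the atoms can be summed pointwise in \<open>x\<close> by
      \<open>sum_top_cubes_le\<close>.\<close>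
    also have "\<dots> = ?c * (\<Sum>l. \<integral>\<^sup>+ x. (if A l \<noteq> {} \<and> x \<in> ?Q l then ennreal (2 powr (real_of_int (k l) + 1)) else 0) \<partial>lborel)"
    proof (subst ennreal_suminf_cmult, intro arg_cong[of _ _ "(*) ?c"] suminf_cong)
      fix l
      show "(if A l \<noteq> {} then ennreal (2 powr (real_of_int (k l) + 1)) * ennreal (2 powr (real_of_int (j l) * real ?n)) else 0) =
        (\<integral>\<^sup>+ x. (if A l \<noteq> {} \<and> x \<in> ?Q l then ennreal (2 powr (real_of_int (k l) + 1)) else 0) \<partial>lborel)"
      proof (cases "A l = {}")
        case False
        have "(\<integral>\<^sup>+ x. (if A l \<noteq> {} \<and> x \<in> ?Q l then ennreal (2 powr (real_of_int (k l) + 1)) else 0) \<partial>lborel) =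
          (\<integral>\<^sup>+ x. ennreal (2 powr (real_of_int (k l) + 1)) * indicator (?Q l) x \<partial>lborel)"
          using False by (intro nn_integral_cong) (auto simp: indicator_def)
        with False show ?thesis
          by (subst (asm) nn_integral_cmult_indicator) (auto simp: emeasure_dcube)
      qed simp
    qed
    also have "(\<Sum>l. \<integral>\<^sup>+ x. (if A l \<noteq> {} \<and> x \<in> ?Q l then ennreal (2 powr (real_of_int (k l) + 1)) else 0) \<partial>lborel) =
       (\<integral>\<^sup>+ x. (\<Sum>l. if A l \<noteq> {} \<and> x \<in> ?Q l then ennreal (2 powr (real_of_int (k l) + 1)) else 0) \<partial>lborel)"
      by (rule nn_integral_suminf[symmetric]) measurable
    also have "\<dots> \<le> (\<integral>\<^sup>+ x. 4 * esqrt (dyadic_total G x) \<partial>lborel)"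
    proof (intro nn_integral_mono)
      fix x :: "real ^ 'n"
      have "(\<Sum>l. if A l \<noteq> {} \<and> x \<in> ?Q l then ennreal (2 powr (real_of_int (fst (k l, j l)) + 1)) else 0) \<le>
        4 * esqrt (dyadic_total G x)"
      proof (rule sum_top_cubes_le)
        fix l assume *: "A l \<noteq> {} \<and> x \<in> ?Q l"
        then obtain z where "z \<in> tent_atom G (k l) (j l) (m l)"
          by (auto simp: A_def split: if_splits)
        with * have "top_cube G (k l) (j l) (snd z)" "dcube (j l) (snd z) = dcube (j l) x"
          by (auto simp: tent_atom_def)
        then show "top_cube G (fst (k l, j l)) (snd (k l, j l)) x"
          using top_cube_cong[of "j l" "snd z" x G "k l"] by simp
      next
        show "inj_on (\<lambda>l. (k l, j l)) {l. A l \<noteq> {} \<and> x \<in> ?Q l}"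
        proof (intro inj_onI)
          fix l l' assume l: "l \<in> {l. A l \<noteq> {} \<and> x \<in> ?Q l}" "l' \<in> {l. A l \<noteq> {} \<and> x \<in> ?Q l}"
            and eq: "(k l, j l) = (k l', j l')"
          have "to_nat (dec l) = l" "to_nat (dec l') = l'"
            using l by (simp_all add: A_def split: if_splits)
          moreover have eq': "k l = k l'" "j l = j l'"
            using eq by simp_all
          moreover have "m l = m l'"
          proof -
            have "dcube (j l) x = m l" "dcube (j l') x = m l'"
              using l by blast+
            then show ?thesis unfolding eq'(2) by (rule trans[OF sym])
          qed
          ultimately show "l = l'"
            by (rule same)
        qed
      qed
      then show "(\<Sum>l. if A l \<noteq> {} \<and> x \<in> ?Q l then ennreal (2 powr (real_of_int (k l) + 1)) else 0) \<le>
        4 * esqrt (dyadic_total G x)"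
        by (simp only: fst_conv)
    qed
    also have "\<dots> = 4 * (\<integral>\<^sup>+ x. esqrt (dyadic_total G x) \<partial>lborel)"
      by (rule nn_integral_cmult) measurable
    also have "\<dots> \<le> 4 * (?c * tent1 G)"
      by (intro mult_left_mono nn_integral_dyadic_total_le) auto
    finally have "(\<Sum>l. esqrt (ennreal (r l ^ ?n) * energy (\<lambda>z. indicator (A l) z * G z))) \<le>
       ?c * (4 * (?c * tent1 G))"
      by (simp add: mult_left_mono)
    also have "\<dots> = 4 * ?c\<^sup>2 * tent1 G"
      by (simp only: power2_eq_square mult_ac)
    also have "\<dots> = ennreal (4 * dyadic_const ?n) * tent1 G"
      by (simp add: ennreal_mult')
    finally show ?thesis .
  qed
  ultimately show ?thesis
    using A by (intro that[of A r x0]) auto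
qed

text \<open>At a fixed level \<open>j\<close> the square root of the energy is bounded uniformly in
  \<open>x\<close> and dominated by an integrable function, so the energy itself is integrable in
  \<open>x\<close>. Every dyadic strip of heights thus has finite energy, even if the whole function
  has not.\<close>

lemma AE_slice_finite:
  fixes G :: "real \<times> (real ^ 'n::finite) \<Rightarrow> ennreal"
  assumes G[measurable]: "G \<in> borel_measurable borel" and fin: "tent1 G < top"
  shows "AE t in lborel. 0 < t \<longrightarrow> (\<integral>\<^sup>+ y. (G (t, y))\<^sup>2 \<partial>lborel) < top"
proof -
  let ?n = "CARD('n)"
  let ?J = "\<integral>\<^sup>+ x. esqrt (dyadic_total G x) \<partial>lborel"
  have J: "?J < top"
    using fin by (intro order_le_less_trans[OF nn_integral_dyadic_total_le[OF G]])
      (simp add: ennreal_mult_less_top)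
  have "AE t in lborel. \<forall>j. 0 < t \<longrightarrow> level ?n t = j \<longrightarrow> (\<integral>\<^sup>+ y. (G (t, y))\<^sup>2 \<partial>lborel) < top"
    unfolding AE_all_countable
  proof
    fix j :: int
    define B where "B = ?J * ennreal (2 powr (- (real_of_int j * real ?n)))"
    have B: "B < top"
      unfolding B_def using J by (simp add: ennreal_mult_less_top)
    have eB: "esqrt (dyadic_energy G j x) \<le> B" for x
    proof -
      have "esqrt (dyadic_energy G j x) = ennreal (2 powr (real_of_int j * real ?n)) *
          esqrt (dyadic_energy G j x) * ennreal (2 powr (- (real_of_int j * real ?n)))"
        by (subst mult.commute, subst mult.assoc[symmetric], subst ennreal_mult[symmetric])
          (simp_all flip: powr_add)
      also have "\<dots> \<le> B"
        unfolding B_def by (intro mult_right_mono dyadic_energy_cube_le) auto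
      finally show ?thesis .
    qed
    let ?f = "\<lambda>z. (G z)\<^sup>2 * inv_weight (fst z) * indicator {z. level ?n (fst z) = j} z"
    have "(\<integral>\<^sup>+ z. ?f z \<partial>lborel) =
       (\<integral>\<^sup>+ x. \<integral>\<^sup>+ z. (G z)\<^sup>2 * dyadic_weight x z * indicator {z. level ?n (fst z) = j} z \<partial>lborel \<partial>lborel)"
      by (rule energy_eq_dyadic) measurable
    also have "\<dots> \<le> (\<integral>\<^sup>+ x. B * esqrt (dyadic_total G x) \<partial>lborel)"
    proof (intro nn_integral_mono)
      fix x :: "real ^ 'n"
      have "(\<integral>\<^sup>+ z. (G z)\<^sup>2 * dyadic_weight x z * indicator {z. level ?n (fst z) = j} z \<partial>lborel) \<le> dyadic_energy G j x"
        unfolding dyadic_energy_def by (intro nn_integral_mono mult_left_mono) (auto simp: indicator_def)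
      also have "\<dots> = esqrt (dyadic_energy G j x) * esqrt (dyadic_energy G j x)"
        by (simp flip: power2_eq_square)
      also have "\<dots> \<le> B * esqrt (dyadic_total G x)"
        by (intro mult_mono eB) (auto simp: dyadic_energy_le_total)
      finally show "(\<integral>\<^sup>+ z. (G z)\<^sup>2 * dyadic_weight x z * indicator {z. level ?n (fst z) = j} z \<partial>lborel) \<le>
        B * esqrt (dyadic_total G x)" .
    qed
    also have "\<dots> = B * ?J" by (rule nn_integral_cmult) measurable
    also have "\<dots> < top" using B J by (simp add: ennreal_mult_less_top)
    finally have fin: "(\<integral>\<^sup>+ t. \<integral>\<^sup>+ y. ?f (t, y) \<partial>lborel \<partial>lborel) < top"
      by (subst nn_integral_lborel_fst) measurable
    have "AE t in lborel. (\<integral>\<^sup>+ y. ?f (t, y) \<partial>lborel) \<noteq> \<infinity>"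
      using fin by (intro nn_integral_PInf_AE) auto
    then show "AE t in lborel. 0 < t \<longrightarrow> level ?n t = j \<longrightarrow> (\<integral>\<^sup>+ y. (G (t, y))\<^sup>2 \<partial>lborel) < top"
    proof eventually_elim
      case (elim t)
      show ?case
      proof safe
        assume t: "0 < t" "j = level ?n t"
        then have "(\<integral>\<^sup>+ y. ?f (t, y) \<partial>lborel) = (\<integral>\<^sup>+ y. (G (t, y))\<^sup>2 * ennreal (1 / t) \<partial>lborel)"
          by (intro nn_integral_cong) (auto simp: inv_weight_def)
        also have "\<dots> = (\<integral>\<^sup>+ y. (G (t, y))\<^sup>2 \<partial>lborel) * ennreal (1 / t)"
          by (rule nn_integral_multc) measurable
        finally show "(\<integral>\<^sup>+ y. (G (t, y))\<^sup>2 \<partial>lborel) < top"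
          using elim t by (auto simp: ennreal_mult_eq_top_iff less_top)
      qed
    qed
  qed
  then show ?thesis by eventually_elim auto
qed

section \<open>Approximation of bounded functions\<close>

text \<open>A Dynkin argument for functions: boxes form an intersection-stable generator, from which
  one reaches Borel sets, simple functions and bounded functions. The fixed outer box and the common
  bounds are there to make dominated convergence available in the limit case. It serves both the
  measurable versions and the density of test functions.\<close>

lemma bounded_box_supported_induct [consumes 2, case_names box add lim]:
  fixes P :: "('a::euclidean_space \<Rightarrow> 'b::euclidean_space) \<Rightarrow> bool"
  assumes f: "f \<in> borel_measurable borel" and bd: "\<And>z. norm (f z) \<le> B * indicator (box a b) z"
    and box: "\<And>c d w. box c d \<subseteq> box a b \<Longrightarrow> P (\<lambda>z. indicator (box c d) z *\<^sub>R w)"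
    and add: "\<And>f g B. P f \<Longrightarrow> P g \<Longrightarrow> f \<in> borel_measurable borel \<Longrightarrow> g \<in> borel_measurable borel \<Longrightarrow>
      (\<And>z. norm (f z) \<le> B * indicator (box a b) z) \<Longrightarrow> (\<And>z. norm (g z) \<le> B * indicator (box a b) z) \<Longrightarrow>
      P (\<lambda>z. f z + g z)"
    and lim: "\<And>f g B. (\<And>i::nat. P (f i)) \<Longrightarrow> (\<And>i. f i \<in> borel_measurable borel) \<Longrightarrow>
      g \<in> borel_measurable borel \<Longrightarrow> (\<And>i z. norm (f i z) \<le> B * indicator (box a b) z) \<Longrightarrow>
      (\<And>z. (\<lambda>i. f i z) \<longlonglongrightarrow> g z) \<Longrightarrow> P g"
  shows "P f"
proof -
  let ?U = "box a b"
  have [measurable]: "?U \<in> sets borel" by simp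
  have zero: "P (\<lambda>z. 0)"
    using box[of a a 0] by simp
  have sum: "P (\<lambda>z. \<Sum>v\<in>V. h v z)" if "finite V" "\<And>v. v \<in> V \<Longrightarrow> P (h v)"
    "\<And>v. v \<in> V \<Longrightarrow> h v \<in> borel_measurable borel" "\<And>v z. v \<in> V \<Longrightarrow> norm (h v z) \<le> C v * indicator ?U z"
    for V :: "'b set" and h :: "'b \<Rightarrow> 'a \<Rightarrow> 'b" and C :: "'b \<Rightarrow> real"
    using that
  proof (induction V rule: finite_induct)
    case (insert v V)
    have "P (\<lambda>z. h v z + (\<Sum>v\<in>V. h v z))"
    proof (rule add[where B = "\<bar>C v\<bar> + (\<Sum>v\<in>V. \<bar>C v\<bar>)"])
      fix z
      have 1: "norm (h u z) \<le> \<bar>C u\<bar> * indicator ?U z" if "u \<in> insert v V" for u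
        using insert.prems(3)[OF that, of z] by (auto simp: indicator_def split: if_splits)
      have nn: "0 \<le> (\<Sum>v\<in>V. \<bar>C v\<bar>)" by (simp add: sum_nonneg)
      show "norm (h v z) \<le> (\<bar>C v\<bar> + (\<Sum>v\<in>V. \<bar>C v\<bar>)) * indicator ?U z"
        by (rule order_trans[OF 1]) (auto intro!: mult_right_mono sum_nonneg)
      have "norm (\<Sum>v\<in>V. h v z) \<le> (\<Sum>v\<in>V. \<bar>C v\<bar> * indicator ?U z)"
        by (rule sum_norm_le) (use 1 in auto)
      then show "norm (\<Sum>v\<in>V. h v z) \<le> (\<bar>C v\<bar> + (\<Sum>v\<in>V. \<bar>C v\<bar>)) * indicator ?U z"
        by (auto simp: indicator_def split: if_splits)
    qed (use insert in auto)
    then show ?case using insert.hyps by simp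
  qed (simp add: zero)
  have sets: "P (\<lambda>z. indicator (A \<inter> ?U) z *\<^sub>R w)" if "A \<in> sets borel" for A w
  proof -
    let ?E = "range (\<lambda>(c, d). box c d) :: 'a set set"
    have "Int_stable ?E"
      unfolding Int_stable_def by (auto simp: box_Int_box)
    moreover have "?E \<subseteq> Pow UNIV" by simp
    moreover have "A \<in> sigma_sets UNIV ?E"
      using that unfolding borel_eq_box by (simp add: sets_measure_of)
    ultimately have "\<forall>w. P (\<lambda>z. indicator (A \<inter> ?U) z *\<^sub>R w)"
    proof (induction rule: sigma_sets_induct_disjoint)
      case (basic A)
      then obtain c d where A: "A = box c d" by auto
      have "\<exists>c' d'. A \<inter> ?U = box c' d'"
        unfolding A box_Int_box by blast
      then show ?case
        using box by (metis inf_le2)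
    next
      case empty
      then show ?case by (simp add: zero)
    next
      case (compl A)
      then have [measurable]: "A \<in> sets borel"
        unfolding borel_eq_box by (simp add: sets_measure_of)
      show ?case
      proof
        fix w
        \<comment> \<open>Only sums are at hand, so the complement relative to the box is obtained
          by adding the indicator of \<open>A\<close> with the vector \<open>- w\<close>.\<close>
        have "P (\<lambda>z. indicator ?U z *\<^sub>R w + indicator (A \<inter> ?U) z *\<^sub>R (- w))"
        proof (rule add[where B = "norm w"])
          show "P (\<lambda>z. indicator ?U z *\<^sub>R w)"
            by (rule box) simp
          show "P (\<lambda>z. indicator (A \<inter> ?U) z *\<^sub>R (- w))"
            using compl.IH by blast
        qed (auto simp: indicator_def)
        also have "(\<lambda>z. indicator ?U z *\<^sub>R w + indicator (A \<inter> ?U) z *\<^sub>R (- w)) =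
          (\<lambda>z. indicator ((UNIV - A) \<inter> ?U) z *\<^sub>R w)"
          by (auto simp: indicator_def)
        finally show "P (\<lambda>z. indicator ((UNIV - A) \<inter> ?U) z *\<^sub>R w)" .
      qed
    next
      case (union A)
      then have [measurable]: "A i \<in> sets borel" for i
        unfolding borel_eq_box by (auto simp add: sets_measure_of)
      show ?case
      proof
        fix w
        have partial: "P (\<lambda>z. indicator ((\<Union>i<N. A i) \<inter> ?U) z *\<^sub>R w)" for N
        proof (induction N)
          case (Suc N)
          have "P (\<lambda>z. indicator ((\<Union>i<N. A i) \<inter> ?U) z *\<^sub>R w + indicator (A N \<inter> ?U) z *\<^sub>R w)"
          proof (rule add[where B = "norm w"])
            show "P (\<lambda>z. indicator (A N \<inter> ?U) z *\<^sub>R w)"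
              using union.IH by blast
            show "P (\<lambda>z. indicator ((\<Union>i<N. A i) \<inter> ?U) z *\<^sub>R w)"
              by (rule Suc)
          qed (auto simp: indicator_def)
          also have "(\<lambda>z. indicator ((\<Union>i<N. A i) \<inter> ?U) z *\<^sub>R w + indicator (A N \<inter> ?U) z *\<^sub>R w) =
            (\<lambda>z. indicator ((\<Union>i<Suc N. A i) \<inter> ?U) z *\<^sub>R w)"
          proof
            fix z
            have "z \<notin> A i" if "z \<in> A N" "i < N" for i
              using union.hyps(1) that by (auto dest: disjoint_family_onD[of A UNIV i N])
            then show "indicator ((\<Union>i<N. A i) \<inter> ?U) z *\<^sub>R w + indicator (A N \<inter> ?U) z *\<^sub>R w =
              indicator ((\<Union>i<Suc N. A i) \<inter> ?U) z *\<^sub>R w"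
              by (cases "z \<in> A N") (auto simp: indicator_def less_Suc_eq)
          qed
          finally show ?case .
        qed (simp add: zero)
        show "P (\<lambda>z. indicator ((\<Union>i. A i) \<inter> ?U) z *\<^sub>R w)"
        proof (rule lim[where B = "norm w"])
          show "P (\<lambda>z. indicator ((\<Union>i<N. A i) \<inter> ?U) z *\<^sub>R w)" for N
            by (rule partial)
          show "(\<lambda>N. indicator ((\<Union>i<N. A i) \<inter> ?U) z *\<^sub>R w) \<longlonglongrightarrow>
            indicator ((\<Union>i. A i) \<inter> ?U) z *\<^sub>R w" for z
          proof (cases "\<exists>i. z \<in> A i")
            case True
            then obtain i where "z \<in> A i" ..
            then show ?thesis
              by (intro tendsto_eventually eventually_sequentiallyI[of "Suc i"])
                (auto simp: indicator_def)
          qed (auto simp: indicator_def)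
          show "norm (indicator ((\<Union>i<N. A i) \<inter> ?U) z *\<^sub>R w) \<le> norm w * indicator ?U z" for N z
            by (auto simp: indicator_def)
        qed measurable
      qed
    qed
    then show ?thesis by blast
  qed
  have simple: "P (\<lambda>z. indicator ?U z *\<^sub>R h z)" if h: "simple_function borel h" for h
  proof -
    have fin: "finite (range h)" and pre: "h -` {v} \<in> sets borel" for v
      using h by (auto simp: simple_function_def) (metis Int_UNIV_right rangeE simple_functionD(2) space_borel h)
    note pre[measurable]
    have "P (\<lambda>z. \<Sum>v\<in>range h. indicator (h -` {v} \<inter> ?U) z *\<^sub>R v)"
    proof (rule sum[where C = norm])
      show "(\<lambda>z. indicator (h -` {v} \<inter> ?U) z *\<^sub>R v) \<in> borel_measurable borel" for v
        by measurable
      show "P (\<lambda>z. indicator (h -` {v} \<inter> ?U) z *\<^sub>R v)" for v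
        by (rule sets[OF pre])
    qed (use fin in \<open>auto simp: indicator_def\<close>)
    also have "(\<lambda>z. \<Sum>v\<in>range h. indicator (h -` {v} \<inter> ?U) z *\<^sub>R v) = (\<lambda>z. indicator ?U z *\<^sub>R h z)"
    proof
      fix z
      have "(\<Sum>v\<in>range h. indicator (h -` {v} \<inter> ?U) z *\<^sub>R v) = (\<Sum>v\<in>range h. if v = h z then indicator ?U z *\<^sub>R v else 0)"
        by (intro sum.cong) (auto simp: indicator_def)
      then show "(\<Sum>v\<in>range h. indicator (h -` {v} \<inter> ?U) z *\<^sub>R v) = indicator ?U z *\<^sub>R h z"
        using fin by simp
    qed
    finally show ?thesis .
  qed
  \<comment> \<open>The simple approximants are bounded by twice \<open>|f|\<close>; hence the bound
    \<open>2 * B\<close> below.\<close>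
  obtain F where F: "\<And>i. simple_function borel (F i)" "\<And>x. (\<lambda>i. F i x) \<longlonglongrightarrow> f x"
    "\<And>i x. dist (F i x) 0 \<le> 2 * dist (f x) 0"
    using borel_measurable_implies_sequence_metric[OF f, of 0] by auto
  have [measurable]: "F i \<in> borel_measurable borel" for i
    using F(1) by (rule borel_measurable_simple_function)
  have "P (\<lambda>z. indicator ?U z *\<^sub>R f z)"
  proof (rule lim[where f = "\<lambda>i z. indicator ?U z *\<^sub>R F i z" and B = "2 * B"])
    show "norm (indicator ?U z *\<^sub>R F i z) \<le> 2 * B * indicator ?U z" for i z
      using F(3)[of i z] bd[of z] by (auto simp: indicator_def split: if_splits)
    show "(\<lambda>i. indicator ?U z *\<^sub>R F i z) \<longlonglongrightarrow> indicator ?U z *\<^sub>R f z" for z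
      by (intro tendsto_intros F)
  qed (use f simple[OF F(1)] in measurable)
  also have "(\<lambda>z. indicator ?U z *\<^sub>R f z) = f"
  proof
    fix z show "indicator ?U z *\<^sub>R f z = f z"
      using bd[of z] by (cases "z \<in> ?U") auto
  qed
  finally show ?thesis .
qed

section \<open>Measurable versions of the kernel\<close>

definition l2 :: "('n::finite, 'm::finite) vfun \<Rightarrow> ennreal" where
  "l2 u = (\<integral>\<^sup>+ x. (enorm (u x))\<^sup>2 \<partial>lborel)"

lemma Lp_norm_2: "Lp_norm 2 u = esqrt (l2 u)"
proof -
  have "norm (u x) powr 2 = (norm (u x))\<^sup>2" for x
    by (cases "norm (u x) = 0") (auto simp: powr_numeral)
  then show ?thesis by (simp add: Lp_norm_def l2_def ennreal_power)
qed

lemma Lp_2_iff: "u \<in> Lp 2 \<longleftrightarrow> u \<in> borel_measurable borel \<and> l2 u < top"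
  by (simp add: Lp_def Lp_norm_2)

lemma l2_cong_AE: "(AE x in lborel. u x = v x) \<Longrightarrow> l2 u = l2 v"
  unfolding l2_def by (intro nn_integral_cong_AE) auto

lemma l2_add_le:
  assumes [measurable]: "u \<in> borel_measurable borel" "v \<in> borel_measurable borel"
  shows "l2 (\<lambda>x. u x + v x) \<le> 2 * l2 u + 2 * l2 v"
proof -
  have "l2 (\<lambda>x. u x + v x) \<le> (\<integral>\<^sup>+ x. 2 * (enorm (u x))\<^sup>2 + 2 * (enorm (v x))\<^sup>2 \<partial>lborel)"
    unfolding l2_def
  proof (intro nn_integral_mono)
    fix x
    have "enorm (u x + v x) \<le> enorm (u x) + enorm (v x)"
      by (simp add: norm_triangle_ineq ennreal_leI flip: ennreal_plus)
    then have "(enorm (u x + v x))\<^sup>2 \<le> (enorm (u x) + enorm (v x))\<^sup>2"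
      by (rule power_mono) simp
    then show "(enorm (u x + v x))\<^sup>2 \<le> 2 * (enorm (u x))\<^sup>2 + 2 * (enorm (v x))\<^sup>2"
      using ennreal_add_power2_le by (rule order_trans)
  qed
  also have "\<dots> = 2 * l2 u + 2 * l2 v"
    unfolding l2_def by (simp add: nn_integral_add nn_integral_cmult)
  finally show ?thesis .
qed

lemma norm_vector_scalar_mult: "norm (c *s x) = norm c * norm (x :: complex ^ 'm::finite)"
  by (simp add: norm_vec_def norm_mult L2_set_right_distrib)

lemma borel_measurable_vector_scalar_mult [measurable (raw)]:
  fixes g :: "'a \<Rightarrow> complex ^ 'm::finite"
  assumes "f \<in> borel_measurable M" "g \<in> borel_measurable M"
  shows "(\<lambda>x. f x *s g x) \<in> borel_measurable M"
proof -
  have "continuous_on UNIV (\<lambda>p :: complex \<times> (complex ^ 'm). fst p *s snd p)"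
    unfolding vector_scalar_mult_def by (intro continuous_intros)
  then show ?thesis
    using borel_measurable_continuous_Pair[of f M g "(*s)"] assms by simp
qed

lemma l2_scale: "u \<in> borel_measurable borel \<Longrightarrow> l2 (\<lambda>x. c *s u x) = (enorm c)\<^sup>2 * l2 u"
  unfolding l2_def
  by (simp add: norm_vector_scalar_mult ennreal_mult' power_mult_distrib nn_integral_cmult)

lemma Lp_2_add: "u \<in> Lp 2 \<Longrightarrow> v \<in> Lp 2 \<Longrightarrow> (\<lambda>x. u x + v x) \<in> Lp 2"
  unfolding Lp_2_iff
  by (auto intro!: order_le_less_trans[OF l2_add_le] simp: ennreal_mult_less_top)

lemma Lp_2_scale: "u \<in> Lp 2 \<Longrightarrow> (\<lambda>x. c *s u x) \<in> Lp 2"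
  unfolding Lp_2_iff
  by (auto simp: l2_scale ennreal_mult_less_top power_less_top_ennreal)

lemma diff_conv_add_scale: "u - v = u + (- 1) *s (v :: complex ^ 'm::finite)"
  by (simp add: vec_eq_iff vector_scalar_mult_def)

lemma Lp_2_diff: "u \<in> Lp 2 \<Longrightarrow> v \<in> Lp 2 \<Longrightarrow> (\<lambda>x. u x - v x) \<in> Lp 2"
  unfolding diff_conv_add_scale by (intro Lp_2_add Lp_2_scale)

lemma l2_cutoff_le: "l2 (cutoff E u) \<le> l2 u"
  unfolding l2_def cutoff_def
  by (intro nn_integral_mono power_mono ennreal_leI) (auto simp: indicator_def)

lemma l2_indicator_le: "l2 (\<lambda>y. indicator B y *\<^sub>R u y) \<le> l2 u"
  using l2_cutoff_le[of B u] by (simp add: cutoff_def)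

lemma Lp_2_indicator:
  assumes [measurable]: "B \<in> sets borel" and "u \<in> Lp 2"
  shows "(\<lambda>y. indicator B y *\<^sub>R u y) \<in> Lp 2"
proof -
  have [measurable]: "u \<in> borel_measurable borel" using assms by (simp add: Lp_2_iff)
  have "l2 (\<lambda>y. indicator B y *\<^sub>R u y) < top"
    using assms(2) by (intro order_le_less_trans[OF l2_indicator_le]) (simp add: Lp_2_iff)
  then show ?thesis by (simp add: Lp_2_iff)
qed

text \<open>\<open>op_norm\<close> is an infimum, so the inequality is known only for constants
  slightly above it. The slack \<open>d = e / (v + 1)\<close> costs at most \<open>e\<close>, and
  its denominator is positive even for \<open>v = 0\<close>.\<close>

lemma op_norm_le:
  assumes op: "op_norm X n1 n2 A \<le> ennreal M" and "f \<in> X" "n1 f < top" "0 \<le> M"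
  shows "n2 (A f) \<le> ennreal M * n1 f"
proof -
  obtain v where v: "0 \<le> v" "n1 f = ennreal v"
    using assms(3) by (cases "n1 f") auto
  have "n2 (A f) \<le> ennreal (M * v)"
  proof (rule ennreal_le_epsilon)
    fix e :: real assume e: "0 < e"
    define d where "d = e / (v + 1)"
    have d: "0 < d" "d * v \<le> e"
      using e v by (auto simp: d_def field_simps)
    have "ennreal M < ennreal (M + d)"
      using d assms(4) by (simp add: ennreal_less_iff)
    with op have "Inf {c. \<forall>f\<in>X. n2 (A f) \<le> c * n1 f} < ennreal (M + d)"
      unfolding op_norm_def by (rule order_le_less_trans)
    then obtain c where c: "\<forall>f\<in>X. n2 (A f) \<le> c * n1 f" "c < ennreal (M + d)"
      by (auto simp: Inf_less_iff)
    have "n2 (A f) \<le> c * n1 f" using c assms by auto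
    also have "\<dots> \<le> ennreal (M + d) * ennreal v"
      using c v by (intro mult_mono) auto
    also have "\<dots> = ennreal ((M + d) * v)"
      using v d assms(4) by (simp add: ennreal_mult')
    also have "\<dots> \<le> ennreal (M * v + e)"
      using d by (intro ennreal_leI) (simp add: algebra_simps)
    also have "\<dots> = ennreal (M * v) + ennreal e"
      using v e assms(4) by (simp add: ennreal_plus)
    finally show "n2 (A f) \<le> ennreal (M * v) + ennreal e" .
  qed
  with v assms(4) show ?thesis by (simp add: ennreal_mult')
qed

section \<open>Fubini's theorem for almost everywhere statements\<close>

lemma AE_lborel_snd:
  assumes "AE s in (lborel :: 'b::euclidean_space measure). P s"
  shows "AE ts in (lborel :: ('a::euclidean_space \<times> 'b) measure). P (snd ts)"
proof -
  obtain N where N: "{s. \<not> P s} \<subseteq> N" "emeasure lborel N = 0" "N \<in> sets borel"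
    using AE_E[OF assms] by auto
  then have [measurable]: "N \<in> sets borel" by simp
  have "(\<integral>\<^sup>+ ts. indicator N (snd ts) \<partial>(lborel :: ('a \<times> 'b) measure)) =
      (\<integral>\<^sup>+ t. \<integral>\<^sup>+ s. indicator N (snd (t :: 'a, s)) \<partial>lborel \<partial>lborel)"
    by (rule nn_integral_lborel_fst[symmetric]) measurable
  also have "\<dots> = 0" using N by simp
  finally have "AE ts in (lborel :: ('a \<times> 'b) measure). indicator N (snd ts) = (0 :: ennreal)"
    by (subst (asm) nn_integral_0_iff_AE) measurable
  then show ?thesis
    by eventually_elim (use N in \<open>auto simp: indicator_def split: if_splits\<close>)
qed

lemma nn_integral_lborel_triple:
  fixes f :: "'a::euclidean_space \<times> 'b::euclidean_space \<times> 'c::euclidean_space \<Rightarrow> ennreal"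
  assumes [measurable]: "f \<in> borel_measurable borel"
  shows "(\<integral>\<^sup>+ ts. \<integral>\<^sup>+ x. f (fst ts, snd ts, x) \<partial>lborel \<partial>lborel) =
    (\<integral>\<^sup>+ z. \<integral>\<^sup>+ s. f (fst z, s, snd z) \<partial>lborel \<partial>lborel)"
proof -
  have "(\<integral>\<^sup>+ ts. \<integral>\<^sup>+ x. f (fst ts, snd ts, x) \<partial>lborel \<partial>lborel) =
     (\<integral>\<^sup>+ t. \<integral>\<^sup>+ s. \<integral>\<^sup>+ x. f (t, s, x) \<partial>lborel \<partial>lborel \<partial>lborel)"
    using nn_integral_lborel_fst[of "\<lambda>ts. \<integral>\<^sup>+ x. f (fst ts, snd ts, x) \<partial>lborel"] by simp
  also have "\<dots> = (\<integral>\<^sup>+ t. \<integral>\<^sup>+ x. \<integral>\<^sup>+ s. f (t, s, x) \<partial>lborel \<partial>lborel \<partial>lborel)"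
    by (intro nn_integral_cong nn_integral_lborel_swap) measurable
  also have "\<dots> = (\<integral>\<^sup>+ z. \<integral>\<^sup>+ s. f (fst z, s, snd z) \<partial>lborel \<partial>lborel)"
    using nn_integral_lborel_fst[of "\<lambda>z. \<integral>\<^sup>+ s. f (fst z, s, snd z) \<partial>lborel"] by simp
  finally show ?thesis .
qed

text \<open>Kernel identities hold for almost every \<open>x\<close> given \<open>(t, s)\<close>,
  whereas the operator integrates in \<open>s\<close> given \<open>(t, x)\<close>. This lemma
  changes the order.\<close>

lemma AE_lborel_triple:
  fixes P :: "'a::euclidean_space \<times> 'b::euclidean_space \<times> 'c::euclidean_space \<Rightarrow> bool"
  assumes [measurable]: "Measurable.pred borel P"
    and "AE ts in lborel. AE x in lborel. P (fst ts, snd ts, x)"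
  shows "AE z in lborel. AE s in lborel. P (fst z, s, snd z)"
proof -
  let ?f = "\<lambda>z. indicator {z. \<not> P z} z :: ennreal"
  have "(\<integral>\<^sup>+ ts. \<integral>\<^sup>+ x. ?f (fst ts, snd ts, x) \<partial>lborel \<partial>lborel) = 0"
  proof (subst nn_integral_0_iff_AE)
    show "AE ts in lborel. (\<integral>\<^sup>+ x. ?f (fst ts, snd ts, x) \<partial>lborel) = 0"
      using assms(2)
    proof eventually_elim
      case (elim ts)
      then have "AE x in lborel. ?f (fst ts, snd ts, x) = 0"
        by eventually_elim auto
      then show ?case by (subst nn_integral_0_iff_AE) measurable
    qed
  qed measurable
  then have "(\<integral>\<^sup>+ z. \<integral>\<^sup>+ s. ?f (fst z, s, snd z) \<partial>lborel \<partial>lborel) = 0"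
    by (subst (asm) nn_integral_lborel_triple) measurable
  then have "AE z in lborel. (\<integral>\<^sup>+ s. ?f (fst z, s, snd z) \<partial>lborel) = 0"
    by (subst (asm) nn_integral_0_iff_AE) measurable
  then show ?thesis
  proof eventually_elim
    case (elim z)
    then have "AE s in lborel. ?f (fst z, s, snd z) = 0"
      by (subst (asm) nn_integral_0_iff_AE) measurable
    then show ?case by eventually_elim (auto simp: indicator_def split: if_splits)
  qed
qed

text \<open>What \<open>F\<close> must satisfy for \<open>K t s\<close> to be applied to its slices.
  It is weaker than square-integrability of \<open>F\<close> in all variables.\<close>

definition L2_slices :: "('n::finite, 'm::finite) tfun \<Rightarrow> bool" where
  "L2_slices F \<longleftrightarrow> F \<in> borel_measurable borel \<and> (AE s in lborel. 0 < s \<longrightarrow> (\<lambda>y. F (s, y)) \<in> Lp 2)"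

lemma L2_slicesD:
  "L2_slices F \<Longrightarrow> AE ts in (lborel :: (real \<times> real) measure). 0 < snd ts \<longrightarrow> (\<lambda>y. F (snd ts, y)) \<in> Lp 2"
  unfolding L2_slices_def using AE_lborel_snd[of "\<lambda>s. 0 < s \<longrightarrow> (\<lambda>y. F (s, y)) \<in> Lp 2"] by auto

locale L2_kernel =
  fixes K :: "('n::finite, 'm::finite) kernel" and M :: real
  assumes ops: "0 < t \<Longrightarrow> 0 < s \<Longrightarrow> K t s \<in> bounded_ops lborel (Lp 2) (Lp_norm 2)"
    and op_norm_K: "0 < t \<Longrightarrow> 0 < s \<Longrightarrow> op_norm (Lp 2) (Lp_norm 2) (Lp_norm 2) (K t s) \<le> ennreal M"
    and measurable_K: "measurable_kernel K"
    and M_nonneg: "0 \<le> M"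
begin

lemma K_Lp_2: "0 < t \<Longrightarrow> 0 < s \<Longrightarrow> u \<in> Lp 2 \<Longrightarrow> K t s u \<in> Lp 2"
  using ops[of t s] by (simp add: bounded_ops_def)

lemma K_add: "0 < t \<Longrightarrow> 0 < s \<Longrightarrow> u \<in> Lp 2 \<Longrightarrow> v \<in> Lp 2 \<Longrightarrow>
    AE x in lborel. K t s (\<lambda>x. u x + v x) x = K t s u x + K t s v x"
  using ops[of t s] by (simp add: bounded_ops_def)

lemma K_scale: "0 < t \<Longrightarrow> 0 < s \<Longrightarrow> u \<in> Lp 2 \<Longrightarrow>
    AE x in lborel. K t s (\<lambda>x. c *s u x) x = c *s K t s u x"
  using ops[of t s] by (simp add: bounded_ops_def)

lemma l2_K_le:
  assumes "0 < t" "0 < s" "u \<in> Lp 2"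
  shows "l2 (K t s u) \<le> ennreal (M\<^sup>2) * l2 u"
proof -
  have "Lp_norm 2 (K t s u) \<le> ennreal M * Lp_norm 2 u"
    by (rule op_norm_le[OF op_norm_K]) (use assms M_nonneg in \<open>auto simp: Lp_def\<close>)
  then have "(esqrt (l2 (K t s u)))\<^sup>2 \<le> (ennreal M * esqrt (l2 u))\<^sup>2"
    unfolding Lp_norm_2 by (rule power_mono) simp
  then show ?thesis
    using M_nonneg by (simp add: power_mult_distrib ennreal_power)
qed

lemma K_diff:
  assumes "0 < t" "0 < s" "u \<in> Lp 2" "v \<in> Lp 2"
  shows "AE x in lborel. K t s (\<lambda>x. u x - v x) x = K t s u x - K t s v x"
proof -
  show ?thesis
    unfolding diff_conv_add_scale
    using K_add[OF assms(1-3) Lp_2_scale[OF assms(4), of "-1"]] K_scale[OF assms(1,2,4), of "-1"]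
    by eventually_elim simp
qed

text \<open>\<open>K t s\<close> acts on functions rather than on classes. By linearity and
  boundedness it maps the difference, a null function, to a null function.\<close>

lemma K_cong_AE:
  assumes "0 < t" "0 < s" "u \<in> Lp 2" "v \<in> Lp 2" "AE x in lborel. u x = v x"
  shows "AE x in lborel. K t s u x = K t s v x"
proof -
  have "AE x in lborel. u x - v x = 0"
    using assms(5) by eventually_elim simp
  from l2_cong_AE[OF this] have "l2 (\<lambda>x. u x - v x) = 0"
    by (simp add: l2_def)
  then have "l2 (K t s (\<lambda>x. u x - v x)) = 0"
    using l2_K_le[OF assms(1,2) Lp_2_diff[OF assms(3,4)]] by simp
  then have "AE x in lborel. (enorm (K t s (\<lambda>x. u x - v x) x))\<^sup>2 = 0"
    unfolding l2_def using K_Lp_2[OF assms(1,2) Lp_2_diff[OF assms(3,4)]]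
    by (subst (asm) nn_integral_0_iff_AE) (auto simp: Lp_2_iff)
  then show ?thesis
    using K_diff[OF assms(1-4)] by eventually_elim simp
qed

abbreviation version :: "('n, 'm) tfun \<Rightarrow> (real \<times> real \<times> (real ^ 'n) \<Rightarrow> complex ^ 'm) \<Rightarrow> bool" where
  "version F H \<equiv> measurable_version (\<lambda>t s. K t s (\<lambda>y. F (s, y))) H"

lemma versionD:
  "version F H \<Longrightarrow> H \<in> borel_measurable borel"
  "version F H \<Longrightarrow> AE ts in lborel. 0 < fst ts \<and> 0 < snd ts \<longrightarrow>
        (AE x in lborel. H (fst ts, snd ts, x) = K (fst ts) (snd ts) (\<lambda>y. F (snd ts, y)) x)"
  unfolding measurable_version_def by auto

lemma version_add:
  assumes "L2_slices F" "L2_slices G" "version F H" "version G J"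
  shows "version (\<lambda>z. F z + G z) (\<lambda>z. H z + J z)"
proof -
  note [measurable] = versionD(1)[OF assms(3)] versionD(1)[OF assms(4)]
  have "AE ts in lborel. 0 < fst ts \<and> 0 < snd ts \<longrightarrow>
        (AE x in lborel. H (fst ts, snd ts, x) + J (fst ts, snd ts, x) =
          K (fst ts) (snd ts) (\<lambda>y. F (snd ts, y) + G (snd ts, y)) x)"
    using L2_slicesD[OF assms(1)] L2_slicesD[OF assms(2)] versionD(2)[OF assms(3)] versionD(2)[OF assms(4)]
  proof eventually_elim
    case (elim ts)
    show ?case
    proof safe
      assume ts: "0 < fst ts" "0 < snd ts"
      have "AE x in lborel. H (fst ts, snd ts, x) = K (fst ts) (snd ts) (\<lambda>y. F (snd ts, y)) x"
        using elim ts by blast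
      moreover have "AE x in lborel. J (fst ts, snd ts, x) = K (fst ts) (snd ts) (\<lambda>y. G (snd ts, y)) x"
        using elim ts by blast
      moreover have "AE x in lborel. K (fst ts) (snd ts) (\<lambda>y. F (snd ts, y) + G (snd ts, y)) x =
           K (fst ts) (snd ts) (\<lambda>y. F (snd ts, y)) x + K (fst ts) (snd ts) (\<lambda>y. G (snd ts, y)) x"
        using elim ts K_add[OF ts, of "\<lambda>y. F (snd ts, y)" "\<lambda>y. G (snd ts, y)"] by blast
      ultimately show "AE x in lborel. H (fst ts, snd ts, x) + J (fst ts, snd ts, x) =
          K (fst ts) (snd ts) (\<lambda>y. F (snd ts, y) + G (snd ts, y)) x"
        by eventually_elim simp
    qed
  qed
  then show ?thesis
    unfolding measurable_version_def by (auto simp: case_prod_beta')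
qed

lemma version_scale:
  assumes "L2_slices F" "version F H"
  shows "version (\<lambda>z. c *s F z) (\<lambda>z. c *s H z)"
proof -
  note [measurable] = versionD(1)[OF assms(2)]
  have "AE ts in lborel. 0 < fst ts \<and> 0 < snd ts \<longrightarrow>
        (AE x in lborel. c *s H (fst ts, snd ts, x) =
          K (fst ts) (snd ts) (\<lambda>y. c *s F (snd ts, y)) x)"
    using L2_slicesD[OF assms(1)] versionD(2)[OF assms(2)]
  proof eventually_elim
    case (elim ts)
    show ?case
    proof safe
      assume ts: "0 < fst ts" "0 < snd ts"
      have "AE x in lborel. H (fst ts, snd ts, x) = K (fst ts) (snd ts) (\<lambda>y. F (snd ts, y)) x"
        using elim ts by blast
      moreover have "AE x in lborel. K (fst ts) (snd ts) (\<lambda>y. c *s F (snd ts, y)) x = c *s K (fst ts) (snd ts) (\<lambda>y. F (snd ts, y)) x"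
        using elim ts K_scale[OF ts, of "\<lambda>y. F (snd ts, y)" c] by blast
      ultimately show "AE x in lborel. c *s H (fst ts, snd ts, x) = K (fst ts) (snd ts) (\<lambda>y. c *s F (snd ts, y)) x"
        by eventually_elim simp
    qed
  qed
  then show ?thesis
    unfolding measurable_version_def by (auto simp: case_prod_beta')
qed

text \<open>Integrals in \<open>s\<close> are thereby independent of the chosen version; linearity
  of the integral operator rests on this.\<close>

lemma version_unique:
  assumes "L2_slices F" "version F H" "version F J"
  shows "AE z in lborel. AE s in lborel. 0 < fst z \<and> 0 < s \<longrightarrow> H (fst z, s, snd z) = J (fst z, s, snd z)"
proof -
  note [measurable] = versionD(1)[OF assms(2)] versionD(1)[OF assms(3)]
  have "AE ts in lborel. AE x in lborel. (\<lambda>z. 0 < fst z \<and> 0 < fst (snd z) \<longrightarrow> H z = J z) (fst ts, snd ts, x)"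
    using versionD(2)[OF assms(2)] versionD(2)[OF assms(3)]
  proof eventually_elim
    case (elim ts)
    show ?case
    proof (cases "0 < fst ts \<and> 0 < snd ts")
      case True
      then have "AE x in lborel. H (fst ts, snd ts, x) = K (fst ts) (snd ts) (\<lambda>y. F (snd ts, y)) x"
        "AE x in lborel. J (fst ts, snd ts, x) = K (fst ts) (snd ts) (\<lambda>y. F (snd ts, y)) x"
        using elim by auto
      then show ?thesis by eventually_elim simp
    qed auto
  qed
  then have "AE z in lborel. AE s in lborel. (\<lambda>z. 0 < fst z \<and> 0 < fst (snd z) \<longrightarrow> H z = J z) (fst z, s, snd z)"
    by (intro AE_lborel_triple) measurable
  then show ?thesis by simp
qed

text \<open>The measurability hypothesis on \<open>K\<close> concerns one fixed \<open>u\<close>; in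
  a product the slices are \<open>u\<close> or zero, so it still applies. For \<open>s\<close>
  outside \<open>A\<close> one needs that \<open>K t s\<close> maps zero to zero, which is
  homogeneity with scalar 0.\<close>

lemma version_product:
  assumes "A \<in> sets borel" "u \<in> Lp 2"
  shows "\<exists>H. version (\<lambda>z. indicator A (fst z) *\<^sub>R u (snd z)) H"
proof -
  obtain H0 where "measurable_version (\<lambda>t s. K t s u) H0"
    using measurable_K assms(2) unfolding measurable_kernel_def by auto
  then have [measurable]: "H0 \<in> borel_measurable borel"
    and ae: "AE ts in lborel. 0 < fst ts \<and> 0 < snd ts \<longrightarrow>
        (AE x in lborel. H0 (fst ts, snd ts, x) = K (fst ts) (snd ts) u x)"
    unfolding measurable_version_def by auto
  note [measurable] = assms(1)
  have 0: "AE x in lborel. K t s (\<lambda>y. 0) x = 0" if "0 < t" "0 < s" for t s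
    using K_scale[OF that assms(2), of 0] by simp
  define H where "H z = indicator A (fst (snd z)) *\<^sub>R H0 z" for z :: "real \<times> real \<times> (real ^ 'n)"
  have "AE ts in lborel. 0 < fst ts \<and> 0 < snd ts \<longrightarrow>
        (AE x in lborel. H (fst ts, snd ts, x) =
          K (fst ts) (snd ts) (\<lambda>y. indicator A (snd ts) *\<^sub>R u y) x)"
    using ae
  proof eventually_elim
    case (elim ts)
    show ?case
    proof (cases "snd ts \<in> A")
      case True
      then show ?thesis using elim by (simp add: H_def)
    next
      case False
      have "AE x in lborel. 0 = K (fst ts) (snd ts) (\<lambda>y. 0) x" if "0 < fst ts" "0 < snd ts"
        using 0[OF that] by eventually_elim simp
      then show ?thesis using False by (simp add: H_def)
    qed
  qed
  moreover have "H \<in> borel_measurable borel"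
    unfolding H_def by measurable
  ultimately show ?thesis
    unfolding measurable_version_def by (intro exI[of _ H]) simp
qed

text \<open>The subsequence along which \<open>F i (s, _)\<close> converges fast depends on \<open>s\<close>; since it is chosen
  measurably in \<open>s\<close>, the versions can be glued along it.\<close>

lemma version_limit:
  assumes F: "\<And>i. L2_slices (F i)" "L2_slices G" and H: "\<And>i::nat. version (F i) (H i)"
    and lim: "AE s in lborel. 0 < s \<longrightarrow> (\<lambda>i. l2 (\<lambda>y. F i (s, y) - G (s, y))) \<longlonglongrightarrow> 0"
  shows "\<exists>J. version G J"
proof -
  have [measurable]: "F i \<in> borel_measurable borel" "G \<in> borel_measurable borel" for i
    using F by (auto simp: L2_slices_def)
  note [measurable] = versionD(1)[OF H]
  define d where "d i s = l2 (\<lambda>y. F i (s, y) - G (s, y))" for i s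
  have [measurable]: "d i \<in> borel_measurable borel" for i
    unfolding d_def l2_def by measurable
  \<comment> \<open>The rate \<open>2^(-q)\<close> is summable, so along these indices L^2
    convergence improves to convergence for almost every \<open>x\<close>. This allows
    \<open>J\<close> to be defined as a pointwise limit.\<close>
  define \<kappa> where "\<kappa> q s = (LEAST i. d i s \<le> ennreal ((1 / 2) ^ q))" for q s
  have \<kappa>_meas[measurable (raw)]: "(\<lambda>x. \<kappa> q (f x)) \<in> measurable N (count_space UNIV)"
    if [measurable]: "f \<in> borel_measurable N" for q and f :: "'z \<Rightarrow> real" and N
    unfolding \<kappa>_def by measurable
  define Hq where "Hq q z = H (\<kappa> q (fst (snd z))) z" for q and z :: "real \<times> real \<times> (real ^ 'n)"
  have [measurable]: "Hq q \<in> borel_measurable borel" for q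
    unfolding Hq_def
    by (rule measurable_compose_countable[where f = "\<lambda>i z. H i z" and g = "\<lambda>z. \<kappa> q (fst (snd z))"]) measurable
  define J where "J z = lim (\<lambda>q. Hq q z)" for z
  have [measurable]: "J \<in> borel_measurable borel"
    unfolding J_def by measurable
  have "AE ts in (lborel :: (real \<times> real) measure). \<forall>i. 0 < snd ts \<longrightarrow> (\<lambda>y. F i (snd ts, y)) \<in> Lp 2"
    unfolding AE_all_countable using L2_slicesD[OF F(1)] by blast
  moreover have "AE ts in lborel. \<forall>i. 0 < fst ts \<and> 0 < snd ts \<longrightarrow>
        (AE x in lborel. H i (fst ts, snd ts, x) = K (fst ts) (snd ts) (\<lambda>y. F i (snd ts, y)) x)"
    unfolding AE_all_countable using versionD(2)[OF H] by blast
  moreover note L2_slicesD[OF F(2)]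
  moreover have "AE ts in (lborel :: (real \<times> real) measure). 0 < snd ts \<longrightarrow> (\<lambda>i. d i (snd ts)) \<longlonglongrightarrow> 0"
    using AE_lborel_snd[OF lim] by (simp add: d_def)
  ultimately have "AE ts in lborel. 0 < fst ts \<and> 0 < snd ts \<longrightarrow>
        (AE x in lborel. J (fst ts, snd ts, x) = K (fst ts) (snd ts) (\<lambda>y. G (snd ts, y)) x)"
  proof eventually_elim
    case (elim ts)
    show ?case
    proof
      assume *: "0 < fst ts \<and> 0 < snd ts"
      define t s where "t = fst ts" and "s = snd ts"
      have ts: "0 < t" "0 < s" and Fs: "\<And>i. (\<lambda>y. F i (s, y)) \<in> Lp 2" and Gs: "(\<lambda>y. G (s, y)) \<in> Lp 2"
        and Hi: "\<And>i. AE x in lborel. H i (t, s, x) = K t s (\<lambda>y. F i (s, y)) x"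
        and d0: "(\<lambda>i. d i s) \<longlonglongrightarrow> 0"
        using elim * by (auto simp: t_def s_def)
      let ?KG = "K t s (\<lambda>y. G (s, y))"
      have [measurable]: "?KG \<in> borel_measurable borel"
        using K_Lp_2[OF ts Gs] by (simp add: Lp_2_iff)
      have le: "l2 (\<lambda>x. Hq q (t, s, x) - ?KG x) \<le> ennreal (M\<^sup>2) * ennreal ((1 / 2) ^ q)" for q
      proof -
        let ?i = "\<kappa> q s"
        have "eventually (\<lambda>i. d i s < ennreal ((1 / 2) ^ q)) sequentially"
          using d0 by (rule order_tendstoD) simp
        then have "\<exists>i. d i s \<le> ennreal ((1 / 2) ^ q)"
          by (auto simp: eventually_sequentially intro: less_imp_le)
        then have di: "d ?i s \<le> ennreal ((1 / 2) ^ q)"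
          unfolding \<kappa>_def by (rule LeastI_ex)
        have "l2 (\<lambda>x. Hq q (t, s, x) - ?KG x) = l2 (K t s (\<lambda>y. F ?i (s, y) - G (s, y)))"
        proof (rule l2_cong_AE)
          show "AE x in lborel. Hq q (t, s, x) - ?KG x = K t s (\<lambda>y. F ?i (s, y) - G (s, y)) x"
            using Hi[of ?i] K_diff[OF ts Fs Gs, of ?i]
            by eventually_elim (simp add: Hq_def)
        qed
        also have "\<dots> \<le> ennreal (M\<^sup>2) * d ?i s"
          unfolding d_def by (rule l2_K_le[OF ts Lp_2_diff[OF Fs Gs]])
        also have "\<dots> \<le> ennreal (M\<^sup>2) * ennreal ((1 / 2) ^ q)"
          using di by (rule mult_left_mono) simp
        finally show ?thesis .
      qed
      have "(\<integral>\<^sup>+ x. (\<Sum>q. (enorm (Hq q (t, s, x) - ?KG x))\<^sup>2) \<partial>lborel) =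
          (\<Sum>q. l2 (\<lambda>x. Hq q (t, s, x) - ?KG x))"
        unfolding l2_def by (rule nn_integral_suminf) measurable
      also have "\<dots> \<le> (\<Sum>q. ennreal (M\<^sup>2) * ennreal ((1 / 2) ^ q))"
        by (intro suminf_le le) auto
      also have "\<dots> = ennreal (M\<^sup>2) * ennreal (\<Sum>q. (1 / 2) ^ q)"
        by (subst ennreal_suminf_cmult, subst suminf_ennreal2) (auto simp: summable_geometric)
      also have "\<dots> < top" by (simp add: ennreal_mult_less_top)
      finally have "AE x in lborel. (\<Sum>q. (enorm (Hq q (t, s, x) - ?KG x))\<^sup>2) \<noteq> \<infinity>"
        by (intro nn_integral_PInf_AE) (auto simp: less_top)
      then have "AE x in lborel. J (t, s, x) = ?KG x"
      proof eventually_elim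
        case (elim x)
        have "summable (\<lambda>q. (norm (Hq q (t, s, x) - ?KG x))\<^sup>2)"
          using elim by (intro summable_suminf_not_top) (simp_all add: ennreal_power)
        then have "(\<lambda>q. (norm (Hq q (t, s, x) - ?KG x))\<^sup>2) \<longlonglongrightarrow> 0"
          by (rule summable_LIMSEQ_zero)
        then have "(\<lambda>q. sqrt ((norm (Hq q (t, s, x) - ?KG x))\<^sup>2)) \<longlonglongrightarrow> sqrt 0"
          by (rule tendsto_real_sqrt)
        then have "(\<lambda>q. Hq q (t, s, x)) \<longlonglongrightarrow> ?KG x"
          by (simp add: LIM_zero_iff tendsto_norm_zero_iff)
        then show ?case unfolding J_def by (rule limI)
      qed
      then show "AE x in lborel. J (fst ts, snd ts, x) = K (fst ts) (snd ts) (\<lambda>y. G (snd ts, y)) x"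
        by (simp add: t_def s_def)
    qed
  qed
  then show ?thesis
    unfolding measurable_version_def by (intro exI[of _ J]) simp
qed

end

lemma l2_dominated_tendsto_0:
  assumes [measurable]: "\<And>i. v i \<in> borel_measurable borel" "W \<in> borel_measurable borel"
    and W: "\<And>i x. enorm (v i x) \<le> W x" "(\<integral>\<^sup>+ x. (W x)\<^sup>2 \<partial>lborel) < top"
    and lim: "\<And>x. (\<lambda>i. v i x) \<longlonglongrightarrow> 0"
  shows "(\<lambda>i. l2 (v i)) \<longlonglongrightarrow> 0"
proof -
  have "(\<lambda>i. \<integral>\<^sup>+ x. (enorm (v i x))\<^sup>2 \<partial>lborel) \<longlonglongrightarrow> (\<integral>\<^sup>+ x. 0 \<partial>(lborel :: (real ^ 'a) measure))"
  proof (rule nn_integral_dominated_convergence[where w = "\<lambda>x. (W x)\<^sup>2"])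
    show "AE x in lborel. (\<lambda>i. (enorm (v i x))\<^sup>2) \<longlonglongrightarrow> 0"
    proof (rule AE_I2)
      fix x
      have "(\<lambda>i. (norm (v i x))\<^sup>2) \<longlonglongrightarrow> 0\<^sup>2"
        by (intro tendsto_power tendsto_norm_zero lim)
      then have "(\<lambda>i. ennreal ((norm (v i x))\<^sup>2)) \<longlonglongrightarrow> ennreal 0"
        by (intro tendsto_ennrealI) simp
      then show "(\<lambda>i. (enorm (v i x))\<^sup>2) \<longlonglongrightarrow> 0"
        by (simp add: ennreal_power)
    qed
  qed (use W in \<open>auto intro!: power_mono\<close>)
  then show ?thesis by (simp add: l2_def)
qed

lemma mem_box_prod_iff: "(s, y) \<in> box c d \<longleftrightarrow> s \<in> box (fst c) (fst d) \<and> y \<in> box (snd c) (snd d)"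
  by (cases c; cases d) (auto simp: mem_box Basis_prod_def ball_Un)

lemma indicator_box_finite:
  "(\<integral>\<^sup>+ x. (ennreal (B * indicator (box a b) x))\<^sup>2 \<partial>lborel) < top" for a b :: "'a::euclidean_space"
proof -
  have "(\<integral>\<^sup>+ x. (ennreal (B * indicator (box a b) x))\<^sup>2 \<partial>lborel) =
     (\<integral>\<^sup>+ x. (ennreal B)\<^sup>2 * indicator (box a b) x \<partial>lborel)"
    by (intro nn_integral_cong) (auto simp: indicator_def)
  also have "\<dots> = (ennreal B)\<^sup>2 * emeasure lborel (box a b)"
    by (intro nn_integral_cmult_indicator) simp
  also have "\<dots> < top"
    using emeasure_lborel_box_finite[of a b]
    by (simp add: ennreal_mult_less_top power_less_top_ennreal)
  finally show ?thesis .
qed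

lemma bounded_box_slice:
  fixes f :: "('n::finite, 'm::finite) tfun"
  assumes "norm (f (s, y)) \<le> B * indicator (box a b) (s, y)"
  shows "enorm (f (s, y)) \<le> ennreal (\<bar>B\<bar> * indicator (box (snd a) (snd b)) y)"
proof -
  have "norm (f (s, y)) \<le> \<bar>B\<bar> * indicator (box (snd a) (snd b)) y"
    using assms by (cases "(s, y) \<in> box a b") (auto simp: mem_box_prod_iff simp del: box_real)
  then show ?thesis by (rule ennreal_leI)
qed

lemma L2_slices_bounded_box:
  fixes f :: "('n::finite, 'm::finite) tfun"
  assumes [measurable]: "f \<in> borel_measurable borel" and bd: "\<And>z. norm (f z) \<le> B * indicator (box a b) z"
  shows "L2_slices f"
proof -
  have "(\<lambda>y. f (s, y)) \<in> Lp 2" for s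
  proof -
    have "l2 (\<lambda>y. f (s, y)) \<le> (\<integral>\<^sup>+ y. (ennreal (\<bar>B\<bar> * indicator (box (snd a) (snd b)) y))\<^sup>2 \<partial>lborel)"
      unfolding l2_def by (intro nn_integral_mono power_mono bounded_box_slice bd) simp
    also have "\<dots> < top" by (rule indicator_box_finite)
    finally show ?thesis by (simp add: Lp_2_iff)
  qed
  then show ?thesis by (simp add: L2_slices_def)
qed

context L2_kernel
begin

text \<open>Boxes factor into an interval of heights and a box in space, so
  \<open>version_product\<close> starts the induction. In the limit case the common bound makes the
  slices converge in L^2, as \<open>version_limit\<close> requires.\<close>

lemma version_bounded_box:
  fixes f :: "('n, 'm) tfun"
  assumes f: "f \<in> borel_measurable borel" and bd: "\<And>z. norm (f z) \<le> B * indicator (box a b) z"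
  shows "\<exists>H. version f H"
  using f bd
proof (induction rule: bounded_box_supported_induct)
  case (box c d w)
  have "(\<lambda>y. indicator (box (snd c) (snd d)) y *\<^sub>R w) \<in> Lp 2"
  proof -
    have "l2 (\<lambda>y. indicator (box (snd c) (snd d)) y *\<^sub>R w) =
       (\<integral>\<^sup>+ y. (ennreal (norm w * indicator (box (snd c) (snd d)) y))\<^sup>2 \<partial>lborel)"
      unfolding l2_def by (intro nn_integral_cong) (auto simp: indicator_def)
    then show ?thesis
      using indicator_box_finite[of "norm w" "snd c" "snd d"] by (simp add: Lp_2_iff)
  qed
  note u = this
  define A where "A = (\<lambda>z. indicator (box (fst c) (fst d)) (fst z) *\<^sub>R
      indicator (box (snd c) (snd d)) (snd z) *\<^sub>R w)"
  have "\<exists>H. version A H"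
    unfolding A_def by (rule version_product[OF _ u]) simp
  moreover have "A = (\<lambda>z. indicator (box c d) z *\<^sub>R w)"
  proof
    fix z show "A z = indicator (box c d) z *\<^sub>R w"
      unfolding A_def using mem_box_prod_iff[of "fst z" "snd z" c d] by (simp add: indicator_def)
  qed
  ultimately show ?case by simp
next
  case (add f g B)
  then show ?case
    using version_add[of f g] L2_slices_bounded_box[of f] L2_slices_bounded_box[of g] by blast
next
  case (lim f g B)
  note [measurable] = lim(2,3)
  define H where "H i = (SOME H. version (f i) H)" for i
  have H: "version (f i) (H i)" for i
    unfolding H_def by (rule someI_ex[where P = "version (f i)"]) (rule lim(1))
  have gB: "norm (g z) \<le> B * indicator (box a b) z" for z
    using tendsto_norm[OF lim(5)[of z]] by (rule LIMSEQ_le_const2) (use lim(4) in blast)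
  have "(\<lambda>i. l2 (\<lambda>y. f i (s, y) - g (s, y))) \<longlonglongrightarrow> 0" for s
  proof (rule l2_dominated_tendsto_0[where W = "\<lambda>y. ennreal ((2 * \<bar>B\<bar>) * indicator (box (snd a) (snd b)) y)"])
    fix i y
    have "norm (f i (s, y) - g (s, y)) \<le> norm (f i (s, y)) + norm (g (s, y))"
      by (rule norm_triangle_ineq4)
    also have "\<dots> \<le> 2 * \<bar>B\<bar> * indicator (box (snd a) (snd b)) y"
      using lim(4)[of i "(s, y)"] gB[of "(s, y)"]
      by (cases "(s, y) \<in> box a b") (auto simp: mem_box_prod_iff simp del: box_real)
    finally show "enorm (f i (s, y) - g (s, y)) \<le> ennreal (2 * \<bar>B\<bar> * indicator (box (snd a) (snd b)) y)"
      by (rule ennreal_leI)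
  next
    show "(\<lambda>i. f i (s, y) - g (s, y)) \<longlonglongrightarrow> 0" for y
      using lim(5)[of "(s, y)"] by (rule LIM_zero)
  qed (use indicator_box_finite[of "2 * \<bar>B\<bar>" "snd a" "snd b"] in simp_all)
  then show ?case
    using H L2_slices_bounded_box[OF lim(2,4)] L2_slices_bounded_box[OF lim(3) gB]
    by (intro version_limit[of f g H]) auto
qed

text \<open>Truncating both the domain and the values reduces to bounded functions; on each L^2
  slice the truncations converge, dominated by the slice itself.\<close>

lemma version_exists:
  assumes "L2_slices F"
  shows "\<exists>H. version F H"
proof -
  have F[measurable]: "F \<in> borel_measurable borel"
    using assms by (simp add: L2_slices_def)
  define a b :: "nat \<Rightarrow> real \<times> (real ^ 'n)" where "a i = - real i *\<^sub>R One" and "b i = real i *\<^sub>R One" for i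
  define f where "f i z = (if z \<in> box (a i) (b i) \<and> norm (F z) \<le> real i then F z else 0)" for i z
  have f[measurable]: "f i \<in> borel_measurable borel" for i
    unfolding f_def by measurable
  have bd: "norm (f i z) \<le> real i * indicator (box (a i) (b i)) z" for i z
    by (auto simp: f_def)
  have slices: "L2_slices (f i)" for i
    by (rule L2_slices_bounded_box[OF f bd])
  define H where "H i = (SOME H. version (f i) H)" for i
  have H: "version (f i) (H i)" for i
    unfolding H_def by (rule someI_ex[where P = "version (f i)"]) (rule version_bounded_box[OF f bd])
  have ev: "eventually (\<lambda>i. f i z = F z) sequentially" for z
  proof -
    obtain i0 :: nat where i0: "norm (F z) + (\<Sum>e\<in>Basis. \<bar>z \<bullet> e\<bar>) < real i0"
      using reals_Archimedean2 by blast
    have nn: "0 \<le> (\<Sum>e\<in>Basis. \<bar>z \<bullet> e\<bar>)" by (simp add: sum_nonneg)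
    have le: "\<bar>z \<bullet> e\<bar> \<le> (\<Sum>e\<in>Basis. \<bar>z \<bullet> e\<bar>)" if "e \<in> Basis" for e
      by (rule member_le_sum[OF that]) auto
    show ?thesis
    proof (rule eventually_sequentiallyI[of i0])
      fix i assume i: "i0 \<le> i"
      have nF: "0 \<le> norm (F z)" by simp
      have "z \<in> box (a i) (b i)"
        unfolding mem_box a_def b_def
      proof
        fix e :: "real \<times> (real ^ 'n)" assume e: "e \<in> Basis"
        have "\<bar>z \<bullet> e\<bar> < real i"
          using le[OF e] i0 i nF by linarith
        then have "- real i < z \<bullet> e" "z \<bullet> e < real i" by linarith+
        with e show "- real i *\<^sub>R One \<bullet> e < z \<bullet> e \<and> z \<bullet> e < real i *\<^sub>R One \<bullet> e"
          by simp
      qed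
      moreover have "norm (F z) \<le> real i" using i0 i nn by linarith
      ultimately show "f i z = F z" by (simp add: f_def)
    qed
  qed
  have "AE s in lborel. 0 < s \<longrightarrow> (\<lambda>i. l2 (\<lambda>y. f i (s, y) - F (s, y))) \<longlonglongrightarrow> 0"
    using assms[unfolded L2_slices_def, THEN conjunct2]
  proof eventually_elim
    case (elim s)
    show ?case
    proof
      assume "0 < s"
      with elim have "l2 (\<lambda>y. F (s, y)) < top" by (simp add: Lp_2_iff)
      then show "(\<lambda>i. l2 (\<lambda>y. f i (s, y) - F (s, y))) \<longlonglongrightarrow> 0"
      proof (intro l2_dominated_tendsto_0[where W = "\<lambda>y. enorm (F (s, y))"])
        fix y
        show "(\<lambda>i. f i (s, y) - F (s, y)) \<longlonglongrightarrow> 0"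
          using ev[of "(s, y)"] by (intro tendsto_eventually) (auto elim: eventually_mono)
      qed (auto simp: f_def l2_def)
    qed
  qed
  then show ?thesis
    by (rule version_limit[OF slices assms H])
qed

end

section \<open>Off-diagonal estimates and the Schur test\<close>

lemma epowr_mono:
  assumes "x \<le> y" "0 \<le> a" shows "epowr x a \<le> epowr y a"
proof (cases y)
  case (real b)
  moreover obtain c where "x = ennreal c" "0 \<le> c"
    using assms(1) real by (cases x) (auto simp: top_unique)
  ultimately show ?thesis
    using assms by (auto simp: epowr_def intro!: ennreal_leI powr_mono2)
qed (simp add: epowr_def)

lemma unit_ball_vol_nat_pos: "0 < unit_ball_vol (real n)"
  by (rule unit_ball_vol_pos) simp

text \<open>Hoelder's inequality up to a factor 2, obtained from the pointwise split
  \<open>a^p \<le> c^(p - 2) a^2 + c^p\<close>: values up to \<open>c\<close> go to the second term,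
  larger ones to the first since \<open>p \<le> 2\<close>.\<close>

lemma Lp_norm_local_le:
  fixes u :: "('n::finite, 'm::finite) vfun"
  assumes p: "1 \<le> p" "p \<le> 2" and u: "u \<in> Lp 2" and r: "0 < r"
    and supp: "\<And>x. x \<notin> ball x0 r \<Longrightarrow> u x = 0"
  shows "Lp_norm p u \<le> ennreal (2 * (unit_ball_vol CARD('n) * r ^ CARD('n)) powr (1 / p - 1 / 2)) * esqrt (l2 u)"
proof -
  define b where "b = unit_ball_vol CARD('n) * r ^ CARD('n)"
  have b: "0 < b" using r by (simp add: b_def unit_ball_vol_nat_pos)
  have [measurable]: "u \<in> borel_measurable borel" using u by (simp add: Lp_2_iff)
  have [measurable]: "ball x0 r \<in> sets borel" by simp
  obtain X where X: "0 \<le> X" "l2 u = ennreal X"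
    using u by (cases "l2 u") (auto simp: Lp_2_iff)
  have "Lp_norm p u \<le> ennreal (2 * b powr (1 / p - 1 / 2)) * esqrt (l2 u)"
  proof (cases "X = 0")
    case True
    then have "(\<integral>\<^sup>+ x. (enorm (u x))\<^sup>2 \<partial>lborel) = 0"
      using X(2) by (simp add: l2_def)
    then have "AE x in lborel. (enorm (u x))\<^sup>2 = 0"
      by (subst (asm) nn_integral_0_iff_AE) auto
    then have "AE x in lborel. ennreal (norm (u x) powr p) = 0"
      by eventually_elim simp
    then have "(\<integral>\<^sup>+ x. ennreal (norm (u x) powr p) \<partial>lborel) = 0"
      by (subst nn_integral_0_iff_AE) auto
    then show ?thesis by (simp add: Lp_norm_def epowr_def)
  next
    case False
    then have X0: "0 < X" using X by simp
    \<comment> \<open>The threshold balances the split: with \<open>c^2 = X / b\<close> the terms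
      \<open>c^(p - 2) X\<close> and \<open>c^p b\<close> are equal. It must be positive, so
      \<open>X = 0\<close> is a separate case.\<close>
    define c where "c = (X / b) powr (1 / 2)"
    have c: "0 < c" using X0 b by (simp add: c_def)
    have pointwise: "a powr p \<le> c powr (p - 2) * a\<^sup>2 + c powr p" if "0 \<le> a" for a
    proof (cases "a \<le> c")
      case True
      then have "a powr p \<le> c powr p" using p that by (intro powr_mono2) auto
      then show ?thesis by (simp add: add_increasing)
    next
      case False
      then have "a powr (p - 2) \<le> c powr (p - 2)" using p c by (intro powr_mono2') auto
      then have "a powr (p - 2) * a\<^sup>2 \<le> c powr (p - 2) * a\<^sup>2" by (rule mult_right_mono) simp
      moreover have "a powr (p - 2) * a\<^sup>2 = a powr p"
        using False c by (simp add: powr_diff powr_numeral)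
      moreover have "0 \<le> c powr p" by simp
      ultimately show ?thesis by linarith
    qed
    have "(\<integral>\<^sup>+ x. ennreal (norm (u x) powr p) \<partial>lborel) \<le>
      (\<integral>\<^sup>+ x. ennreal (c powr (p - 2)) * (enorm (u x))\<^sup>2 + ennreal (c powr p) * indicator (ball x0 r) x \<partial>lborel)"
    proof (intro nn_integral_mono)
      fix x
      show "ennreal (norm (u x) powr p) \<le>
        ennreal (c powr (p - 2)) * (enorm (u x))\<^sup>2 + ennreal (c powr p) * indicator (ball x0 r) x"
      proof (cases "x \<in> ball x0 r")
        case True
        then show ?thesis
          using ennreal_leI[OF pointwise[of "norm (u x)"]]
          by (simp add: ennreal_power ennreal_mult')
      qed (simp add: supp)
    qed
    also have "\<dots> = ennreal (c powr (p - 2)) * l2 u + ennreal (c powr p) * emeasure lborel (ball x0 r)"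
    proof -
      have "(\<integral>\<^sup>+ x. ennreal (c powr (p - 2)) * (enorm (u x))\<^sup>2 \<partial>lborel) = ennreal (c powr (p - 2)) * l2 u"
        unfolding l2_def by (rule nn_integral_cmult) measurable
      moreover have "(\<integral>\<^sup>+ x. ennreal (c powr p) * indicator (ball x0 r) x \<partial>lborel) =
          ennreal (c powr p) * emeasure lborel (ball x0 r)"
        by (rule nn_integral_cmult_indicator) simp
      moreover have "(\<integral>\<^sup>+ x. ennreal (c powr (p - 2)) * (enorm (u x))\<^sup>2 + ennreal (c powr p) * indicator (ball x0 r) x \<partial>lborel) =
        (\<integral>\<^sup>+ x. ennreal (c powr (p - 2)) * (enorm (u x))\<^sup>2 \<partial>lborel) + (\<integral>\<^sup>+ x. ennreal (c powr p) * indicator (ball x0 r) x \<partial>lborel)"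
        by (rule nn_integral_add) measurable
      ultimately show ?thesis by (simp only:)
    qed
    also have "\<dots> = ennreal (c powr (p - 2) * X + c powr p * b)"
    proof -
      have "emeasure lborel (ball x0 r) = ennreal b"
        using r by (simp add: emeasure_ball b_def)
      then show ?thesis
        using X b by (simp add: ennreal_mult')
    qed
    also have "c powr (p - 2) * X + c powr p * b = 2 * (X / b) powr (p / 2) * b"
    proof -
      have "c powr (p - 2) * X = (X / b) powr (p / 2 - 1) * (X / b) * b"
        using b by (simp add: c_def powr_powr diff_divide_distrib)
      also have "\<dots> = (X / b) powr (p / 2) * b"
        using X0 b by (simp add: powr_diff)
      finally show ?thesis
        by (simp add: c_def powr_powr)
    qed
    finally have "Lp_norm p u \<le> epowr (ennreal (2 * (X / b) powr (p / 2) * b)) (1 / p)"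
      unfolding Lp_norm_def using p by (intro epowr_mono) auto
    also have "\<dots> = ennreal ((2 * (X / b) powr (p / 2) * b) powr (1 / p))"
      using b by (simp add: epowr_def)
    also have "\<dots> \<le> ennreal (2 * b powr (1 / p - 1 / 2) * sqrt X)"
    proof (rule ennreal_leI)
      have "(2 * (X / b) powr (p / 2) * b) powr (1 / p) = 2 powr (1 / p) * (X / b) powr (1 / 2) * b powr (1 / p)"
        using b X0 p by (simp add: powr_mult powr_powr)
      also have "\<dots> = 2 powr (1 / p) * (b powr (1 / p - 1 / 2) * sqrt X)"
        using b X0 by (simp add: powr_divide powr_diff powr_half_sqrt[symmetric])
      also have "\<dots> \<le> 2 powr 1 * (b powr (1 / p - 1 / 2) * sqrt X)"
        using p X by (intro mult_right_mono powr_mono) auto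
      finally show "(2 * (X / b) powr (p / 2) * b) powr (1 / p) \<le> 2 * b powr (1 / p - 1 / 2) * sqrt X"
        by simp
    qed
    also have "\<dots> = ennreal (2 * b powr (1 / p - 1 / 2)) * esqrt (l2 u)"
      using X by (simp add: esqrt_ennreal ennreal_mult')
    finally show ?thesis .
  qed
  then show ?thesis by (simp add: b_def)
qed

section \<open>A Schur test for the measure ds/s\<close>

definition schur :: "real \<Rightarrow> real \<Rightarrow> real \<Rightarrow> real" where
  "schur \<delta> t s = min (s / t) (t / s) powr \<delta>"

lemma schur_commute: "schur \<delta> t s = schur \<delta> s t"
  by (simp add: schur_def min.commute)

lemma schur_nonneg: "0 \<le> schur \<delta> t s"
  by (simp add: schur_def)

lemma borel_measurable_schur [measurable (raw)]:
  assumes [measurable]: "f \<in> borel_measurable M" "g \<in> borel_measurable M"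
  shows "(\<lambda>x. schur \<delta> (f x) (g x)) \<in> borel_measurable M"
  unfolding schur_def by measurable

text \<open>The parts \<open>s \<le> t\<close> and \<open>t < s\<close> are power integrals, each
  contributing \<open>1 / \<delta>\<close> by scale invariance.\<close>

lemma nn_integral_schur_le:
  assumes \<delta>: "0 < \<delta>" and t: "0 < t"
  shows "(\<integral>\<^sup>+ s. ennreal (schur \<delta> t s) * inv_weight s \<partial>lborel) \<le> ennreal (2 / \<delta>)"
proof -
  have 1: "(\<integral>\<^sup>+ s. ennreal (s powr (\<delta> - 1)) * indicator {0..t} s \<partial>lborel) = ennreal (t powr \<delta> / \<delta>)"
    using has_integral_powr_from_0[of "\<delta> - 1" t] \<delta> t
    by (intro nn_integral_has_integral_lebesgue') auto
  have 2: "(\<integral>\<^sup>+ s. ennreal (s powr (- \<delta> - 1)) * indicator {t..} s \<partial>lborel) = ennreal (t powr (- \<delta>) / \<delta>)"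
    using has_integral_powr_to_inf[of "- \<delta> - 1" t] \<delta> t
    by (intro nn_integral_has_integral_lebesgue') auto
  have "(\<integral>\<^sup>+ s. ennreal (schur \<delta> t s) * inv_weight s \<partial>lborel) \<le>
     (\<integral>\<^sup>+ s. ennreal (t powr (- \<delta>)) * (ennreal (s powr (\<delta> - 1)) * indicator {0..t} s) +
        ennreal (t powr \<delta>) * (ennreal (s powr (- \<delta> - 1)) * indicator {t..} s) \<partial>lborel)"
  proof (intro nn_integral_mono)
    fix s :: real
    consider "s \<le> 0" | "0 < s" "s \<le> t" | "t < s" by linarith
    then show "ennreal (schur \<delta> t s) * inv_weight s \<le>
      ennreal (t powr (- \<delta>)) * (ennreal (s powr (\<delta> - 1)) * indicator {0..t} s) +
        ennreal (t powr \<delta>) * (ennreal (s powr (- \<delta> - 1)) * indicator {t..} s)"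
    proof cases
      case 2
      then have "s / t \<le> t / s" using t by (simp add: field_simps mult_mono)
      then have "schur \<delta> t s * (1 / s) = t powr (- \<delta>) * s powr (\<delta> - 1)"
        using 2 t by (simp add: schur_def powr_divide powr_minus powr_diff field_simps)
      then have "ennreal (schur \<delta> t s) * inv_weight s = ennreal (t powr (- \<delta>)) * (ennreal (s powr (\<delta> - 1)) * indicator {0..t} s)"
        using 2 by (simp add: inv_weight_def schur_nonneg flip: ennreal_mult)
      then show ?thesis by (simp add: add_increasing2)
    next
      case 3
      then have "t / s \<le> s / t" using t by (simp add: field_simps mult_mono)
      then have "schur \<delta> t s * (1 / s) = t powr \<delta> * s powr (- \<delta> - 1)"
        using 3 t by (simp add: schur_def powr_divide powr_minus powr_diff field_simps)
      then have "ennreal (schur \<delta> t s) * inv_weight s = ennreal (t powr \<delta>) * (ennreal (s powr (- \<delta> - 1)) * indicator {t..} s)"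
        using 3 t by (simp add: inv_weight_def schur_nonneg flip: ennreal_mult)
      then show ?thesis by (simp add: add_increasing)
    qed (simp add: inv_weight_def)
  qed
  also have "\<dots> = ennreal (t powr (- \<delta>)) * ennreal (t powr \<delta> / \<delta>) + ennreal (t powr \<delta>) * ennreal (t powr (- \<delta>) / \<delta>)"
    by (subst nn_integral_add) (auto simp: nn_integral_cmult 1 2)
  also have "\<dots> = ennreal (2 / \<delta>)"
    using \<delta> t by (simp add: powr_minus flip: ennreal_mult ennreal_plus)
  finally show ?thesis .
qed

text \<open>The kernel is split into two square roots for Cauchy-Schwarz. By its symmetry the same
  bound \<open>2 / \<delta>\<close> serves for the integral in either variable.\<close>

lemma Schur_test:
  assumes \<delta>: "0 < \<delta>" and [measurable]: "b \<in> borel_measurable borel"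
  shows "(\<integral>\<^sup>+ t. (\<integral>\<^sup>+ s. ennreal (schur \<delta> t s) * b s * inv_weight s \<partial>lborel)\<^sup>2 * inv_weight t \<partial>lborel) \<le>
    ennreal ((2 / \<delta>)\<^sup>2) * (\<integral>\<^sup>+ s. (b s)\<^sup>2 * inv_weight s \<partial>lborel)"
proof -
  let ?c = "ennreal (2 / \<delta>)"
  have "(\<integral>\<^sup>+ t. (\<integral>\<^sup>+ s. ennreal (schur \<delta> t s) * b s * inv_weight s \<partial>lborel)\<^sup>2 * inv_weight t \<partial>lborel) \<le>
    (\<integral>\<^sup>+ t. \<integral>\<^sup>+ s. ?c * ((b s)\<^sup>2 * inv_weight s) * (ennreal (schur \<delta> s t) * inv_weight t) \<partial>lborel \<partial>lborel)"
  proof (intro nn_integral_mono)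
    fix t :: real
    show "(\<integral>\<^sup>+ s. ennreal (schur \<delta> t s) * b s * inv_weight s \<partial>lborel)\<^sup>2 * inv_weight t \<le>
      (\<integral>\<^sup>+ s. ?c * ((b s)\<^sup>2 * inv_weight s) * (ennreal (schur \<delta> s t) * inv_weight t) \<partial>lborel)"
    proof (cases "0 < t")
      case True
      let ?m = "\<lambda>s. esqrt (ennreal (schur \<delta> t s) * inv_weight s)"
      have "(\<integral>\<^sup>+ s. ennreal (schur \<delta> t s) * b s * inv_weight s \<partial>lborel) = (\<integral>\<^sup>+ s. ?m s * (?m s * b s) \<partial>lborel)"
      proof (intro nn_integral_cong)
        fix s
        have "?m s * (?m s * b s) = (?m s)\<^sup>2 * b s"
          by (simp only: power2_eq_square mult.assoc)
        then show "ennreal (schur \<delta> t s) * b s * inv_weight s = ?m s * (?m s * b s)"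
          by (simp add: mult_ac)
      qed
      then have "(\<integral>\<^sup>+ s. ennreal (schur \<delta> t s) * b s * inv_weight s \<partial>lborel)\<^sup>2 \<le>
        (\<integral>\<^sup>+ s. (?m s)\<^sup>2 \<partial>lborel) * (\<integral>\<^sup>+ s. (?m s * b s)\<^sup>2 \<partial>lborel)"
        by (simp only:) (rule Cauchy_Schwarz_nn_integral, auto)
      also have "\<dots> \<le> ?c * (\<integral>\<^sup>+ s. (?m s * b s)\<^sup>2 \<partial>lborel)"
        using nn_integral_schur_le[OF \<delta> True] by (intro mult_right_mono) auto
      finally have "(\<integral>\<^sup>+ s. ennreal (schur \<delta> t s) * b s * inv_weight s \<partial>lborel)\<^sup>2 * inv_weight t \<le>
        ?c * (\<integral>\<^sup>+ s. (?m s * b s)\<^sup>2 \<partial>lborel) * inv_weight t"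
        by (rule mult_right_mono) simp
      also have "\<dots> = (\<integral>\<^sup>+ s. ?c * (?m s * b s)\<^sup>2 * inv_weight t \<partial>lborel)"
        by (simp add: nn_integral_cmult nn_integral_multc)
      also have "\<dots> = (\<integral>\<^sup>+ s. ?c * ((b s)\<^sup>2 * inv_weight s) * (ennreal (schur \<delta> s t) * inv_weight t) \<partial>lborel)"
        by (intro nn_integral_cong) (simp add: power_mult_distrib schur_commute mult_ac)
      finally show ?thesis .
    qed (simp add: inv_weight_def)
  qed
  also have "\<dots> = (\<integral>\<^sup>+ s. \<integral>\<^sup>+ t. ?c * ((b s)\<^sup>2 * inv_weight s) * (ennreal (schur \<delta> s t) * inv_weight t) \<partial>lborel \<partial>lborel)"
    by (rule nn_integral_lborel_swap) measurable
  also have "\<dots> \<le> (\<integral>\<^sup>+ s. ?c * ((b s)\<^sup>2 * inv_weight s) * ?c \<partial>lborel)"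
  proof (intro nn_integral_mono)
    fix s :: real
    have "(\<integral>\<^sup>+ t. ?c * ((b s)\<^sup>2 * inv_weight s) * (ennreal (schur \<delta> s t) * inv_weight t) \<partial>lborel) =
      ?c * ((b s)\<^sup>2 * inv_weight s) * (\<integral>\<^sup>+ t. ennreal (schur \<delta> s t) * inv_weight t \<partial>lborel)"
      by (rule nn_integral_cmult) measurable
    also have "\<dots> \<le> ?c * ((b s)\<^sup>2 * inv_weight s) * ?c"
    proof (cases "0 < s")
      case True
      then show ?thesis by (intro mult_left_mono nn_integral_schur_le \<delta>) auto
    qed (simp add: inv_weight_def)
    finally show "(\<integral>\<^sup>+ t. ?c * ((b s)\<^sup>2 * inv_weight s) * (ennreal (schur \<delta> s t) * inv_weight t) \<partial>lborel) \<le>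
      ?c * ((b s)\<^sup>2 * inv_weight s) * ?c" .
  qed
  also have "\<dots> = (\<integral>\<^sup>+ s. ennreal ((2 / \<delta>)\<^sup>2) * ((b s)\<^sup>2 * inv_weight s) \<partial>lborel)"
  proof -
    have "ennreal ((2 / \<delta>)\<^sup>2) = ?c * ?c"
      using \<delta> by (simp only: power2_eq_square) (simp add: ennreal_mult[symmetric])
    then show ?thesis by (simp add: mult_ac)
  qed
  also have "\<dots> = ennreal ((2 / \<delta>)\<^sup>2) * (\<integral>\<^sup>+ s. (b s)\<^sup>2 * inv_weight s \<partial>lborel)"
    by (rule nn_integral_cmult) measurable
  finally show ?thesis .
qed

text \<open>The radii grow with \<open>k\<close> because at height about \<open>2^k r\<close> the
  off-diagonal decay only sets in at distances of that order. The index \<open>j = 0\<close> stands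
  for the full ball of radius \<open>2^(k + 1) r\<close>.\<close>

definition annulus :: "real ^ 'n::finite \<Rightarrow> real \<Rightarrow> nat \<Rightarrow> nat \<Rightarrow> (real ^ 'n) set" where
  "annulus x0 r k j = {y. (j = 0 \<or> 2 ^ (k + j) * r \<le> dist y x0) \<and> dist y x0 < 2 ^ (k + j + 1) * r}"

text \<open>The index \<open>k = 0\<close> collects all heights below \<open>2 r\<close>, including
  those much smaller than \<open>r\<close>.\<close>

definition strip :: "real \<Rightarrow> nat \<Rightarrow> real set" where
  "strip r k = {t. (k = 0 \<or> 2 ^ k * r \<le> t) \<and> t < 2 ^ (k + 1) * r}"

lemma annulus_measurable [measurable]: "annulus x0 r k j \<in> sets borel"
  unfolding annulus_def by measurable

lemma strip_measurable [measurable]: "strip r k \<in> sets borel"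
  unfolding strip_def by measurable

text \<open>For \<open>j > 0\<close>, \<open>2^(k + j) r - r \<ge> 2^(k + j - 1) r\<close>.
  Nonemptiness matters: \<open>setdist\<close> from the empty set is 0.\<close>

lemma setdist_annulus_ge:
  assumes r: "0 < r" and j: "0 < j" and ne: "annulus x0 r k j \<noteq> {}"
  shows "2 ^ (k + j - 1) * r \<le> setdist (annulus x0 r k j) (ball x0 r)"
proof (rule le_setdistI[OF ne])
  show "ball x0 r \<noteq> {}" using r by simp
  fix x y assume "x \<in> annulus x0 r k j" "y \<in> ball x0 r"
  then have "2 ^ (k + j) * r \<le> dist x x0" "dist y x0 < r"
    using j by (auto simp: annulus_def dist_commute)
  moreover have "dist x x0 \<le> dist x y + dist y x0" by (rule dist_triangle)
  moreover have "(2 :: real) ^ (k + j) = 2 * 2 ^ (k + j - 1)"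
    using j by (simp add: power_Suc[symmetric] del: power_Suc)
  moreover have "r \<le> 2 ^ (k + j - 1) * r" using r by simp
  ultimately show "2 ^ (k + j - 1) * r \<le> dist x y" by simp
qed

locale tent_kernel = L2_kernel K M for K :: "('n::finite, 'm::finite) kernel" and M +
  fixes p N' C :: real
  assumes p: "1 \<le> p" "p \<le> 2" and N': "real CARD('n) / 2 < N'" and C: "0 < C"
    and offdiag: "E \<in> sets borel \<Longrightarrow> F \<in> sets borel \<Longrightarrow> 0 < t \<Longrightarrow> 0 < s \<Longrightarrow>
           Lp_L2_norm p (\<lambda>f. cutoff E (K t s (cutoff F f)))
             \<le> ennreal (C * max t s powr (- real CARD('n) * (1 / p - 1 / 2))
                         * (1 + setdist E F / max t s) powr (- N'))"
begin

text \<open>The gain per dyadic scale in passing from L^p to L^2. It is at most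
  \<open>n / 2\<close>, since \<open>1 \<le> p\<close>, and therefore below
  \<open>N'\<close>.\<close>

definition n\<theta> :: real where "n\<theta> = real CARD('n) * (1 / p - 1 / 2)"

definition "unit_vol = unit_ball_vol (real CARD('n))"

definition "off_const = 2 * C * unit_vol powr (1 / p - 1 / 2)"

text \<open>\<open>M\<close> covers the piece \<open>k = j = 0\<close>, the other summand the
  remaining pieces. The factor \<open>4 powr N'\<close> absorbs two off-by-ones: the distance is
  only \<open>2^(k + j - 1) r\<close>, while \<open>max t s\<close> may reach
  \<open>2^(k + 1) r\<close>.\<close>

definition "piece_const = M + off_const * 4 powr N'"

lemma unit_vol_pos: "0 < unit_vol"
  by (simp add: unit_vol_def unit_ball_vol_nat_pos)

lemma n\<theta>_bounds: "0 \<le> n\<theta>" "n\<theta> \<le> real CARD('n) / 2"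
proof -
  have "1 / p - 1 / 2 \<le> 1 / 2" "0 \<le> 1 / p - 1 / 2" using p by (simp_all add: field_simps)
  then show "0 \<le> n\<theta>" "n\<theta> \<le> real CARD('n) / 2"
    unfolding n\<theta>_def using mult_left_mono[of "1 / p - 1 / 2" "1 / 2" "real CARD('n)"] by auto
qed

lemma N'_pos: "0 < N'"
  using N' by (rule le_less_trans[rotated]) simp

lemma off_const_nonneg: "0 \<le> off_const"
  using C by (simp add: off_const_def)

text \<open>Hoelder on the support contributes \<open>r powr n\<theta>\<close>, which combines with
  the power of \<open>max t s\<close> in the hypothesis into the scale-invariant factor
  \<open>(max t s / r) powr (- n\<theta>)\<close>.\<close>

lemma l2_offdiag_le:
  assumes ts: "0 < t" "0 < s" and u: "u \<in> Lp 2" and r: "0 < r"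
    and supp: "\<And>x. x \<notin> ball x0 r \<Longrightarrow> u x = 0" and E: "E \<in> sets borel"
  shows "esqrt (l2 (cutoff E (K t s u))) \<le> ennreal (off_const * (max t s / r) powr (- n\<theta>) *
    (1 + setdist E (ball x0 r) / max t s) powr (- N')) * esqrt (l2 u)"
proof -
  let ?\<mu> = "max t s" and ?V = "unit_ball_vol (real CARD('n))" and ?\<theta> = "1 / p - 1 / 2"
  let ?D = "(1 + setdist E (ball x0 r) / ?\<mu>) powr (- N')"
  have \<mu>: "0 < ?\<mu>" using ts by simp
  have cut: "cutoff (ball x0 r) u = u"
    using supp by (auto simp: cutoff_def fun_eq_iff indicator_def)
  note Lpu = Lp_norm_local_le[OF p u r supp]
  have "Lp_norm p u < top"
    using u by (intro order_le_less_trans[OF Lpu]) (auto simp: ennreal_mult_less_top Lp_2_iff)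
  then have uX: "u \<in> Lp p \<inter> Lp 2" using u by (simp add: Lp_def Lp_2_iff)
  have "Lp_norm 2 (cutoff E (K t s (cutoff (ball x0 r) u))) \<le>
     ennreal (C * ?\<mu> powr (- real CARD('n) * ?\<theta>) * ?D) * Lp_norm p u"
    by (rule op_norm_le[of "Lp p \<inter> Lp 2" "Lp_norm p" "Lp_norm 2" "\<lambda>f. cutoff E (K t s (cutoff (ball x0 r) f))",
          OF offdiag[OF E _ ts, unfolded Lp_L2_norm_def] uX \<open>Lp_norm p u < top\<close>])
      (use C in auto)
  also have "\<dots> \<le> ennreal (C * ?\<mu> powr (- real CARD('n) * ?\<theta>) * ?D) *
      (ennreal (2 * (?V * r ^ CARD('n)) powr ?\<theta>) * esqrt (l2 u))"
    by (intro mult_left_mono Lpu) auto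
  also have "\<dots> = ennreal (C * ?\<mu> powr (- real CARD('n) * ?\<theta>) * ?D * (2 * (?V * r ^ CARD('n)) powr ?\<theta>)) * esqrt (l2 u)"
    using C by (subst mult.assoc[symmetric], subst ennreal_mult[symmetric]) auto
  also have "C * ?\<mu> powr (- real CARD('n) * ?\<theta>) * ?D * (2 * (?V * r ^ CARD('n)) powr ?\<theta>) =
    off_const * (?\<mu> / r) powr (- n\<theta>) * ?D"
  proof -
    have "(?V * r ^ CARD('n)) powr ?\<theta> = unit_vol powr ?\<theta> * r powr n\<theta>"
      using r unit_vol_pos
      by (simp add: unit_vol_def powr_mult n\<theta>_def powr_powr flip: powr_realpow)
    moreover have "(?\<mu> / r) powr (- n\<theta>) = ?\<mu> powr (- n\<theta>) * r powr n\<theta>"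
      using r \<mu> by (simp add: powr_divide powr_minus field_simps)
    ultimately show ?thesis
      by (simp add: off_const_def n\<theta>_def mult_ac)
  qed
  finally show ?thesis unfolding cut Lp_norm_2 .
qed

text \<open>Three regimes. For \<open>j = 0 < k\<close> the height alone gives decay, as
  \<open>max t s \<ge> 2^k r\<close>. For \<open>j > 0\<close> the distance takes over. For
  \<open>k = j = 0\<close> only the uniform L^2 bound is available.\<close>

lemma l2_annulus_le:
  assumes ts: "0 < t" "0 < s" "s < r" and u: "u \<in> Lp 2" and r: "0 < r"
    and supp: "\<And>x. x \<notin> ball x0 r \<Longrightarrow> u x = 0" and t: "t \<in> strip r k"
  shows "esqrt (l2 (cutoff (annulus x0 r k j) (K t s u))) \<le>
    ennreal (piece_const * 2 powr (- real k * n\<theta> - real j * N')) * esqrt (l2 u)"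
proof -
  let ?A = "annulus x0 r k j"
  let ?\<rho> = "max t s / r"
  have piece: "off_const * 4 powr N' \<le> piece_const" "M \<le> piece_const"
    using M_nonneg off_const_nonneg by (simp_all add: piece_const_def)
  have pc: "0 \<le> piece_const" using piece M_nonneg by simp
  have \<rho>: "0 < ?\<rho>" "?\<rho> \<le> 2 powr (real k + 1)"
  proof -
    have "1 * r \<le> 2 ^ (k + 1) * r" using r by (intro mult_right_mono one_le_power) auto
    then have "s \<le> 2 ^ (k + 1) * r" using ts(3) by linarith
    moreover have "t \<le> 2 ^ (k + 1) * r" using t by (simp add: strip_def)
    ultimately have "max t s \<le> 2 ^ (k + 1) * r" by (rule max.boundedI[rotated])
    moreover have "(2::real) ^ (k + 1) = 2 powr (real k + 1)" by (simp add: powr_add powr_realpow)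
    ultimately show "?\<rho> \<le> 2 powr (real k + 1)" using r by (simp add: field_simps)
  qed (use ts r in auto)
  have off: "off_const * ?\<rho> powr (- n\<theta>) * (1 + setdist ?A (ball x0 r) / max t s) powr (- N') \<le>
      piece_const * 2 powr (- real k * n\<theta> - real j * N')" if ne: "?A \<noteq> {}" and kj: "0 < k \<or> 0 < j"
  proof (cases "j = 0")
    case True
    then have k: "0 < k" using kj by simp
    have "2 ^ k \<le> ?\<rho>"
      using t r k by (auto simp: strip_def field_simps max_def)
    then have "?\<rho> powr (- n\<theta>) \<le> (2 ^ k) powr (- n\<theta>)"
      using n\<theta>_bounds by (intro powr_mono2') auto
    also have "\<dots> = 2 powr (- real k * n\<theta>)"
      by (simp add: powr_powr flip: powr_realpow)
    finally have 1: "?\<rho> powr (- n\<theta>) \<le> 2 powr (- real k * n\<theta>)" .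
    have "(1 + setdist ?A (ball x0 r) / max t s) powr (- N') \<le> 1 powr (- N')"
      using N'_pos ts by (intro powr_mono2') (auto intro!: divide_nonneg_pos setdist_pos_le)
    then have 2: "(1 + setdist ?A (ball x0 r) / max t s) powr (- N') \<le> 1" by simp
    have "off_const * ?\<rho> powr (- n\<theta>) * (1 + setdist ?A (ball x0 r) / max t s) powr (- N') \<le>
      off_const * 2 powr (- real k * n\<theta>) * 1"
      using off_const_nonneg by (intro mult_mono 1 2) auto
    also have "\<dots> \<le> piece_const * 2 powr (- real k * n\<theta>)"
    proof -
      have "off_const * 1 \<le> off_const * 4 powr N'"
        using off_const_nonneg N'_pos by (intro mult_left_mono ge_one_powr_ge_zero) auto
      then have "off_const \<le> piece_const" using piece by simp
      then show ?thesis by (simp add: mult_right_mono)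
    qed
    finally show ?thesis using True by simp
  next
    case False
    let ?d = "2 powr (real k + real j - 1)"
    have d: "(2::real) ^ (k + j - 1) = ?d"
      using False by (simp add: powr_realpow[symmetric] of_nat_diff)
    have "?d * r \<le> setdist ?A (ball x0 r)"
      using setdist_annulus_ge[OF r _ ne] False d by simp
    then have "?d / ?\<rho> \<le> setdist ?A (ball x0 r) / max t s"
      using ts by (simp add: divide_right_mono)
    then have "(1 + setdist ?A (ball x0 r) / max t s) powr (- N') \<le> (?d / ?\<rho>) powr (- N')"
    proof (intro powr_mono2')
      show "0 < ?d / ?\<rho>" by (intro divide_pos_pos) (use ts r in auto)
    qed (use N'_pos in auto)
    then have "?\<rho> powr (- n\<theta>) * (1 + setdist ?A (ball x0 r) / max t s) powr (- N') \<le>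
       ?\<rho> powr (- n\<theta>) * (?d / ?\<rho>) powr (- N')"
      by (rule mult_left_mono) simp
    also have "\<dots> = ?\<rho> powr (N' - n\<theta>) * ?d powr (- N')"
    proof -
      have id: "R powr (- a) * (d / R) powr (- b) = R powr (b - a) * d powr (- b)"
        if "0 < R" "0 < d" for R d a b :: real
        using that by (simp add: powr_divide powr_minus powr_diff field_simps)
      show ?thesis by (rule id[OF \<rho>(1)]) simp
    qed
    \<comment> \<open>The exponent \<open>N' - n\<theta>\<close> is positive, so an upper bound on
      the ratio suffices. Heights far below \<open>r\<close>, where
      \<open>?\<rho> powr (- n\<theta>)\<close> alone may be large, are thus controlled by the
      spatial decay.\<close>
    also have "\<dots> \<le> (2 powr (real k + 1)) powr (N' - n\<theta>) * ?d powr (- N')"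
      using \<rho> N' n\<theta>_bounds by (intro mult_right_mono powr_mono2) auto
    also have "\<dots> = 2 powr (2 * N' - n\<theta> - real k * n\<theta> - real j * N')"
      by (simp add: powr_powr algebra_simps flip: powr_add)
    also have "\<dots> \<le> 2 powr (2 * N' - real k * n\<theta> - real j * N')"
      using n\<theta>_bounds by (intro powr_mono) auto
    also have "\<dots> = 4 powr N' * 2 powr (- real k * n\<theta> - real j * N')"
    proof -
      have "(4::real) powr N' = 2 powr (2 * N')"
        by (simp add: powr_powr[symmetric])
      then show ?thesis by (simp add: algebra_simps flip: powr_add)
    qed
    finally have "off_const * (?\<rho> powr (- n\<theta>) * (1 + setdist ?A (ball x0 r) / max t s) powr (- N')) \<le>
       off_const * (4 powr N' * 2 powr (- real k * n\<theta> - real j * N'))"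
      using off_const_nonneg by (rule mult_left_mono)
    also have "\<dots> \<le> piece_const * 2 powr (- real k * n\<theta> - real j * N')"
      using piece(1) by (simp add: mult.assoc[symmetric] mult_right_mono)
    finally show ?thesis by (simp add: mult.assoc)
  qed
  consider "?A = {}" | "?A \<noteq> {}" "0 < k \<or> 0 < j" | "k = 0" "j = 0" by blast
  then show ?thesis
  proof cases
    case 1
    then show ?thesis by (simp add: cutoff_def l2_def)
  next
    case 2
    show ?thesis
      using off[OF 2]
      by (intro order_trans[OF l2_offdiag_le[OF ts(1,2) u r supp]] mult_right_mono ennreal_leI) auto
  next
    \<comment> \<open>Here \<open>max t s\<close> may be arbitrarily small and the annulus meets the
      support, so for \<open>n\<theta> > 0\<close> the off-diagonal bound can blow up.\<close>
    case 3
    have "l2 (cutoff ?A (K t s u)) \<le> ennreal (M\<^sup>2) * l2 u"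
      using l2_cutoff_le l2_K_le[OF ts(1,2) u] by (rule order_trans)
    then have "esqrt (l2 (cutoff ?A (K t s u))) \<le> esqrt (ennreal (M\<^sup>2) * l2 u)"
      by simp
    also have "\<dots> = ennreal M * esqrt (l2 u)"
      using M_nonneg by (simp add: esqrt_mult esqrt_ennreal)
    also have "\<dots> \<le> ennreal piece_const * esqrt (l2 u)"
      using piece by (intro mult_right_mono ennreal_leI) auto
    finally show ?thesis using 3 by simp
  qed
qed

end

section \<open>Estimates on atoms and on the tent space\<close>

definition majorant ::
  "(real \<Rightarrow> real \<Rightarrow> real) \<Rightarrow> (real \<times> real \<times> (real ^ 'n::finite) \<Rightarrow> complex ^ 'm::finite) \<Rightarrow>
   real \<times> (real ^ 'n) \<Rightarrow> ennreal" where
  "majorant w H z = (\<integral>\<^sup>+ s. ennreal (w (fst z) s) * enorm (H (fst z, s, snd z)) * inv_weight s \<partial>lborel)"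

lemma AE_lborel_pair:
  assumes "AE ts in (lborel :: ('a::euclidean_space \<times> 'b::euclidean_space) measure). P ts"
  shows "AE t in lborel. AE s in lborel. P (t, s)"
proof (rule lborel_pair.AE_pair)
  show "AE ts in lborel \<Otimes>\<^sub>M lborel. P ts"
    using assms by (simp only: lborel_prod)
qed

lemma geometric_ennreal_suminf:
  assumes "0 \<le> q" "q < 1" "0 \<le> c"
  shows "(\<Sum>k::nat. ennreal (c * q ^ k)) = ennreal (c / (1 - q))"
  using assms by (subst suminf_ennreal2) (auto simp: suminf_mult suminf_geometric summable_geometric summable_mult)

lemma dyadic_cover:
  assumes r: "0 < r" and t: "0 < t"
  shows "\<exists>k j. t \<in> strip r k \<and> y \<in> annulus x0 r k j"
proof -
  have ex: "\<exists>n::nat. a < 2 ^ n * r" for a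
  proof -
    obtain n where "a / r < 2 ^ n" using real_arch_pow[of 2 "a / r"] by auto
    then show ?thesis using r by (auto simp: field_simps)
  qed
  have shift: "\<exists>k. (k = 0 \<or> 2 ^ (i + k) * r \<le> a) \<and> a < 2 ^ (i + k + 1) * r" for a i
  proof -
    define k where "k = (LEAST k. a < 2 ^ (i + k + 1) * r)"
    have "\<exists>k. a < 2 ^ (i + k + 1) * r"
    proof -
      obtain n where "a < 2 ^ n * r" using ex by blast
      also have "2 ^ n * r \<le> 2 ^ (i + n + 1) * r"
        using r by (intro mult_right_mono power_increasing) auto
      finally show ?thesis by (rule exI)
    qed
    then have "a < 2 ^ (i + k + 1) * r" unfolding k_def by (rule LeastI_ex)
    moreover have "2 ^ (i + k) * r \<le> a" if "k \<noteq> 0"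
      using not_less_Least[of "k - 1" "\<lambda>k. a < 2 ^ (i + k + 1) * r", folded k_def] that by auto
    ultimately show ?thesis by (intro exI[of _ k]) auto
  qed
  obtain k where "t \<in> strip r k"
    using shift[of 0 t] by (auto simp: strip_def)
  moreover obtain j where "y \<in> annulus x0 r k j"
    using shift[of k "dist y x0"] by (auto simp: annulus_def)
  ultimately show ?thesis by blast
qed

text \<open>This bound on the weight covers both kernels: \<open>(t/s)^\<alpha>\<close> for \<open>t < s\<close> (with any admissible \<open>\<sigma>\<close> and \<open>\<delta> = \<alpha>\<close>) and
  \<open>(s/t)^\<beta>\<close> for \<open>s < t\<close> (with \<open>\<beta> = \<sigma> + \<delta>\<close>).\<close>

locale weighted_tent_kernel = tent_kernel K M p N' C
  for K :: "('n::finite, 'm::finite) kernel" and M p N' C +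
  fixes w :: "real \<Rightarrow> real \<Rightarrow> real" and \<sigma> \<delta> :: real
  assumes w_borel: "(\<lambda>q. w (fst q) (snd q)) \<in> borel_measurable borel"
    and w_le: "0 < t \<Longrightarrow> 0 < s \<Longrightarrow> w t s \<le> min 1 (s / t) powr \<sigma> * schur \<delta> t s"
    and \<delta>: "0 < \<delta>" and \<sigma>: "real CARD('n) * (1 - 1 / p) < \<sigma>"
begin

lemma w_measurable [measurable (raw)]:
  assumes [measurable]: "f \<in> borel_measurable N" "g \<in> borel_measurable N"
  shows "(\<lambda>x. w (f x) (g x)) \<in> borel_measurable N"
proof -
  have "(\<lambda>x. (f x, g x)) \<in> borel_measurable N" by measurable
  from measurable_compose[OF this w_borel] show ?thesis by simp
qed

lemma borel_measurable_majorant [measurable (raw)]: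
  fixes H :: "real \<times> real \<times> (real ^ 'n) \<Rightarrow> complex ^ 'm"
  assumes [measurable]: "H \<in> borel_measurable borel" and f: "f \<in> borel_measurable N"
  shows "(\<lambda>x. majorant w H (f x)) \<in> borel_measurable N"
proof -
  have "majorant w H \<in> borel_measurable borel"
    unfolding majorant_def[abs_def] by measurable
  from measurable_compose[OF f this] show ?thesis .
qed

lemma \<sigma>_pos: "0 < \<sigma>"
proof -
  have "0 \<le> real CARD('n) * (1 - 1 / p)" using p by simp
  then show ?thesis using \<sigma> by linarith
qed

text \<open>The atom has heights \<open>s < r\<close>, while \<open>t \<ge> 2^k r\<close> for
  \<open>k > 0\<close>; hence \<open>s / t \<le> 2^(-k)\<close>. The \<sigma>-part of the weight
  turns into decay in \<open>k\<close>, and the \<delta>-part is kept for the Schur test.\<close>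

lemma w_strip_le:
  assumes "0 < t" "0 < s" "s < r" "t \<in> strip r k"
  shows "w t s \<le> 2 powr (- real k * \<sigma>) * schur \<delta> t s"
proof -
  have "min 1 (s / t) \<le> 2 powr (- real k)"
  proof (cases "k = 0")
    case False
    have "2 ^ k * s \<le> 2 ^ k * r" using assms by (intro mult_left_mono) auto
    also have "\<dots> \<le> t" using assms False by (simp add: strip_def)
    finally have "2 ^ k * s \<le> t" .
    then have "s / t \<le> 2 powr (- real k)"
      using assms by (simp add: powr_minus powr_realpow field_simps)
    then show ?thesis by simp
  qed simp
  then have "min 1 (s / t) powr \<sigma> \<le> (2 powr (- real k)) powr \<sigma>"
    using \<sigma>_pos assms by (intro powr_mono2) auto
  then have "min 1 (s / t) powr \<sigma> * schur \<delta> t s \<le> 2 powr (- real k * \<sigma>) * schur \<delta> t s"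
    by (intro mult_right_mono) (auto simp: powr_powr schur_nonneg)
  then show ?thesis using w_le[OF assms(1,2)] by linarith
qed

text \<open>Minkowski's inequality moves the L^2 norm in \<open>x\<close> inside the integral in
  \<open>s\<close>. Then \<open>l2_annulus_le\<close> reduces everything to the norms of the slices
  of \<open>a\<close>, and the Schur test handles the two heights.\<close>

lemma energy_piece_le:
  fixes a :: "('n, 'm) tfun"
  assumes a: "L2_slices a" and H: "version a H" and r: "0 < r"
    and supp: "\<And>z. 0 < fst z \<Longrightarrow> a z \<noteq> 0 \<Longrightarrow> fst z < r \<and> dist (snd z) x0 < r"
  shows "energy (\<lambda>z. indicator (strip r k \<times> annulus x0 r k j) z * majorant w H z) \<le>
    ennreal ((piece_const * 2 powr (- real k * (n\<theta> + \<sigma>) - real j * N') * (2 / \<delta>))\<^sup>2) * energy (\<lambda>z. enorm (a z))"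
proof -
  note [measurable] = versionD(1)[OF H]
  have [measurable]: "a \<in> borel_measurable borel" using a by (simp add: L2_slices_def)
  let ?A = "annulus x0 r k j"
  let ?Q = "piece_const * 2 powr (- real k * n\<theta> - real j * N')"
  let ?Q' = "piece_const * 2 powr (- real k * (n\<theta> + \<sigma>) - real j * N')"
  let ?b = "\<lambda>s. esqrt (l2 (\<lambda>y. a (s, y)))"
  let ?g = "\<lambda>t s. ennreal (w t s) * inv_weight s * esqrt (l2 (cutoff ?A (\<lambda>x. H (t, s, x))))"
  have pc: "0 \<le> piece_const"
    using M_nonneg off_const_nonneg by (simp add: piece_const_def)
  have [measurable]: "?b \<in> borel_measurable borel"
    unfolding l2_def by measurable
  have bound: "AE s in lborel. ?g t s \<le> ennreal ?Q' * (ennreal (schur \<delta> t s) * ?b s * inv_weight s)"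
    if t: "0 < t" "t \<in> strip r k"
      and ae: "AE s in lborel. 0 < t \<and> 0 < s \<longrightarrow> (AE x in lborel. H (t, s, x) = K t s (\<lambda>y. a (s, y)) x)"
    for t
    using ae a[unfolded L2_slices_def, THEN conjunct2]
  proof eventually_elim
    case (elim s)
    show ?case
    proof (cases "0 < s")
      case True
      then have u: "(\<lambda>y. a (s, y)) \<in> Lp 2" using elim by simp
      have "AE x in lborel. H (t, s, x) = K t s (\<lambda>y. a (s, y)) x" using elim t True by simp
      then have "AE x in lborel. cutoff ?A (\<lambda>x. H (t, s, x)) x = cutoff ?A (K t s (\<lambda>y. a (s, y))) x"
        by eventually_elim (simp add: cutoff_def)
      then have eq: "l2 (cutoff ?A (\<lambda>x. H (t, s, x))) = l2 (cutoff ?A (K t s (\<lambda>y. a (s, y))))"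
        by (rule l2_cong_AE)
      show ?thesis
      proof (cases "s < r")
        case sr: True
        have "esqrt (l2 (cutoff ?A (\<lambda>x. H (t, s, x)))) \<le> ennreal ?Q * ?b s"
          unfolding eq
          by (rule l2_annulus_le[OF t(1) True sr u r _ t(2)])
            (use supp[of "(s, _)"] True in \<open>auto simp: dist_commute\<close>)
        then have "?g t s \<le> ennreal (2 powr (- real k * \<sigma>) * schur \<delta> t s) * inv_weight s * (ennreal ?Q * ?b s)"
          using w_strip_le[OF t(1) True sr t(2)] by (intro mult_mono ennreal_leI) auto
        also have "\<dots> = ennreal (?Q * 2 powr (- real k * \<sigma>)) * (ennreal (schur \<delta> t s) * ?b s * inv_weight s)"
          using pc by (simp add: ennreal_mult' ennreal_mult'' schur_nonneg mult_ac)
        also have "?Q * 2 powr (- real k * \<sigma>) = ?Q'"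
          by (simp add: algebra_simps flip: powr_add)
        finally show ?thesis .
      next
        case False
        \<comment> \<open>The atom vanishes at heights \<open>s \<ge> r\<close>. The image of a zero
          slice is null by boundedness, so these \<open>s\<close> contribute nothing.\<close>
        then have "(\<lambda>y. a (s, y)) = (\<lambda>y. 0)"
          using supp[of "(s, _)"] True by fastforce
        then have "l2 (\<lambda>y. a (s, y)) = 0" by (simp add: l2_def)
        then have "l2 (K t s (\<lambda>y. a (s, y))) = 0"
          using l2_K_le[OF t(1) True u] by simp
        then have "l2 (cutoff ?A (\<lambda>x. H (t, s, x))) = 0"
          unfolding eq using l2_cutoff_le[of ?A "K t s (\<lambda>y. a (s, y))"] by simp
        then show ?thesis by simp
      qed
    qed (simp add: inv_weight_def)
  qed
  have "energy (\<lambda>z. indicator (strip r k \<times> ?A) z * majorant w H z) =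
    (\<integral>\<^sup>+ t. \<integral>\<^sup>+ x. (indicator (strip r k \<times> ?A) (t, x) * majorant w H (t, x))\<^sup>2 * inv_weight t \<partial>lborel \<partial>lborel)"
  proof -
    have "(\<lambda>z. (indicator (strip r k \<times> ?A) z * majorant w H z)\<^sup>2 * inv_weight (fst z)) =
      (\<lambda>z. (indicator (strip r k) (fst z) * indicator ?A (snd z) * majorant w H z)\<^sup>2 * inv_weight (fst z))"
      by (auto simp: fun_eq_iff indicator_def)
    then have "(\<lambda>z. (indicator (strip r k \<times> ?A) z * majorant w H z)\<^sup>2 * inv_weight (fst z)) \<in> borel_measurable borel"
      by simp
    from nn_integral_lborel_fst[OF this] show ?thesis
      by (simp add: energy_def)
  qed
  also have "\<dots> \<le> (\<integral>\<^sup>+ t. (ennreal ?Q' * (\<integral>\<^sup>+ s. ennreal (schur \<delta> t s) * ?b s * inv_weight s \<partial>lborel))\<^sup>2 * inv_weight t \<partial>lborel)"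
  proof (rule nn_integral_mono_AE)
    have "AE t in lborel. AE s in lborel. 0 < t \<and> 0 < s \<longrightarrow>
        (AE x in lborel. H (t, s, x) = K t s (\<lambda>y. a (s, y)) x)"
      using AE_lborel_pair[OF versionD(2)[OF H]] by simp
    then show "AE t in lborel. (\<integral>\<^sup>+ x. (indicator (strip r k \<times> ?A) (t, x) * majorant w H (t, x))\<^sup>2 * inv_weight t \<partial>lborel) \<le>
      (ennreal ?Q' * (\<integral>\<^sup>+ s. ennreal (schur \<delta> t s) * ?b s * inv_weight s \<partial>lborel))\<^sup>2 * inv_weight t"
    proof eventually_elim
      case (elim t)
      show ?case
      proof (cases "0 < t \<and> t \<in> strip r k")
        case True
        have "(\<integral>\<^sup>+ x. (indicator (strip r k \<times> ?A) (t, x) * majorant w H (t, x))\<^sup>2 * inv_weight t \<partial>lborel) =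
          (\<integral>\<^sup>+ x. (\<integral>\<^sup>+ s. indicator ?A x * (ennreal (w t s) * enorm (H (t, s, x)) * inv_weight s) \<partial>lborel)\<^sup>2 \<partial>lborel) * inv_weight t"
          using True by (subst nn_integral_multc[symmetric])
            (auto simp: majorant_def nn_integral_cmult indicator_def intro!: nn_integral_cong)
        also have "\<dots> \<le> (\<integral>\<^sup>+ s. esqrt (\<integral>\<^sup>+ x. (indicator ?A x * (ennreal (w t s) * enorm (H (t, s, x)) * inv_weight s))\<^sup>2 \<partial>lborel) \<partial>lborel)\<^sup>2 * inv_weight t"
        proof (intro mult_right_mono Minkowski_nn_integral)
          have "(\<lambda>p. indicator ?A (fst p) * (ennreal (w t (snd p)) * enorm (H (t, snd p, fst p)) * inv_weight (snd p))) \<in> borel_measurable borel"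
            by measurable
          from measurable_lborel_prod[OF this]
          show "(\<lambda>(x, s). indicator ?A x * (ennreal (w t s) * enorm (H (t, s, x)) * inv_weight s)) \<in> borel_measurable (lborel \<Otimes>\<^sub>M lborel)"
            by (simp add: case_prod_beta')
        qed (auto intro: lborel.sigma_finite_measure_axioms)
        also have "\<dots> = (\<integral>\<^sup>+ s. ?g t s \<partial>lborel)\<^sup>2 * inv_weight t"
        proof -
          have "esqrt (\<integral>\<^sup>+ x. (indicator ?A x * (ennreal (w t s) * enorm (H (t, s, x)) * inv_weight s))\<^sup>2 \<partial>lborel) = ?g t s" for s
          proof -
            have "(\<integral>\<^sup>+ x. (indicator ?A x * (ennreal (w t s) * enorm (H (t, s, x)) * inv_weight s))\<^sup>2 \<partial>lborel) =
              (\<integral>\<^sup>+ x. (ennreal (w t s) * inv_weight s)\<^sup>2 * (enorm (cutoff ?A (\<lambda>x. H (t, s, x)) x))\<^sup>2 \<partial>lborel)"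
              by (intro nn_integral_cong) (auto simp: cutoff_def indicator_def power2_eq_square mult_ac)
            also have "\<dots> = (ennreal (w t s) * inv_weight s)\<^sup>2 * l2 (cutoff ?A (\<lambda>x. H (t, s, x)))"
              unfolding l2_def cutoff_def by (rule nn_integral_cmult) measurable
            finally show ?thesis by (simp add: esqrt_mult)
          qed
          then show ?thesis by simp
        qed
        also have "\<dots> \<le> (\<integral>\<^sup>+ s. ennreal ?Q' * (ennreal (schur \<delta> t s) * ?b s * inv_weight s) \<partial>lborel)\<^sup>2 * inv_weight t"
          using bound[of t] True elim by (intro mult_right_mono power_mono nn_integral_mono_AE) auto
        also have "\<dots> = (ennreal ?Q' * (\<integral>\<^sup>+ s. ennreal (schur \<delta> t s) * ?b s * inv_weight s \<partial>lborel))\<^sup>2 * inv_weight t"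
          by (subst nn_integral_cmult) auto
        finally show ?thesis .
      qed (auto simp: inv_weight_def)
    qed
  qed
  also have "\<dots> = (ennreal ?Q')\<^sup>2 * (\<integral>\<^sup>+ t. (\<integral>\<^sup>+ s. ennreal (schur \<delta> t s) * ?b s * inv_weight s \<partial>lborel)\<^sup>2 * inv_weight t \<partial>lborel)"
    by (subst nn_integral_cmult[symmetric]) (auto simp: power_mult_distrib mult.assoc)
  also have "\<dots> \<le> (ennreal ?Q')\<^sup>2 * (ennreal ((2 / \<delta>)\<^sup>2) * (\<integral>\<^sup>+ s. (?b s)\<^sup>2 * inv_weight s \<partial>lborel))"
    by (intro mult_left_mono Schur_test \<delta>) auto
  also have "(\<integral>\<^sup>+ s. (?b s)\<^sup>2 * inv_weight s \<partial>lborel) = energy (\<lambda>z. enorm (a z))"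
    unfolding energy_def esqrt_power2 l2_def
    by (subst nn_integral_lborel_fst[symmetric]) (auto simp: nn_integral_multc)
  also have "(ennreal ?Q')\<^sup>2 * (ennreal ((2 / \<delta>)\<^sup>2) * energy (\<lambda>z. enorm (a z))) =
     ennreal ((?Q' * (2 / \<delta>))\<^sup>2) * energy (\<lambda>z. enorm (a z))"
  proof -
    have sq: "(ennreal q)\<^sup>2 * ennreal (d\<^sup>2) = ennreal ((q * d)\<^sup>2)" if "0 \<le> q" for q d
      using that by (simp add: power_mult_distrib ennreal_power ennreal_mult')
    have "0 \<le> ?Q'" using pc by simp
    from sq[OF this, of "2 / \<delta>"] show ?thesis by (simp only: mult.assoc[symmetric])
  qed
  finally show ?thesis .
qed

end

context L2_kernel
begin

lemma K_sum:
  assumes ts: "0 < t" "0 < s" and u: "\<And>l::nat. u l \<in> Lp 2"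
  shows "(\<lambda>x. \<Sum>l<N. u l x) \<in> Lp 2 \<and> (AE x in lborel. K t s (\<lambda>x. \<Sum>l<N. u l x) x = (\<Sum>l<N. K t s (u l) x))"
proof (induction N)
  case 0
  have "(\<lambda>x. 0) \<in> Lp 2" by (simp add: Lp_2_iff l2_def)
  moreover have "AE x in lborel. K t s (\<lambda>x. 0) x = 0"
    using K_scale[OF ts u, of 0 0] by simp
  ultimately show ?case by simp
next
  case (Suc N)
  then have "(\<lambda>x. (\<Sum>l<N. u l x) + u N x) \<in> Lp 2" using u by (intro Lp_2_add) auto
  moreover have "AE x in lborel. K t s (\<lambda>x. (\<Sum>l<N. u l x) + u N x) x = (\<Sum>l<N. K t s (u l) x) + K t s (u N) x"
    using K_add[OF ts Suc[THEN conjunct1] u[of N]] Suc[THEN conjunct2] by eventually_elim simp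
  ultimately show ?case by simp
qed

text \<open>\<open>K u - K u\<^sub>N\<close> tends to zero in \<open>L\<^sup>2\<close> for the partial sums \<open>u\<^sub>N\<close>, so the
  truncated difference \<open>|K u| - (\<Sum>l. |K u\<^sub>l|)\<close> has vanishing \<open>L\<^sup>2\<close> norm.\<close>

lemma K_disjoint_sum_le:
  assumes ts: "0 < t" "0 < s" and u: "u \<in> Lp 2"
    and B[measurable]: "\<And>l::nat. B l \<in> sets borel" and disj: "disjoint_family B"
    and cover: "AE y in lborel. u y \<noteq> 0 \<longrightarrow> (\<exists>l. y \<in> B l)"
  shows "AE x in lborel. enorm (K t s u x) \<le> (\<Sum>l. enorm (K t s (\<lambda>y. indicator (B l) y *\<^sub>R u y) x))"
proof -
  have [measurable]: "u \<in> borel_measurable borel" using u by (simp add: Lp_2_iff)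
  define v where "v l y = indicator (B l) y *\<^sub>R u y" for l y
  define u' where "u' y = indicator (\<Union>l. B l) y *\<^sub>R u y" for y
  have v: "v l \<in> Lp 2" for l
    unfolding v_def by (rule Lp_2_indicator[OF B u])
  have u': "u' \<in> Lp 2"
    unfolding u'_def by (rule Lp_2_indicator[OF _ u]) measurable
  have Kv[measurable]: "K t s (v l) \<in> borel_measurable borel" for l
    using K_Lp_2[OF ts v] by (simp add: Lp_2_iff)
  have Ku'[measurable]: "K t s u' \<in> borel_measurable borel"
    using K_Lp_2[OF ts u'] by (simp add: Lp_2_iff)
  define uN where "uN N y = (\<Sum>l<N. v l y)" for N y
  have uN: "uN N \<in> Lp 2" "AE x in lborel. K t s (uN N) x = (\<Sum>l<N. K t s (v l) x)" for N
    using K_sum[of t s v N, OF ts v] by (simp_all add: uN_def[abs_def])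
  have uN_eq: "uN N y = indicator (\<Union>l<N. B l) y *\<^sub>R u y" for N y
  proof -
    have "disjoint_family_on B {..<N}"
      using disj by (rule disjoint_family_on_mono[rotated]) simp
    then have "indicator (\<Union>l<N. B l) y = (\<Sum>l<N. indicator (B l) y :: real)"
      by (intro indicator_UN_disjoint) auto
    then show ?thesis by (simp add: uN_def v_def scaleR_sum_left)
  qed
  have conv: "(\<lambda>N. l2 (\<lambda>y. u' y - uN N y)) \<longlonglongrightarrow> 0"
  proof (rule l2_dominated_tendsto_0[where W = "\<lambda>y. enorm (u y)"])
    show "enorm (u' y - uN N y) \<le> enorm (u y)" for N y
      by (intro ennreal_leI) (auto simp: u'_def uN_eq indicator_def)
    show "(\<lambda>N. u' y - uN N y) \<longlonglongrightarrow> 0" for y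
    proof (cases "\<exists>l. y \<in> B l")
      case True
      then obtain l where "y \<in> B l" ..
      then show ?thesis
        by (intro tendsto_eventually eventually_sequentiallyI[of "Suc l"])
          (auto simp: u'_def uN_eq indicator_def)
    qed (auto simp: u'_def uN_eq indicator_def)
    show "(\<lambda>y. u' y - uN N y) \<in> borel_measurable borel" for N
      using Lp_2_diff[OF u' uN(1)[of N]] by (simp add: Lp_2_iff)
  qed (use u in \<open>auto simp: Lp_2_iff l2_def\<close>)
  define g where "g x = (\<Sum>l. enorm (K t s (v l) x))" for x
  have [measurable]: "g \<in> borel_measurable borel"
    unfolding g_def by measurable
  have le: "(\<integral>\<^sup>+ x. (enorm (K t s u' x) - g x)\<^sup>2 \<partial>lborel) \<le> ennreal (M\<^sup>2) * l2 (\<lambda>y. u' y - uN N y)" for N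
  proof -
    have "(\<integral>\<^sup>+ x. (enorm (K t s u' x) - g x)\<^sup>2 \<partial>lborel) \<le> l2 (K t s (\<lambda>y. u' y - uN N y))"
      unfolding l2_def
    proof (rule nn_integral_mono_AE)
      show "AE x in lborel. (enorm (K t s u' x) - g x)\<^sup>2 \<le> (enorm (K t s (\<lambda>y. u' y - uN N y) x))\<^sup>2"
        using K_diff[OF ts u' uN(1)[of N]] uN(2)[of N]
      proof eventually_elim
        case (elim x)
        have "norm (K t s (uN N) x) \<le> (\<Sum>l<N. norm (K t s (v l) x))"
          unfolding elim(2) by (rule norm_sum)
        then have "enorm (K t s (uN N) x) \<le> (\<Sum>l<N. enorm (K t s (v l) x))"
          by (simp add: ennreal_leI)
        also have "\<dots> \<le> g x" unfolding g_def by (rule sum_le_suminf) auto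
        finally have 1: "enorm (K t s (uN N) x) \<le> g x" .
        have "norm (K t s u' x) \<le> norm (K t s (uN N) x) + norm (K t s (\<lambda>y. u' y - uN N y) x)"
          unfolding elim(1) by (metis add.commute norm_triangle_sub)
        then have "enorm (K t s u' x) \<le> enorm (K t s (uN N) x) + enorm (K t s (\<lambda>y. u' y - uN N y) x)"
          by (simp add: ennreal_leI flip: ennreal_plus)
        also have "\<dots> \<le> g x + enorm (K t s (\<lambda>y. u' y - uN N y) x)"
          using 1 by (rule add_right_mono)
        finally show ?case
          by (intro power_mono) (auto simp: ennreal_minus_le_iff)
      qed
    qed
    also have "\<dots> \<le> ennreal (M\<^sup>2) * l2 (\<lambda>y. u' y - uN N y)"
      by (rule l2_K_le[OF ts Lp_2_diff[OF u' uN(1)]])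
    finally show ?thesis .
  qed
  have "(\<lambda>N. ennreal (M\<^sup>2) * l2 (\<lambda>y. u' y - uN N y)) \<longlonglongrightarrow> ennreal (M\<^sup>2) * 0"
    by (intro tendsto_mult_ennreal conv tendsto_const) auto
  then have "(\<integral>\<^sup>+ x. (enorm (K t s u' x) - g x)\<^sup>2 \<partial>lborel) \<le> ennreal (M\<^sup>2) * 0"
    by (rule LIMSEQ_le_const) (use le in blast)
  then have "(\<integral>\<^sup>+ x. (enorm (K t s u' x) - g x)\<^sup>2 \<partial>lborel) = 0" by simp
  then have "AE x in lborel. (enorm (K t s u' x) - g x)\<^sup>2 = 0"
    by (subst (asm) nn_integral_0_iff_AE) measurable
  moreover have "AE x in lborel. K t s u x = K t s u' x"
  proof (rule K_cong_AE[OF ts u u'])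
    show "AE y in lborel. u y = u' y"
      using cover by eventually_elim (auto simp: u'_def indicator_def)
  qed
  ultimately show ?thesis
    by eventually_elim (simp add: g_def v_def[abs_def] ennreal_minus_eq_0)
qed

end

context tent_kernel
begin

text \<open>Ratio of the geometric series over the strips; its exponent is
  \<open>n / 2 - n\<theta> - \<sigma>\<close>.\<close>

definition "decay_k \<sigma> = 2 powr (real CARD('n) * (1 - 1 / p) - \<sigma>)"

definition "decay_j = 2 powr (real CARD('n) / 2 - N')"

text \<open>The weight enters only through \<sigma> and \<delta>. This is the source of uniformity
  in the imaginary part of the exponent.\<close>

definition "atom_const \<sigma> \<delta> =
  unit_vol * 2 ^ CARD('n) * piece_const * (2 / \<delta>) / (1 - decay_j) / (1 - decay_k \<sigma>)"

end

context weighted_tent_kernel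
begin

lemma piece_const_nonneg: "0 \<le> piece_const"
  using M_nonneg off_const_nonneg by (simp add: piece_const_def)

lemma decay_bounds: "0 \<le> decay_k \<sigma>" "decay_k \<sigma> < 1" "0 \<le> decay_j" "decay_j < 1"
  using \<sigma> N' powr_less_mono[of _ 0 2] by (auto simp: decay_k_def decay_j_def)

text \<open>Each piece lives in a region of size \<open>2^(k + j + 1) r\<close>, so
  \<open>tent1_local_le\<close> turns its energy bound into a tent bound at the price of the square
  root of a volume. The pieces then sum as two geometric series. \<open>unit_vol\<close> arises as a
  product of two square roots, one from that volume and one from
  \<open>nn_integral_cone\<close>.\<close>

lemma atom_estimate:
  fixes a :: "('n, 'm) tfun"
  assumes a: "L2_slices a" and H: "version a H" and r: "0 < r"
    and supp: "\<And>z. 0 < fst z \<Longrightarrow> a z \<noteq> 0 \<Longrightarrow> fst z < r \<and> dist (snd z) x0 < r"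
  shows "tent1 (majorant w H) \<le> ennreal (atom_const \<sigma> \<delta>) * esqrt (ennreal (r ^ CARD('n)) * energy (\<lambda>z. enorm (a z)))"
proof -
  note [measurable] = versionD(1)[OF H]
  let ?n = "CARD('n)"
  let ?Y = "esqrt (ennreal (r ^ ?n) * energy (\<lambda>z. enorm (a z)))"
  define D where "D = unit_vol * 2 ^ ?n * piece_const * (2 / \<delta>)"
  have D: "0 \<le> D" using unit_vol_pos piece_const_nonneg \<delta> by (simp add: D_def)
  define P where "P k j z = indicator (strip r k \<times> annulus x0 r k j) z * majorant w H z" for k j z
  have P[measurable]: "P k j \<in> borel_measurable borel" for k j
  proof -
    have "P k j = (\<lambda>z. indicator (strip r k) (fst z) * indicator (annulus x0 r k j) (snd z) * majorant w H z)"
      by (auto simp: P_def fun_eq_iff indicator_def)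
    then show ?thesis by simp
  qed
  have piece: "tent1 (P k j) \<le> ennreal (D * decay_j ^ j * decay_k \<sigma> ^ k) * ?Y" for k j
  proof -
    let ?R = "2 ^ (k + j + 1) * r"
    let ?Q = "piece_const * 2 powr (- real k * (n\<theta> + \<sigma>) - real j * N') * (2 / \<delta>)"
    have Q: "0 \<le> ?Q" using piece_const_nonneg \<delta> by simp
    have "tent1 (P k j) \<le> esqrt (emeasure lborel (ball x0 (?R + ?R))) *
        esqrt (ennreal (unit_ball_vol ?n) * energy (P k j))"
    proof (rule tent1_local_le[OF P])
      fix z assume "P k j z \<noteq> 0"
      then have z: "fst z \<in> strip r k" "snd z \<in> annulus x0 r k j"
        by (auto simp: P_def indicator_def mem_Times_iff split: if_splits)
      have "fst z < 2 ^ (k + 1) * r" using z by (simp add: strip_def)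
      also have "\<dots> \<le> ?R" using r by (intro mult_right_mono power_increasing) auto
      finally show "fst z < ?R \<and> dist (snd z) x0 < ?R"
        using z by (simp add: annulus_def)
    qed
    also have "emeasure lborel (ball x0 (?R + ?R)) = ennreal (unit_vol * 2 powr (real (k + j + 2) * real ?n)) * ennreal (r ^ ?n)"
    proof -
      have "?R + ?R = 2 ^ (k + j + 2) * r" by simp
      then have "emeasure lborel (ball x0 (?R + ?R)) = ennreal (unit_vol * (2 ^ (k + j + 2) * r) ^ ?n)"
        using r by (simp only:) (subst emeasure_ball, auto simp: unit_vol_def)
      also have "(2 ^ (k + j + 2) * r) ^ ?n = 2 powr (real (k + j + 2) * real ?n) * r ^ ?n"
      proof -
        have "2 powr (real (k + j + 2) * real ?n) = (2 powr real (k + j + 2)) powr real ?n"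
          by (rule powr_powr[symmetric])
        then show ?thesis
          by (simp only: power_mult_distrib powr_realpow zero_less_numeral zero_less_power)
      qed
      finally show ?thesis
        using r unit_vol_pos by (simp only: mult.assoc[symmetric]) (rule ennreal_mult, auto)
    qed
    also have "esqrt (ennreal (unit_vol * 2 powr (real (k + j + 2) * real ?n)) * ennreal (r ^ ?n)) *
        esqrt (ennreal (unit_ball_vol ?n) * energy (P k j)) \<le>
      esqrt (ennreal (unit_vol * 2 powr (real (k + j + 2) * real ?n)) * ennreal (r ^ ?n)) *
        esqrt (ennreal unit_vol * (ennreal (?Q\<^sup>2) * energy (\<lambda>z. enorm (a z))))"
      unfolding P_def[abs_def] unit_vol_def[symmetric]
      using energy_piece_le[OF a H r supp, of k j]
      by (intro mult_left_mono) (auto intro: mult_left_mono)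
    also have "\<dots> = esqrt (ennreal ((unit_vol * 2 powr (real (k + j + 2) * real ?n / 2) * ?Q)\<^sup>2) *
       (ennreal (r ^ ?n) * energy (\<lambda>z. enorm (a z))))"
    proof -
      have "(2 powr (real (k + j + 2) * real ?n / 2))\<^sup>2 = (2 :: real) powr (real (k + j + 2) * real ?n)"
        by (simp add: power2_eq_square mult.commute flip: powr_add)
      then have "ennreal ((unit_vol * 2 powr (real (k + j + 2) * real ?n / 2) * ?Q)\<^sup>2) =
        ennreal (unit_vol * 2 powr (real (k + j + 2) * real ?n) * (unit_vol * ?Q\<^sup>2))"
        by (simp only: power_mult_distrib) (simp add: power2_eq_square mult_ac)
      also have "\<dots> = ennreal (unit_vol * 2 powr (real (k + j + 2) * real ?n)) * (ennreal unit_vol * ennreal (?Q\<^sup>2))"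
      proof -
        have "ennreal (b * (c * d)) = ennreal b * (ennreal c * ennreal d)" if "0 \<le> b" "0 \<le> c" for b c d
          using that by (simp add: ennreal_mult')
        then show ?thesis using unit_vol_pos by simp
      qed
      finally show ?thesis
        unfolding esqrt_mult[symmetric] by (simp only: mult_ac)
    qed
    also have "\<dots> = ennreal (unit_vol * 2 powr (real (k + j + 2) * real ?n / 2) * ?Q) * ?Y"
    proof -
      have sq: "esqrt (ennreal (b\<^sup>2) * Y) = ennreal b * esqrt Y" if "0 \<le> b" for b Y
        using that by (simp add: esqrt_mult esqrt_ennreal)
      have "0 \<le> unit_vol * 2 powr (real (k + j + 2) * real ?n / 2) * ?Q"
        using Q unit_vol_pos by (intro mult_nonneg_nonneg[OF _ Q]) simp
      then show ?thesis by (rule sq)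
    qed
    also have "unit_vol * 2 powr (real (k + j + 2) * real ?n / 2) * ?Q = D * decay_j ^ j * decay_k \<sigma> ^ k"
    proof -
      \<comment> \<open>Collecting exponents: \<open>n / 2 - n\<theta> = n (1 - 1 / p)\<close>,
        which is where n/p' appears. The offset 2 in \<open>k + j + 2\<close> leaves the constant
        \<open>2^n\<close>.\<close>
      have "real (k + j + 2) * real ?n / 2 + (- real k * (n\<theta> + \<sigma>) - real j * N') =
        real ?n + (real ?n / 2 - N') * real j + (real ?n * (1 - 1 / p) - \<sigma>) * real k"
        by (simp add: n\<theta>_def algebra_simps add_divide_distrib)
      then have "2 powr (real (k + j + 2) * real ?n / 2) * 2 powr (- real k * (n\<theta> + \<sigma>) - real j * N') =
         2 ^ ?n * decay_j ^ j * decay_k \<sigma> ^ k"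
        by (simp add: decay_j_def decay_k_def powr_powr powr_add[symmetric] flip: powr_realpow)
      then show ?thesis by (simp add: D_def mult_ac)
    qed
    finally show ?thesis .
  qed
  have "tent1 (majorant w H) \<le> tent1 (\<lambda>z. \<Sum>k. \<Sum>j. P k j z)"
  proof (intro tent1_mono_AE AE_I2 impI)
    fix z :: "real \<times> (real ^ 'n)" assume "0 < fst z"
    then obtain k j where kj: "fst z \<in> strip r k" "snd z \<in> annulus x0 r k j"
      using dyadic_cover[OF r, of "fst z" "snd z" x0] by blast
    then have "majorant w H z = P k j z" by (simp add: P_def mem_Times_iff)
    also have "\<dots> \<le> (\<Sum>j. P k j z)"
      using sum_le_suminf[of "\<lambda>j. P k j z" "{j}"] by simp
    also have "\<dots> \<le> (\<Sum>k. \<Sum>j. P k j z)"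
      using sum_le_suminf[of "\<lambda>k. \<Sum>j. P k j z" "{k}"] by simp
    finally show "majorant w H z \<le> (\<Sum>k. \<Sum>j. P k j z)" .
  qed
  also have "\<dots> \<le> (\<Sum>k. tent1 (\<lambda>z. \<Sum>j. P k j z))"
    by (rule tent1_suminf_le) measurable
  also have "\<dots> \<le> (\<Sum>k. \<Sum>j. tent1 (P k j))"
    by (intro suminf_le tent1_suminf_le) auto
  also have "\<dots> \<le> (\<Sum>k. \<Sum>j. ennreal (D * decay_k \<sigma> ^ k * decay_j ^ j) * ?Y)"
    using piece by (intro suminf_le) (auto simp: mult_ac)
  also have "\<dots> = (\<Sum>k. ennreal (D * decay_k \<sigma> ^ k / (1 - decay_j)) * ?Y)"
  proof (intro suminf_cong)
    fix k
    have "0 \<le> D * decay_k \<sigma> ^ k" using D decay_bounds by simp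
    from geometric_ennreal_suminf[OF decay_bounds(3,4) this]
    show "(\<Sum>j. ennreal (D * decay_k \<sigma> ^ k * decay_j ^ j) * ?Y) = ennreal (D * decay_k \<sigma> ^ k / (1 - decay_j)) * ?Y"
      by (simp only: ennreal_suminf_multc)
  qed
  also have "\<dots> = (\<Sum>k. ennreal (D / (1 - decay_j) * decay_k \<sigma> ^ k) * ?Y)"
    by simp
  also have "\<dots> = ennreal (D / (1 - decay_j) / (1 - decay_k \<sigma>)) * ?Y"
    using D decay_bounds by (simp only: ennreal_suminf_multc) (subst geometric_ennreal_suminf, auto)
  finally show ?thesis by (simp add: atom_const_def D_def)
qed

text \<open>Every atom receives its own version \<open>Ha l\<close>.
  \<open>K_disjoint_sum_le\<close> yields \<open>|H| \<le> \<Sum>l. |Ha l|\<close> almost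
  everywhere, so the majorants add up and convergence of the atomic sum in the tent norm never
  enters.\<close>

lemma tent1_majorant_le:
  fixes F :: "('n, 'm) tfun"
  assumes F: "L2_slices F" and H: "version F H" and fin: "tent1 (\<lambda>z. enorm (F z)) < top"
  shows "tent1 (majorant w H) \<le> ennreal (atom_const \<sigma> \<delta> * (4 * dyadic_const CARD('n))) * tent1 (\<lambda>z. enorm (F z))"
proof -
  let ?n = "CARD('n)"
  note [measurable] = versionD(1)[OF H]
  have Fm[measurable]: "F \<in> borel_measurable borel" using F by (simp add: L2_slices_def)
  have Gm: "(\<lambda>z. enorm (F z)) \<in> borel_measurable borel" by measurable
  obtain A x0 r where A[measurable]: "\<And>l. A l \<in> sets borel" and disj: "disjoint_family A" and r: "\<And>l. 0 < r l"
    and sub: "\<And>l z. z \<in> A l \<Longrightarrow> 0 < fst z \<and> fst z < r l \<and> dist (snd z) (x0 l) < r l"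
    and cover: "AE z in lborel. 0 < fst z \<longrightarrow> enorm (F z) \<noteq> 0 \<longrightarrow> (\<exists>l. z \<in> A l)"
    and sum: "(\<Sum>l. esqrt (ennreal (r l ^ ?n) * energy (\<lambda>z. indicator (A l) z * enorm (F z)))) \<le>
      ennreal (4 * dyadic_const ?n) * tent1 (\<lambda>z. enorm (F z))"
    by (rule atomic_decomposition[OF Gm fin]) blast
  define a where "a l z = indicator (A l) z *\<^sub>R F z" for l z
  have [measurable]: "a l \<in> borel_measurable borel" for l
    unfolding a_def by measurable
  have sect[measurable]: "{y. (s, y) \<in> A l} \<in> sets borel" for s l
    by measurable
  have a_sect: "(\<lambda>y. a l (s, y)) = (\<lambda>y. indicator {y. (s, y) \<in> A l} y *\<^sub>R F (s, y))" for l s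
    by (auto simp: a_def indicator_def)
  have a: "L2_slices (a l)" for l
    unfolding L2_slices_def
  proof
    show "AE s in lborel. 0 < s \<longrightarrow> (\<lambda>y. a l (s, y)) \<in> Lp 2"
      using F[unfolded L2_slices_def, THEN conjunct2]
      by eventually_elim (auto simp: a_sect intro!: Lp_2_indicator)
  qed measurable
  define Ha where "Ha l = (SOME J. version (a l) J)" for l
  have Ha: "version (a l) (Ha l)" for l
    unfolding Ha_def by (rule someI_ex[where P = "version (a l)"]) (rule version_exists[OF a])
  note [measurable] = versionD(1)[OF Ha]
  have "AE s in lborel. AE y in lborel. 0 < s \<longrightarrow> F (s, y) \<noteq> 0 \<longrightarrow> (\<exists>l. (s, y) \<in> A l)"
    using AE_lborel_pair[OF cover] by simp
  then have cov: "AE ts in (lborel :: (real \<times> real) measure). AE y in lborel. 0 < snd ts \<longrightarrow> F (snd ts, y) \<noteq> 0 \<longrightarrow> (\<exists>l. (snd ts, y) \<in> A l)"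
    by (rule AE_lborel_snd)
  have Hall: "AE ts in lborel. \<forall>l. 0 < fst ts \<and> 0 < snd ts \<longrightarrow>
      (AE x in lborel. Ha l (fst ts, snd ts, x) = K (fst ts) (snd ts) (\<lambda>y. a l (snd ts, y)) x)"
    unfolding AE_all_countable using versionD(2)[OF Ha] by blast
  have "AE ts in lborel. AE x in lborel. (\<lambda>q. 0 < fst q \<and> 0 < fst (snd q) \<longrightarrow> enorm (H q) \<le> (\<Sum>l. enorm (Ha l q))) (fst ts, snd ts, x)"
    using L2_slicesD[OF F] versionD(2)[OF H] Hall cov
  proof eventually_elim
    case (elim ts)
    show ?case
    proof (cases "0 < fst ts \<and> 0 < snd ts")
      case True
      define t s where "t = fst ts" and "s = snd ts"
      have ts: "0 < t" "0 < s" using True by (auto simp: t_def s_def)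
      have u: "(\<lambda>y. F (s, y)) \<in> Lp 2" using elim(1) ts by (simp add: s_def)
      have HF: "AE x in lborel. H (t, s, x) = K t s (\<lambda>y. F (s, y)) x"
        using elim(2) True by (simp add: t_def s_def)
      have "\<forall>l. AE x in lborel. Ha l (t, s, x) = K t s (\<lambda>y. a l (s, y)) x"
        using elim(3) True by (simp add: t_def s_def)
      then have HA: "AE x in lborel. \<forall>l. Ha l (t, s, x) = K t s (\<lambda>y. a l (s, y)) x"
        by (simp add: AE_all_countable)
      have "AE x in lborel. enorm (K t s (\<lambda>y. F (s, y)) x) \<le>
         (\<Sum>l. enorm (K t s (\<lambda>y. indicator {y. (s, y) \<in> A l} y *\<^sub>R F (s, y)) x))"
      proof (rule K_disjoint_sum_le[OF ts u sect])
        show "disjoint_family (\<lambda>l. {y. (s, y) \<in> A l})"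
          using disj by (auto simp: disjoint_family_on_def)
        show "AE y in lborel. F (s, y) \<noteq> 0 \<longrightarrow> (\<exists>l. y \<in> {y. (s, y) \<in> A l})"
          using elim(4) by eventually_elim (use ts in \<open>simp add: s_def\<close>)
      qed
      with HF HA have "AE x in lborel. enorm (H (t, s, x)) \<le> (\<Sum>l. enorm (Ha l (t, s, x)))"
        by eventually_elim (simp add: a_sect)
      then show ?thesis by (simp add: t_def s_def)
    qed auto
  qed
  then have "AE z in lborel. AE s in lborel. (\<lambda>q. 0 < fst q \<and> 0 < fst (snd q) \<longrightarrow> enorm (H q) \<le> (\<Sum>l. enorm (Ha l q))) (fst z, s, snd z)"
    by (intro AE_lborel_triple) measurable
  then have maj: "AE z in lborel. 0 < fst z \<longrightarrow> majorant w H z \<le> (\<Sum>l. majorant w (Ha l) z)"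
  proof eventually_elim
    case (elim z)
    show ?case
    proof
      assume z: "0 < fst z"
      have "majorant w H z \<le> (\<integral>\<^sup>+ s. (\<Sum>l. ennreal (w (fst z) s) * enorm (Ha l (fst z, s, snd z)) * inv_weight s) \<partial>lborel)"
        unfolding majorant_def
      proof (rule nn_integral_mono_AE)
        show "AE s in lborel. ennreal (w (fst z) s) * enorm (H (fst z, s, snd z)) * inv_weight s \<le>
          (\<Sum>l. ennreal (w (fst z) s) * enorm (Ha l (fst z, s, snd z)) * inv_weight s)"
          using elim
        proof eventually_elim
          case (elim s)
          show ?case
          proof (cases "0 < s")
            case True
            have "enorm (H (fst z, s, snd z)) \<le> (\<Sum>l. enorm (Ha l (fst z, s, snd z)))"
              by (rule elim[simplified, rule_format]) (use z True in simp)
            then have "ennreal (w (fst z) s) * enorm (H (fst z, s, snd z)) * inv_weight s \<le>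
              ennreal (w (fst z) s) * (\<Sum>l. enorm (Ha l (fst z, s, snd z))) * inv_weight s"
              by (intro mult_right_mono mult_left_mono) simp_all
            then show ?thesis by (simp only: ennreal_suminf_cmult ennreal_suminf_multc)
          qed (simp add: inv_weight_def)
        qed
      qed
      also have "\<dots> = (\<Sum>l. majorant w (Ha l) z)"
        unfolding majorant_def by (rule nn_integral_suminf) measurable
      finally show "majorant w H z \<le> (\<Sum>l. majorant w (Ha l) z)" .
    qed
  qed
  have "tent1 (majorant w H) \<le> tent1 (\<lambda>z. \<Sum>l. majorant w (Ha l) z)"
    by (rule tent1_mono_AE[OF maj])
  also have "\<dots> \<le> (\<Sum>l. tent1 (majorant w (Ha l)))"
    by (rule tent1_suminf_le) measurable
  also have "\<dots> \<le> (\<Sum>l. ennreal (atom_const \<sigma> \<delta>) * esqrt (ennreal (r l ^ ?n) * energy (\<lambda>z. enorm (a l z))))"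
  proof (intro suminf_le)
    fix l
    show "tent1 (majorant w (Ha l)) \<le> ennreal (atom_const \<sigma> \<delta>) * esqrt (ennreal (r l ^ ?n) * energy (\<lambda>z. enorm (a l z)))"
    proof (rule atom_estimate[OF a Ha r])
      fix z assume "a l z \<noteq> 0"
      then show "fst z < r l \<and> dist (snd z) (x0 l) < r l"
        using sub[of z l] by (auto simp: a_def indicator_def split: if_splits)
    qed
  qed auto
  also have "\<dots> = ennreal (atom_const \<sigma> \<delta>) * (\<Sum>l. esqrt (ennreal (r l ^ ?n) * energy (\<lambda>z. enorm (a l z))))"
    by simp
  also have "\<dots> = ennreal (atom_const \<sigma> \<delta>) * (\<Sum>l. esqrt (ennreal (r l ^ ?n) * energy (\<lambda>z. indicator (A l) z * enorm (F z))))"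
  proof -
    have "(\<lambda>z. enorm (a l z)) = (\<lambda>z. indicator (A l) z * enorm (F z))" for l
      by (auto simp: a_def fun_eq_iff indicator_def)
    then show ?thesis by (simp only:)
  qed
  also have "ennreal (atom_const \<sigma> \<delta>) * (\<Sum>l. esqrt (ennreal (r l ^ ?n) * energy (\<lambda>z. indicator (A l) z * enorm (F z)))) \<le>
    ennreal (atom_const \<sigma> \<delta>) * (ennreal (4 * dyadic_const ?n) * tent1 (\<lambda>z. enorm (F z)))"
    using sum by (rule mult_left_mono) simp
  also have "\<dots> = ennreal (atom_const \<sigma> \<delta> * (4 * dyadic_const ?n)) * tent1 (\<lambda>z. enorm (F z))"
    using dyadic_const_pos[of ?n] by (simp add: ennreal_mult'' mult.assoc)
  finally show ?thesis .
qed

end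

section \<open>Density of test functions\<close>

text \<open>Carrying a polynomial factor makes the class closed under differentiation, so a single
  derivative formula yields smoothness of every order.\<close>

definition expq :: "real poly \<Rightarrow> real \<Rightarrow> real" where
  "expq P x = (if 0 < x then poly P (1 / x) * exp (- (1 / x)) else 0)"

text \<open>With \<open>y = 1 / x\<close> one has \<open>dy/dx = - y^2\<close>, and
  \<open>P(y) exp(-y)\<close> differentiates in \<open>x\<close> to
  \<open>y^2 (P - P')(y) exp(-y)\<close>.\<close>

definition expq_deriv :: "real poly \<Rightarrow> real poly" where
  "expq_deriv P = [:0, 0, 1:] * (P - pderiv P)"

lemma poly_exp_tendsto_0: "((\<lambda>y. poly P y * exp (- y)) \<longlongrightarrow> 0) at_top" for P :: "real poly"
proof -
  have "((\<lambda>y. \<Sum>i\<le>degree P. coeff P i * (y ^ i / exp y)) \<longlongrightarrow> (\<Sum>i\<le>degree P. coeff P i * 0)) at_top"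
    by (intro tendsto_intros tendsto_power_div_exp_0)
  then show ?thesis
    by (simp add: poly_altdef exp_minus sum_distrib_right divide_inverse mult.assoc)
qed

lemma DERIV_expq: "DERIV (expq P) x :> expq (expq_deriv P) x"
proof -
  consider "0 < x" | "x < 0" | "x = 0" by linarith
  then show ?thesis
  proof cases
    case 1
    have "((\<lambda>x. poly P (1 / x) * exp (- (1 / x))) has_field_derivative expq (expq_deriv P) x) (at x)"
      using 1 by (auto intro!: derivative_eq_intros DERIV_chain2[OF poly_DERIV]
          simp: expq_def expq_deriv_def field_simps power2_eq_square)
    then show ?thesis
      by (rule has_field_derivative_transform_within_open[of _ _ _ "{0<..}"])
        (use 1 in \<open>auto simp: expq_def\<close>)
  next
    case 2
    have "((\<lambda>x. 0) has_field_derivative expq (expq_deriv P) x) (at x)"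
      using 2 by (simp add: expq_def)
    then show ?thesis
      by (rule has_field_derivative_transform_within_open[of _ _ _ "{..<0}"])
        (use 2 in \<open>auto simp: expq_def\<close>)
  next
    case 3
    have "((\<lambda>h. expq P h / h) \<longlongrightarrow> 0) (at_left 0)"
      by (rule tendsto_eventually) (auto simp: expq_def eventually_at_filter)
    moreover have "((\<lambda>h. expq P h / h) \<longlongrightarrow> 0) (at_right 0)"
    proof -
      \<comment> \<open>Dividing by \<open>h\<close> multiplies the polynomial in
        \<open>1 / h\<close> by its variable, hence \<open>pCons 0 P\<close>.\<close>
      have "((\<lambda>h. poly (pCons 0 P) (inverse h) * exp (- inverse h)) \<longlongrightarrow> 0) (at_right 0)"
        by (rule filterlim_compose[OF poly_exp_tendsto_0 filterlim_inverse_at_top_right])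
      then show ?thesis
        by (rule Lim_transform_eventually)
          (auto simp: expq_def eventually_at_filter divide_inverse)
    qed
    ultimately have "((\<lambda>h. expq P h / h) \<longlongrightarrow> 0) (at 0)"
      by (rule filterlim_split_at)
    then show ?thesis
      using 3 by (simp add: DERIV_def) (simp add: expq_def)
  qed
qed

section \<open>Calculus of the classes C^k\<close>

lemma Ck_Suc_imp: "Ck (Suc k) f \<Longrightarrow> Ck k f"
proof (induction k arbitrary: f)
  case 0
  then show ?case
    by (auto intro!: continuous_at_imp_continuous_on differentiable_imp_continuous_within)
next
  case (Suc k)
  then have "\<And>v. Ck k (\<lambda>x. frechet_derivative f (at x) v)"
    by (metis Ck.simps(2))
  then show ?case using Suc.prems by (metis Ck.simps(2))
qed

text \<open>Lets an induction supply an explicit derivative in place of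
  \<open>frechet_derivative\<close>.\<close>

lemma Ck_SucI:
  assumes "\<And>x. (f has_derivative f' x) (at x)" "\<And>v. Ck k (\<lambda>x. f' x v)"
  shows "Ck (Suc k) f"
proof -
  have "frechet_derivative f (at x) = f' x" for x
    using frechet_derivative_at[OF assms(1)] by simp
  then show ?thesis using assms by (auto simp: differentiable_def)
qed

lemma Ck_SucE:
  assumes "Ck (Suc k) f"
  obtains f' where "\<And>x. (f has_derivative f' x) (at x)" "\<And>v. Ck k (\<lambda>x. f' x v)"
  using assms by (intro that[of "\<lambda>x. frechet_derivative f (at x)"]) (auto simp: frechet_derivative_works[symmetric])

lemma Ck_const: "Ck k (\<lambda>x. c)"
proof (induction k arbitrary: c)
  case (Suc k)
  then show ?case by (intro Ck_SucI[of _ "\<lambda>x v. 0"]) auto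
qed simp

lemma Ck_add: "Ck k f \<Longrightarrow> Ck k g \<Longrightarrow> Ck k (\<lambda>x. f x + g x)"
proof (induction k arbitrary: f g)
  case (Suc k)
  obtain f' where f': "\<And>x. (f has_derivative f' x) (at x)" "\<And>v. Ck k (\<lambda>x. f' x v)"
    using Suc.prems(1) by (rule Ck_SucE) blast
  obtain g' where g': "\<And>x. (g has_derivative g' x) (at x)" "\<And>v. Ck k (\<lambda>x. g' x v)"
    using Suc.prems(2) by (rule Ck_SucE) blast
  show ?case
    by (rule Ck_SucI[of _ "\<lambda>x v. f' x v + g' x v"])
      (auto intro!: f' g' has_derivative_add Suc.IH)
qed (simp add: continuous_on_add)

text \<open>The product rule gives a sum of products of functions of class C^k, the original factors
  being lowered by \<open>Ck_Suc_imp\<close>; then the induction hypothesis applies.\<close>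

lemma Ck_scaleR: "Ck k f \<Longrightarrow> Ck k g \<Longrightarrow> Ck k (\<lambda>x. f x *\<^sub>R g x)"
proof (induction k arbitrary: f g)
  case (Suc k)
  obtain f' where f': "\<And>x. (f has_derivative f' x) (at x)" "\<And>v. Ck k (\<lambda>x. f' x v)"
    using Suc.prems(1) by (rule Ck_SucE) blast
  obtain g' where g': "\<And>x. (g has_derivative g' x) (at x)" "\<And>v. Ck k (\<lambda>x. g' x v)"
    using Suc.prems(2) by (rule Ck_SucE) blast
  show ?case
  proof (rule Ck_SucI[of _ "\<lambda>x v. f x *\<^sub>R g' x v + f' x v *\<^sub>R g x"])
    show "((\<lambda>x. f x *\<^sub>R g x) has_derivative (\<lambda>v. f x *\<^sub>R g' x v + f' x v *\<^sub>R g x)) (at x)" for x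
      by (rule has_derivative_scaleR) (rule f' g')+
    show "Ck k (\<lambda>x. f x *\<^sub>R g' x v + f' x v *\<^sub>R g x)" for v
      using f'(2)[of v] g'(2)[of v] Ck_Suc_imp[OF Suc.prems(1)] Ck_Suc_imp[OF Suc.prems(2)]
      by (intro Ck_add Suc.IH)
  qed
qed (simp add: continuous_on_scaleR)

lemma Ck_prod: "finite I \<Longrightarrow> (\<And>i. i \<in> I \<Longrightarrow> Ck k (f i)) \<Longrightarrow> Ck k (\<lambda>x. \<Prod>i\<in>I. f i x :: real)"
proof (induction I rule: finite_induct)
  case (insert i I)
  then show ?case using Ck_scaleR[of k "f i" "\<lambda>x. \<Prod>i\<in>I. f i x"] by simp
qed (simp add: Ck_const)

lemma Ck_expq: "Ck k (\<lambda>z. expq P (c * (z \<bullet> b) + d))"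
proof (induction k arbitrary: P)
  case 0
  have "continuous_on UNIV (expq P)"
    by (rule DERIV_continuous_on[OF DERIV_subset[OF DERIV_expq]]) simp
  then show ?case
    by (auto intro!: continuous_on_compose2[of UNIV "expq P"] continuous_intros)
next
  case (Suc k)
  show ?case
  proof (rule Ck_SucI[of _ "\<lambda>z v. expq (expq_deriv P) (c * (z \<bullet> b) + d) *\<^sub>R (c * (v \<bullet> b))"])
    show "Ck k (\<lambda>z. expq (expq_deriv P) (c * (z \<bullet> b) + d) *\<^sub>R (c * (v \<bullet> b)))" for v
      by (intro Ck_scaleR Ck_const Suc)
    show "((\<lambda>z. expq P (c * (z \<bullet> b) + d)) has_derivative (\<lambda>v. expq (expq_deriv P) (c * (z \<bullet> b) + d) *\<^sub>R (c * (v \<bullet> b)))) (at z)" for z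
    proof -
      have "((\<lambda>z. c * (z \<bullet> b) + d) has_derivative (\<lambda>v. c * (v \<bullet> b))) (at z)"
        by (auto intro!: derivative_eq_intros)
      from has_derivative_compose[OF this DERIV_expq[of P, unfolded has_field_derivative_def]]
      show ?thesis by simp
    qed
  qed
qed

text \<open>As \<open>m\<close> grows, \<open>exp (- 1 / (m x))\<close> tends to \<open>1\<close> for \<open>x > 0\<close>, so no normalisation is needed for the
  bumps to converge to the indicator of the box.\<close>

definition bump :: "nat \<Rightarrow> 'a::euclidean_space \<Rightarrow> 'a \<Rightarrow> 'a \<Rightarrow> real" where
  "bump m c d z = (\<Prod>e\<in>Basis. expq 1 (real m * (z \<bullet> e) + - real m * (c \<bullet> e)) *
     expq 1 (- real m * (z \<bullet> e) + real m * (d \<bullet> e)))"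

lemma expq_1_bounds: "0 \<le> expq 1 x" "expq 1 x \<le> 1"
  by (auto simp: expq_def)

lemma Ck_bump: "Ck k (bump m c d)"
proof -
  have "Ck k (\<lambda>z. expq 1 (real m * (z \<bullet> e) + - real m * (c \<bullet> e)) *\<^sub>R
     expq 1 (- real m * (z \<bullet> e) + real m * (d \<bullet> e)))" for e
    by (intro Ck_scaleR Ck_expq)
  then show ?thesis
    unfolding bump_def[abs_def] by (intro Ck_prod) auto
qed

lemma bump_bounds: "0 \<le> bump m c d z" "bump m c d z \<le> 1"
  unfolding bump_def
  by (auto intro!: prod_nonneg prod_le_1 mult_nonneg_nonneg mult_le_one expq_1_bounds)

lemma bump_eq_0: "z \<notin> box c d \<Longrightarrow> bump m c d z = 0"
proof -
  assume "z \<notin> box c d"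
  then obtain e where e: "e \<in> Basis" "z \<bullet> e \<le> c \<bullet> e \<or> d \<bullet> e \<le> z \<bullet> e"
    by (auto simp: mem_box not_less)
  then have "real m * (z \<bullet> e) \<le> real m * (c \<bullet> e) \<or> real m * (d \<bullet> e) \<le> real m * (z \<bullet> e)"
    by (auto intro: mult_left_mono)
  with e(1) show ?thesis
    unfolding bump_def by (intro prod_zero) (auto simp: expq_def intro!: bexI[of _ e])
qed

lemma bump_tendsto: "(\<lambda>m. bump m c d z) \<longlonglongrightarrow> indicator (box c d) z"
proof (cases "z \<in> box c d")
  case True
  have lim: "(\<lambda>m. expq 1 (real m * x)) \<longlonglongrightarrow> 1" if "0 < x" for x
  proof -
    have "(\<lambda>m. exp (- (1 / (real m * x)))) \<longlonglongrightarrow> exp (- 0)"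
      using that by real_asymp
    moreover have "eventually (\<lambda>m. exp (- (1 / (real m * x))) = expq 1 (real m * x)) sequentially"
      using that by (intro eventually_sequentiallyI[of 1]) (auto simp: expq_def)
    ultimately have "(\<lambda>m. expq 1 (real m * x)) \<longlonglongrightarrow> exp (- 0)"
      by (rule Lim_transform_eventually)
    then show ?thesis by simp
  qed
  have "(\<lambda>m. \<Prod>e\<in>Basis. expq 1 (real m * (z \<bullet> e - c \<bullet> e)) * expq 1 (real m * (d \<bullet> e - z \<bullet> e)))
     \<longlonglongrightarrow> (\<Prod>e\<in>(Basis :: 'a set). 1 * 1)"
    using True by (intro tendsto_prod tendsto_mult lim) (auto simp: mem_box)
  then show ?thesis
    using True by (simp add: bump_def algebra_simps)
qed (simp add: bump_eq_0)

section \<open>Test functions and approximation in the tent norm\<close>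

lemma test_functions_add:
  assumes "\<phi> \<in> test_functions" "\<psi> \<in> test_functions"
  shows "(\<lambda>z. \<phi> z + \<psi> z) \<in> test_functions"
proof -
  let ?S = "closure {z. \<phi> z \<noteq> 0} \<union> closure {z. \<psi> z \<noteq> 0}"
  have S: "compact ?S" "?S \<subseteq> upper_half"
    using assms by (auto simp: test_functions_def)
  have "{z. \<phi> z + \<psi> z \<noteq> 0} \<subseteq> {z. \<phi> z \<noteq> 0} \<union> {z. \<psi> z \<noteq> 0}" by auto
  then have sub: "closure {z. \<phi> z + \<psi> z \<noteq> 0} \<subseteq> ?S"
    unfolding closure_Un[symmetric] by (rule closure_mono)
  have "bounded (closure {z. \<phi> z + \<psi> z \<noteq> 0})"
    using compact_imp_bounded[OF S(1)] sub by (rule bounded_subset)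
  then have "compact (closure {z. \<phi> z + \<psi> z \<noteq> 0})"
    by (simp add: compact_eq_bounded_closed)
  then show ?thesis
    using sub S(2) assms by (auto simp: test_functions_def Ck_add)
qed

lemma test_functions_borel: "\<phi> \<in> test_functions \<Longrightarrow> \<phi> \<in> borel_measurable borel"
  by (auto simp: test_functions_def intro!: borel_measurable_continuous_onI dest: spec[of _ 0])

lemma bump_test_function:
  assumes "box c d \<subseteq> box a b" "0 < fst a"
  shows "(\<lambda>z. bump m c d z *\<^sub>R w) \<in> test_functions"
proof -
  have "{z. bump m c d z *\<^sub>R w \<noteq> 0} \<subseteq> cbox a b"
    using bump_eq_0[of _ c d m] assms(1) box_subset_cbox[of a b] by fastforce
  then have sub: "closure {z. bump m c d z *\<^sub>R w \<noteq> 0} \<subseteq> cbox a b"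
    by (rule closure_minimal) (rule closed_cbox)
  moreover have "cbox a b \<subseteq> upper_half"
  proof
    fix z assume "z \<in> cbox a b"
    then have "(fst z, snd z) \<in> cbox (fst a, snd a) (fst b, snd b)" by simp
    then have "fst a \<le> fst z" unfolding cbox_Pair_iff by simp
    with assms(2) show "z \<in> upper_half" by (simp add: upper_half_def mem_Times_iff)
  qed
  moreover have "bounded (closure {z. bump m c d z *\<^sub>R w \<noteq> 0})"
    using bounded_cbox sub by (rule bounded_subset)
  then have "compact (closure {z. bump m c d z *\<^sub>R w \<noteq> 0})"
    by (simp add: compact_eq_bounded_closed)
  ultimately show ?thesis
    by (auto simp: test_functions_def intro!: Ck_scaleR Ck_bump Ck_const)
qed

text \<open>Heights in the box stay above \<open>fst a > 0\<close>, so the weight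
  \<open>1 / t\<close> is bounded there and the energy is finite.\<close>

lemma tent1_box_finite:
  fixes a b :: "real \<times> (real ^ 'n::finite)"
  assumes a: "0 < fst a"
  shows "tent1 (\<lambda>z. ennreal (B * indicator (box a b) z)) < top"
proof -
  let ?G = "\<lambda>z. ennreal (B * indicator (box a b) z)"
  have [measurable]: "box a b \<in> sets borel" by simp
  obtain R where R: "0 < R" "\<And>z. z \<in> box a b \<Longrightarrow> norm z < R"
    using bounded_box[of a b] by (auto simp: bounded_pos_less)
  have "tent1 ?G \<le> esqrt (emeasure lborel (ball (0 :: real ^ 'n) (R + R))) *
    esqrt (ennreal (unit_ball_vol CARD('n)) * energy ?G)"
  proof (rule tent1_local_le)
    fix z assume "?G z \<noteq> 0"
    then have "z \<in> box a b" by (cases "z \<in> box a b") auto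
    then have "norm z < R" by (rule R(2))
    then show "fst z < R \<and> dist (snd z) 0 < R"
      using norm_fst_le[of "fst z" "snd z"] norm_snd_le[of "snd z" "fst z"] by auto
  qed measurable
  also have "energy ?G \<le> (\<integral>\<^sup>+ z. (ennreal (B * indicator (box a b) z))\<^sup>2 * ennreal (1 / fst a) \<partial>lborel)"
    unfolding energy_def
  proof (intro nn_integral_mono)
    fix z
    show "(?G z)\<^sup>2 * inv_weight (fst z) \<le> (?G z)\<^sup>2 * ennreal (1 / fst a)"
    proof (cases "z \<in> box a b")
      case True
      then have "(fst z, snd z) \<in> box a b" by simp
      then have "fst a < fst z" unfolding mem_box_prod_iff by simp
      then show ?thesis using a
        by (intro mult_left_mono) (auto simp: inv_weight_def intro!: ennreal_leI divide_left_mono)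
    qed simp
  qed
  also have "\<dots> = (\<integral>\<^sup>+ z. (ennreal (B * indicator (box a b) z))\<^sup>2 \<partial>lborel) * ennreal (1 / fst a)"
    by (rule nn_integral_multc) measurable
  finally show ?thesis
    using indicator_box_finite[of B a b] emeasure_lborel_ball_finite[of "0 :: real ^ 'n" "R + R"]
    by (auto simp: ennreal_mult_less_top mult_left_mono intro: order_le_less_trans)
qed

definition approximable :: "('n::finite, 'm::finite) tfun \<Rightarrow> bool" where
  "approximable f \<longleftrightarrow> (\<forall>e>0. \<exists>\<phi>\<in>test_functions. tent1 (\<lambda>z. enorm (f z - \<phi> z)) < ennreal e)"

lemma tent1_triangle:
  fixes f g h :: "('n::finite, 'm::finite) tfun"
  assumes [measurable]: "g \<in> borel_measurable borel" "h \<in> borel_measurable borel"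
    and "\<And>z. 0 < fst z \<Longrightarrow> f z = g z + h z"
  shows "tent1 (\<lambda>z. enorm (f z)) \<le> tent1 (\<lambda>z. enorm (g z)) + tent1 (\<lambda>z. enorm (h z))"
proof -
  have "tent1 (\<lambda>z. enorm (f z)) \<le> tent1 (\<lambda>z. enorm (g z) + enorm (h z))"
    using assms(3)
    by (intro tent1_mono_AE AE_I2) (simp add: norm_triangle_ineq ennreal_leI flip: ennreal_plus)
  also have "\<dots> \<le> tent1 (\<lambda>z. enorm (g z)) + tent1 (\<lambda>z. enorm (h z))"
    by (rule tent1_add_le) measurable
  finally show ?thesis .
qed

lemma ennreal_half_add: "x < ennreal (e / 2) \<Longrightarrow> y < ennreal (e / 2) \<Longrightarrow> x + y < ennreal e"
proof -
  assume "x < ennreal (e / 2)" "y < ennreal (e / 2)"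
  then have "x + y < ennreal (e / 2) + ennreal (e / 2)" by (rule add_strict_mono)
  also have "0 < e"
    using \<open>x < ennreal (e / 2)\<close> by (metis ennreal_eq_0_iff half_gt_zero_iff not_less not_less_zero)
  then have "ennreal (e / 2) + ennreal (e / 2) = ennreal e" by (simp flip: ennreal_plus)
  finally show ?thesis .
qed

lemma approximable_limit:
  assumes f: "\<And>i. approximable (f i)" and [measurable]: "\<And>i. f i \<in> borel_measurable borel" "g \<in> borel_measurable borel"
    and lim: "(\<lambda>i. tent1 (\<lambda>z. enorm (g z - f i z))) \<longlonglongrightarrow> 0"
  shows "approximable g"
  unfolding approximable_def
proof (intro allI impI)
  fix e :: real assume e: "0 < e"
  have "eventually (\<lambda>i. tent1 (\<lambda>z. enorm (g z - f i z)) < ennreal (e / 2)) sequentially"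
    using lim by (rule order_tendstoD) (use e in simp)
  then obtain i where i: "tent1 (\<lambda>z. enorm (g z - f i z)) < ennreal (e / 2)"
    by (auto simp: eventually_sequentially)
  obtain \<phi> where \<phi>: "\<phi> \<in> test_functions" "tent1 (\<lambda>z. enorm (f i z - \<phi> z)) < ennreal (e / 2)"
    using f[of i] e unfolding approximable_def by (meson half_gt_zero)
  note [measurable] = test_functions_borel[OF \<phi>(1)]
  have "tent1 (\<lambda>z. enorm (g z - \<phi> z)) \<le> tent1 (\<lambda>z. enorm (g z - f i z)) + tent1 (\<lambda>z. enorm (f i z - \<phi> z))"
    by (rule tent1_triangle) simp_all
  also have "\<dots> < ennreal e" by (rule ennreal_half_add[OF i \<phi>(2)])
  finally show "\<exists>\<phi>\<in>test_functions. tent1 (\<lambda>z. enorm (g z - \<phi> z)) < ennreal e"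
    using \<phi>(1) by blast
qed

text \<open>Bumps are bounded by 1, vanish off their box and converge to its indicator, which
  settles boxes by dominated convergence. The dominating function has finite tent norm because the
  outer box stays away from height 0.\<close>

lemma approximable_bounded_box:
  fixes f :: "('n::finite, 'm::finite) tfun"
  assumes f: "f \<in> borel_measurable borel" and bd: "\<And>z. norm (f z) \<le> B * indicator (box a b) z"
    and a: "0 < fst a"
  shows "approximable f"
  using f bd
proof (induction rule: bounded_box_supported_induct)
  case (box c d w)
  have "approximable (\<lambda>z. bump m c d z *\<^sub>R w)" for m
    unfolding approximable_def using bump_test_function[OF box a, of m w]
    by (auto intro!: bexI[of _ "\<lambda>z. bump m c d z *\<^sub>R w"])
  then show ?case
  proof (rule approximable_limit)
    have [measurable]: "box a b \<in> sets borel" "box c d \<in> sets borel" by simp_all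
    show m[measurable]: "(\<lambda>z. bump m c d z *\<^sub>R w) \<in> borel_measurable borel" for m
      by (rule test_functions_borel[OF bump_test_function[OF box a]])
    show "(\<lambda>z. indicator (box c d) z *\<^sub>R w) \<in> borel_measurable borel" by measurable
    show "(\<lambda>i. tent1 (\<lambda>z. enorm (indicator (box c d) z *\<^sub>R w - bump i c d z *\<^sub>R w))) \<longlonglongrightarrow> 0"
    proof (rule tent1_dominated_convergence[where H = "\<lambda>z. ennreal (norm w * indicator (box a b) z)"])
      show "tent1 (\<lambda>z. ennreal (norm w * indicator (box a b) z)) < top"
        by (rule tent1_box_finite[OF a])
      fix z
      show "enorm (indicator (box c d) z *\<^sub>R w - bump i c d z *\<^sub>R w) \<le> ennreal (norm w * indicator (box a b) z)" for i
      proof (rule ennreal_leI, cases "z \<in> box c d")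
        case True
        have "indicator (box c d) z *\<^sub>R w - bump i c d z *\<^sub>R w = (1 - bump i c d z) *\<^sub>R w"
          using True by (simp add: scaleR_left_diff_distrib)
        then have "norm (indicator (box c d) z *\<^sub>R w - bump i c d z *\<^sub>R w) = \<bar>1 - bump i c d z\<bar> * norm w"
          by simp
        also have "\<dots> \<le> 1 * norm w"
          using bump_bounds[of i c d z] by (intro mult_right_mono) auto
        finally show "norm (indicator (box c d) z *\<^sub>R w - bump i c d z *\<^sub>R w) \<le> norm w * indicator (box a b) z"
          using True box by auto
      qed (simp add: bump_eq_0)
      have "(\<lambda>i. norm (indicator (box c d) z *\<^sub>R w - bump i c d z *\<^sub>R w)) \<longlonglongrightarrow> norm (indicator (box c d) z *\<^sub>R w - indicator (box c d) z *\<^sub>R w)"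
        by (intro tendsto_intros bump_tendsto)
      then have "(\<lambda>i. enorm (indicator (box c d) z *\<^sub>R w - bump i c d z *\<^sub>R w)) \<longlonglongrightarrow> ennreal 0"
        by (intro tendsto_ennrealI) simp
      then show "(\<lambda>i. enorm (indicator (box c d) z *\<^sub>R w - bump i c d z *\<^sub>R w)) \<longlonglongrightarrow> 0"
        by simp
    qed measurable
  qed
next
  case (add f g B)
  note [measurable] = add(3,4)
  show ?case
    unfolding approximable_def
  proof (intro allI impI)
    fix e :: real assume "0 < e"
    then obtain \<phi> \<psi> where \<phi>: "\<phi> \<in> test_functions" "tent1 (\<lambda>z. enorm (f z - \<phi> z)) < ennreal (e / 2)"
      and \<psi>: "\<psi> \<in> test_functions" "tent1 (\<lambda>z. enorm (g z - \<psi> z)) < ennreal (e / 2)"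
      using add(1,2) unfolding approximable_def by (meson half_gt_zero)
    note [measurable] = test_functions_borel[OF \<phi>(1)] test_functions_borel[OF \<psi>(1)]
    have "tent1 (\<lambda>z. enorm (f z + g z - (\<phi> z + \<psi> z))) \<le> tent1 (\<lambda>z. enorm (f z - \<phi> z)) + tent1 (\<lambda>z. enorm (g z - \<psi> z))"
      by (rule tent1_triangle) simp_all
    also have "\<dots> < ennreal e" by (rule ennreal_half_add[OF \<phi>(2) \<psi>(2)])
    finally show "\<exists>\<phi>\<in>test_functions. tent1 (\<lambda>z. enorm (f z + g z - \<phi> z)) < ennreal e"
      using test_functions_add[OF \<phi>(1) \<psi>(1)] by (rule bexI)
  qed
next
  case (lim f g B)
  note [measurable] = lim(2,3)
  have gB: "norm (g z) \<le> B * indicator (box a b) z" for z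
    using tendsto_norm[OF lim(5)[of z]] by (rule LIMSEQ_le_const2) (use lim(4) in blast)
  have [measurable]: "box a b \<in> sets borel" by simp
  show ?case
  proof (rule approximable_limit[OF lim(1-3)])
    show "(\<lambda>i. tent1 (\<lambda>z. enorm (g z - f i z))) \<longlonglongrightarrow> 0"
    proof (rule tent1_dominated_convergence[where H = "\<lambda>z. ennreal (2 * B * indicator (box a b) z)"])
      show "tent1 (\<lambda>z. ennreal (2 * B * indicator (box a b) z)) < top"
        by (rule tent1_box_finite[OF a])
      fix z
      show "enorm (g z - f i z) \<le> ennreal (2 * B * indicator (box a b) z)" for i
        using norm_triangle_ineq4[of "g z" "f i z"] gB[of z] lim(4)[of i z] by (intro ennreal_leI) linarith
      have "(\<lambda>i. norm (g z - f i z)) \<longlonglongrightarrow> norm (g z - g z)"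
        by (intro tendsto_intros lim)
      then have "(\<lambda>i. enorm (g z - f i z)) \<longlonglongrightarrow> ennreal 0"
        by (intro tendsto_ennrealI) simp
      then show "(\<lambda>i. enorm (g z - f i z)) \<longlonglongrightarrow> 0" by simp
    qed measurable
  qed
qed

lemma approximable_if_finite:
  fixes F :: "('n::finite, 'm::finite) tfun"
  assumes F[measurable]: "F \<in> borel_measurable borel" and fin: "tent1 (\<lambda>z. enorm (F z)) < top"
  shows "approximable F"
proof -
  \<comment> \<open>The exhausting boxes keep a positive distance from the boundary of the
    half-space; \<open>Suc\<close> keeps the lowest height positive also at
    \<open>i = 0\<close>.\<close>
  define a b :: "nat \<Rightarrow> real \<times> (real ^ 'n)" where
    "a i = (1 / real (Suc i), - real i *\<^sub>R One)" and "b i = (real i, real i *\<^sub>R One)" for i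
  define f where "f i z = (if z \<in> box (a i) (b i) \<and> norm (F z) \<le> real i then F z else 0)" for i z
  have f[measurable]: "f i \<in> borel_measurable borel" for i
    unfolding f_def by measurable
  have "approximable (f i)" for i
    by (rule approximable_bounded_box[OF f, of i "real i" "a i" "b i"]) (auto simp: f_def a_def)
  then show ?thesis
  proof (rule approximable_limit[OF _ f F])
    show "(\<lambda>i. tent1 (\<lambda>z. enorm (F z - f i z))) \<longlonglongrightarrow> 0"
    proof (rule tent1_dominated_convergence[where H = "\<lambda>z. enorm (F z)"])
      fix z :: "real \<times> (real ^ 'n)" assume z: "0 < fst z"
      obtain i0 :: nat where i0: "norm (F z) + norm z + 1 / fst z < real i0"
        using reals_Archimedean2 by blast
      have nn: "0 \<le> norm (F z)" "0 \<le> norm z" "0 < 1 / fst z" using z by simp_all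
      have "eventually (\<lambda>i. enorm (F z - f i z) = 0) sequentially"
      proof (rule eventually_sequentiallyI[of i0])
        fix i assume i: "i0 \<le> i"
        have "1 / fst z < real (Suc i)" using i0 i nn by linarith
        then have "1 / real (Suc i) < fst z" using z by (simp add: field_simps)
        moreover have "fst z < real i"
        proof -
          have "fst z \<le> norm z" using norm_fst_le[of "fst z" "snd z"] by simp
          then show ?thesis using i0 i nn by linarith
        qed
        moreover have "snd z \<in> box (- real i *\<^sub>R One) (real i *\<^sub>R One)"
          unfolding mem_box
        proof
          fix e :: "real ^ 'n" assume e: "e \<in> Basis"
          have "\<bar>snd z \<bullet> e\<bar> < real i"
          proof -
            have "norm (snd z) \<le> norm z" using norm_snd_le[of "snd z" "fst z"] by simp
            then show ?thesis
              using Basis_le_norm[OF e, of "snd z"] i0 i nn by linarith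
          qed
          then have "- real i < snd z \<bullet> e" "snd z \<bullet> e < real i" by linarith+
          with e show "- real i *\<^sub>R One \<bullet> e < snd z \<bullet> e \<and> snd z \<bullet> e < real i *\<^sub>R One \<bullet> e"
            by simp
        qed
        ultimately have "(fst z, snd z) \<in> box (a i) (b i)"
          unfolding mem_box_prod_iff by (simp add: a_def b_def)
        moreover have "norm (F z) \<le> real i" using i0 i nn by linarith
        ultimately show "enorm (F z - f i z) = 0" by (simp add: f_def)
      qed
      then show "(\<lambda>i. enorm (F z - f i z)) \<longlonglongrightarrow> 0"
        by (rule tendsto_eventually)
    qed (use fin in \<open>auto simp: f_def\<close>)
  qed
qed

lemma tent1_test_function_finite:
  fixes \<phi> :: "('n::finite, 'm::finite) tfun"
  assumes "\<phi> \<in> test_functions"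
  shows "tent1 (\<lambda>z. enorm (\<phi> z)) < top"
proof -
  let ?S = "closure {z. \<phi> z \<noteq> 0}"
  have S: "compact ?S" "?S \<subseteq> upper_half" and cont: "continuous_on UNIV \<phi>"
    using assms by (auto simp: test_functions_def dest: spec[of _ 0])
  show ?thesis
  proof (cases "?S = {}")
    case True
    then have "{z. \<phi> z \<noteq> 0} = {}"
      using closure_subset[of "{z. \<phi> z \<noteq> 0}"] by blast
    then have "\<phi> z = 0" for z by blast
    then show ?thesis by simp
  next
    case False
    obtain z0 where z0: "z0 \<in> ?S" "\<And>z. z \<in> ?S \<Longrightarrow> fst z0 \<le> fst z"
    proof -
      have "continuous_on ?S fst" by (intro continuous_intros)
      from continuous_attains_inf[OF S(1) False this] show ?thesis using that by blast
    qed
    have pos: "0 < fst z0" using z0(1) S(2) by (auto simp: upper_half_def)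
    obtain R where R: "0 < R" "\<And>z. z \<in> ?S \<Longrightarrow> norm z < R"
      using compact_imp_bounded[OF S(1)] by (auto simp: bounded_pos_less)
    have "compact (\<phi> ` ?S)"
      using S(1) cont by (intro compact_continuous_image continuous_on_subset[OF cont]) auto
    then obtain B where B: "0 < B" "\<And>z. z \<in> ?S \<Longrightarrow> norm (\<phi> z) \<le> B"
      using compact_imp_bounded[of "\<phi> ` ?S"] unfolding bounded_pos by blast
    define a b :: "real \<times> (real ^ 'n)" where
      "a = (fst z0 / 2, - R *\<^sub>R One)" and "b = (R, R *\<^sub>R One)"
    have box: "z \<in> box a b" if z: "z \<in> ?S" for z
    proof -
      have n: "norm z < R" by (rule R(2)[OF z])
      have "snd z \<in> box (- R *\<^sub>R One) (R *\<^sub>R One)"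
        unfolding mem_box
      proof
        fix e :: "real ^ 'n" assume e: "e \<in> Basis"
        have "\<bar>snd z \<bullet> e\<bar> < R"
          using Basis_le_norm[OF e, of "snd z"] norm_snd_le[of "snd z" "fst z"] n by simp
        then have "- R < snd z \<bullet> e" "snd z \<bullet> e < R" by linarith+
        with e show "- R *\<^sub>R One \<bullet> e < snd z \<bullet> e \<and> snd z \<bullet> e < R *\<^sub>R One \<bullet> e"
          by simp
      qed
      moreover have "fst z0 / 2 < fst z" using z0(2)[OF z] pos by linarith
      moreover have "fst z < R"
        using norm_fst_le[of "fst z" "snd z"] n by (simp add: abs_le_iff)
      ultimately have "(fst z, snd z) \<in> box a b"
        unfolding mem_box_prod_iff by (simp add: a_def b_def)
      then show ?thesis by simp
    qed
    have "tent1 (\<lambda>z. enorm (\<phi> z)) \<le> tent1 (\<lambda>z. ennreal (B * indicator (box a b) z))"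
    proof (intro tent1_mono_AE AE_I2 impI ennreal_leI)
      fix z show "norm (\<phi> z) \<le> B * indicator (box a b) z"
      proof (cases "z \<in> ?S")
        case True
        then show ?thesis using B(2) box by simp
      next
        case False
        then have "\<phi> z = 0" using closure_subset[of "{z. \<phi> z \<noteq> 0}"] by auto
        then show ?thesis using B(1) by (simp add: indicator_def)
      qed
    qed
    also have "\<dots> < top"
      by (rule tent1_box_finite) (simp add: a_def pos)
    finally show ?thesis .
  qed
qed

theorem tent_space_1_iff:
  fixes F :: "('n::finite, 'm::finite) tfun"
  shows "F \<in> tent_space 1 \<longleftrightarrow> ext0 F \<in> borel_measurable borel \<and> tent1 (\<lambda>z. enorm (ext0 F z)) < top"
proof -
  have norm_diff: "tent_norm 1 (\<lambda>z. F z - \<phi> z) = tent1 (\<lambda>z. enorm (ext0 F z - \<phi> z))"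
    if "ext0 F \<in> borel_measurable borel" "\<phi> \<in> test_functions" for \<phi>
  proof -
    note [measurable] = that(1) test_functions_borel[OF that(2)]
    have eq: "ext0 (\<lambda>z. F z - \<phi> z) = (\<lambda>z. ext0 F z - indicator upper_half z *\<^sub>R \<phi> z)"
      by (simp add: fun_eq_iff ext0_def scaleR_diff_right)
    have "(\<lambda>z. F z - \<phi> z) \<in> borel_measurable half_measure"
      unfolding borel_measurable_half_measure_iff eq by measurable
    then have "tent_norm 1 (\<lambda>z. F z - \<phi> z) = tent1 (\<lambda>z. enorm (ext0 (\<lambda>z. F z - \<phi> z) z))"
      by (rule tent_norm_1)
    also have "\<dots> = tent1 (\<lambda>z. enorm (ext0 F z - \<phi> z))"
      by (intro antisym tent1_mono_AE AE_I2) (auto simp: ext0_def upper_half_def mem_Times_iff)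
    finally show ?thesis .
  qed
  show ?thesis
  proof
    assume "F \<in> tent_space 1"
    then obtain \<phi> where m[measurable]: "ext0 F \<in> borel_measurable borel" and \<phi>: "\<And>k. \<phi> k \<in> test_functions"
      and lim: "(\<lambda>k. tent_norm 1 (\<lambda>z. F z - \<phi> k z)) \<longlonglongrightarrow> 0"
      by (auto simp: tent_space_def borel_measurable_half_measure_iff)
    have "eventually (\<lambda>k. tent_norm 1 (\<lambda>z. F z - \<phi> k z) < 1) sequentially"
      using lim by (rule order_tendstoD) simp
    then obtain k where "tent_norm 1 (\<lambda>z. F z - \<phi> k z) < 1"
      by (auto simp: eventually_sequentially)
    then have k: "tent1 (\<lambda>z. enorm (ext0 F z - \<phi> k z)) < top"
      using norm_diff[OF m \<phi>, of k] by (simp add: order_less_trans[OF _ ennreal_one_less_top])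
    note [measurable] = test_functions_borel[OF \<phi>]
    have "tent1 (\<lambda>z. enorm (ext0 F z)) \<le> tent1 (\<lambda>z. enorm (ext0 F z - \<phi> k z)) + tent1 (\<lambda>z. enorm (\<phi> k z))"
      by (rule tent1_triangle) simp_all
    also have "\<dots> < top" using k tent1_test_function_finite[OF \<phi>] by (simp add: ennreal_add_eq_top less_top)
    finally show "ext0 F \<in> borel_measurable borel \<and> tent1 (\<lambda>z. enorm (ext0 F z)) < top"
      using m by simp
  next
    assume F: "ext0 F \<in> borel_measurable borel \<and> tent1 (\<lambda>z. enorm (ext0 F z)) < top"
    then have "approximable (ext0 F)" by (intro approximable_if_finite) auto
    then have "\<exists>\<phi>\<in>test_functions. tent1 (\<lambda>z. enorm (ext0 F z - \<phi> z)) < ennreal (1 / real (Suc k))" for k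
      unfolding approximable_def by simp
    then obtain \<phi> where \<phi>: "\<And>k. \<phi> k \<in> test_functions"
      "\<And>k. tent1 (\<lambda>z. enorm (ext0 F z - \<phi> k z)) < ennreal (1 / real (Suc k))"
      by metis
    have "(\<lambda>k. tent_norm 1 (\<lambda>z. F z - \<phi> k z)) \<longlonglongrightarrow> 0"
    proof (rule tendsto_sandwich[of "\<lambda>_. 0"])
      show "eventually (\<lambda>k. tent_norm 1 (\<lambda>z. F z - \<phi> k z) \<le> ennreal (1 / real (Suc k))) sequentially"
        using \<phi> F norm_diff by (auto intro!: always_eventually less_imp_le)
      have "(\<lambda>k. ennreal (1 / real (Suc k))) \<longlonglongrightarrow> ennreal 0"
        by (intro tendsto_ennrealI LIMSEQ_Suc lim_1_over_n)
      then show "(\<lambda>k. ennreal (1 / real (Suc k))) \<longlonglongrightarrow> 0" by simp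
    qed auto
    then show "F \<in> tent_space 1"
      using F \<phi> by (auto simp: tent_space_def borel_measurable_half_measure_iff)
  qed
qed

section \<open>The integral operators\<close>

lemma AE_lborel_pairI:
  assumes [measurable]: "Measurable.pred borel P"
    and "AE t in lborel. AE s in lborel. P (t, s)"
  shows "AE z in (lborel :: ('a::euclidean_space \<times> 'b::euclidean_space) measure). P z"
proof -
  have "AE z in lborel \<Otimes>\<^sub>M lborel. P z"
  proof (rule lborel_pair.AE_pair_measure[OF _ assms(2)])
    have "{z. P z} \<in> sets (borel :: ('a \<times> 'b) measure)" by measurable
    then show "{z \<in> space (lborel \<Otimes>\<^sub>M lborel). P z} \<in> sets (lborel \<Otimes>\<^sub>M lborel)"
      unfolding lborel_prod by simp
  qed
  then show ?thesis by (simp only: lborel_prod)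
qed

text \<open>Applied to the majorant, where finiteness almost everywhere is absolute convergence of
  the defining integral. It follows from the finite L^2 norms of almost all slices.\<close>

lemma AE_finite_of_tent1:
  fixes G :: "real \<times> (real ^ 'n::finite) \<Rightarrow> ennreal"
  assumes [measurable]: "G \<in> borel_measurable borel" and fin: "tent1 G < top"
  shows "AE z in lborel. 0 < fst z \<longrightarrow> G z < top"
proof (rule AE_lborel_pairI)
  show "AE t in lborel. AE y in lborel. 0 < fst (t, y) \<longrightarrow> G (t, y) < top"
    using AE_slice_finite[OF assms]
  proof eventually_elim
    case (elim t)
    show ?case
    proof (cases "0 < t")
      case True
      then have "(\<integral>\<^sup>+ y. (G (t, y))\<^sup>2 \<partial>lborel) \<noteq> \<infinity>" using elim by simp
      then have "AE y in lborel. (G (t, y))\<^sup>2 \<noteq> \<infinity>"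
        by (intro nn_integral_PInf_AE) auto
      then show ?thesis
        by eventually_elim (auto simp: power_eq_top_ennreal less_top)
    qed auto
  qed
qed measurable

lemma tent_space_1_slices:
  assumes "F \<in> tent_space 1"
  shows "L2_slices (ext0 F)"
proof -
  have m[measurable]: "ext0 F \<in> borel_measurable borel" and fin: "tent1 (\<lambda>z. enorm (ext0 F z)) < top"
    using assms by (simp_all add: tent_space_1_iff)
  have "AE s in lborel. 0 < s \<longrightarrow> (\<integral>\<^sup>+ y. (enorm (ext0 F (s, y)))\<^sup>2 \<partial>lborel) < top"
    by (rule AE_slice_finite[OF _ fin]) measurable
  then show ?thesis
    unfolding L2_slices_def using m
    by (auto simp: Lp_2_iff l2_def elim!: eventually_mono)
qed

section \<open>Linear structure of the tent space\<close>

lemma ext0_add: "ext0 (\<lambda>z. F z + G z) = (\<lambda>z. ext0 F z + ext0 G z)"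
  by (simp add: ext0_def fun_eq_iff scaleR_add_right)

lemma ext0_scale: "ext0 (\<lambda>z. c *s F z) = (\<lambda>z. c *s ext0 F z)"
  by (simp add: ext0_def fun_eq_iff vec_eq_iff)

lemma tent_space_1_add:
  fixes F G :: "('n::finite, 'm::finite) tfun"
  assumes "F \<in> tent_space 1" "G \<in> tent_space 1"
  shows "(\<lambda>z. F z + G z) \<in> tent_space (1 :: real)"
proof -
  have [measurable]: "ext0 F \<in> borel_measurable borel" "ext0 G \<in> borel_measurable borel"
    and fin: "tent1 (\<lambda>z. enorm (ext0 F z)) < top" "tent1 (\<lambda>z. enorm (ext0 G z)) < top"
    using assms by (simp_all add: tent_space_1_iff)
  have "tent1 (\<lambda>z. enorm (ext0 F z + ext0 G z)) \<le> tent1 (\<lambda>z. enorm (ext0 F z)) + tent1 (\<lambda>z. enorm (ext0 G z))"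
    by (rule tent1_triangle) simp_all
  also have "\<dots> < top" using fin by (simp add: ennreal_add_eq_top less_top)
  finally show ?thesis by (simp add: tent_space_1_iff ext0_add)
qed

lemma tent_space_1_scale:
  fixes F :: "('n::finite, 'm::finite) tfun"
  assumes "F \<in> tent_space 1"
  shows "(\<lambda>z. c *s F z) \<in> tent_space (1 :: real)"
proof -
  have [measurable]: "ext0 F \<in> borel_measurable borel"
    and fin: "tent1 (\<lambda>z. enorm (ext0 F z)) < top"
    using assms by (simp_all add: tent_space_1_iff)
  have cone: "cone_energy (\<lambda>z. ennreal (norm c) * enorm (ext0 F z)) x =
      (ennreal (norm c))\<^sup>2 * cone_energy (\<lambda>z. enorm (ext0 F z)) x" for x
    unfolding cone_energy_def power_mult_distrib mult.assoc
    by (rule nn_integral_cmult) measurable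
  have "tent1 (\<lambda>z. enorm (c *s ext0 F z)) = tent1 (\<lambda>z. ennreal (norm c) * enorm (ext0 F z))"
    by (simp add: norm_vector_scalar_mult ennreal_mult')
  also have "\<dots> = ennreal (norm c) * tent1 (\<lambda>z. enorm (ext0 F z))"
    unfolding tent1_def cone esqrt_mult esqrt_square by (rule nn_integral_cmult) measurable
  also have "\<dots> < top" using fin by (simp add: ennreal_mult_less_top)
  finally show ?thesis by (simp add: tent_space_1_iff ext0_scale)
qed

lemma integral_vector_scalar_mult:
  fixes f :: "'a \<Rightarrow> complex ^ 'm::finite"
  assumes "integrable N f"
  shows "(\<integral>x. c *s f x \<partial>N) = c *s (\<integral>x. f x \<partial>N)"
proof -
  have "bounded_linear (\<lambda>v :: complex ^ 'm::finite. c *s v)"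
    by (rule bounded_linear_intro[where K = "norm c"])
      (auto simp: vec_eq_iff algebra_simps norm_vector_scalar_mult)
  from integral_bounded_linear[OF this assms] show ?thesis .
qed

text \<open>The estimates see only the modulus of the complex factor \<open>\<kappa>\<close>; the
  operator itself carries its phase.\<close>

locale integral_kernel = weighted_tent_kernel K M p N' C "\<lambda>t s. norm (\<kappa> t s)" \<sigma> \<delta>
  for K :: "('n::finite, 'm::finite) kernel" and M p N' C and \<kappa> :: "real \<Rightarrow> real \<Rightarrow> complex" and \<sigma> \<delta> +
  assumes \<kappa>_borel: "(\<lambda>q. \<kappa> (fst q) (snd q)) \<in> borel_measurable borel"
begin

definition ver :: "('n, 'm) tfun \<Rightarrow> real \<times> real \<times> (real ^ 'n) \<Rightarrow> complex ^ 'm" where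
  "ver F = (SOME H. version (ext0 F) H)"

definition integrand :: "('n, 'm) tfun \<Rightarrow> real \<times> (real ^ 'n) \<Rightarrow> real \<Rightarrow> complex ^ 'm" where
  "integrand F z s = (1 / s) *\<^sub>R (\<kappa> (fst z) s *s ver F (fst z, s, snd z))"

text \<open>A total function, since the Bochner integral is 0 where the integrand is not integrable.
  For \<open>F\<close> in the tent space such points form a null set.\<close>

definition int_op :: "('n, 'm) tfun \<Rightarrow> ('n, 'm) tfun" where
  "int_op F z = (LINT s:{0<..}|lborel. integrand F z s)"

definition "op_const = atom_const \<sigma> \<delta> * (4 * dyadic_const CARD('n))"

lemma \<kappa>_measurable [measurable (raw)]:
  assumes [measurable]: "f \<in> borel_measurable N" "g \<in> borel_measurable N"
  shows "(\<lambda>x. \<kappa> (f x) (g x)) \<in> borel_measurable N"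
proof -
  have "(\<lambda>x. (f x, g x)) \<in> borel_measurable N" by measurable
  from measurable_compose[OF this \<kappa>_borel] show ?thesis by simp
qed

lemma version_ver: "F \<in> tent_space 1 \<Longrightarrow> version (ext0 F) (ver F)"
  unfolding ver_def
  by (rule someI_ex[where P = "version (ext0 F)"]) (rule version_exists[OF tent_space_1_slices])

lemma ver_borel [measurable]: "F \<in> tent_space 1 \<Longrightarrow> ver F \<in> borel_measurable borel"
  by (rule versionD(1)[OF version_ver])

lemma integrand_measurable: "F \<in> tent_space 1 \<Longrightarrow> integrand F z \<in> borel_measurable borel"
  unfolding integrand_def by measurable

lemma op_borel:
  assumes F[measurable]: "F \<in> tent_space 1"
  shows "int_op F \<in> borel_measurable borel"
proof -
  have "(\<lambda>q. indicator {0<..} (snd q) *\<^sub>R integrand F (fst q) (snd q)) \<in> borel_measurable borel"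
    unfolding integrand_def using F by measurable
  from measurable_lborel_prod[OF this]
  have "(\<lambda>(z, s). indicator {0<..} s *\<^sub>R integrand F z s) \<in> borel_measurable (lborel \<Otimes>\<^sub>M lborel)"
    by (simp add: case_prod_beta')
  from lborel.borel_measurable_lebesgue_integral[OF this]
  show ?thesis by (simp add: int_op_def[abs_def] set_lebesgue_integral_def)
qed

lemma nn_integral_integrand:
  assumes "F \<in> tent_space 1"
  shows "(\<integral>\<^sup>+ s. enorm (indicator {0<..} s *\<^sub>R integrand F z s) \<partial>lborel) =
    majorant (\<lambda>t s. norm (\<kappa> t s)) (ver F) z"
  unfolding majorant_def
proof (intro nn_integral_cong)
  fix s
  show "enorm (indicator {0<..} s *\<^sub>R integrand F z s) =
    ennreal (norm (\<kappa> (fst z) s)) * enorm (ver F (fst z, s, snd z)) * inv_weight s"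
  proof (cases "0 < s")
    case True
    then have "norm (indicator {0<..} s *\<^sub>R integrand F z s) =
      norm (\<kappa> (fst z) s) * norm (ver F (fst z, s, snd z)) * (1 / s)"
      by (simp add: integrand_def norm_vector_scalar_mult)
    moreover have "ennreal (a * b * c) = ennreal a * ennreal b * ennreal c" if "0 \<le> a" "0 \<le> b" for a b c
      using that by (simp add: ennreal_mult')
    moreover have "inv_weight s = ennreal (1 / s)" using True by (simp add: inv_weight_def)
    ultimately show ?thesis by (simp only: norm_ge_zero)
  qed (simp add: inv_weight_def)
qed

lemma tent1_majorant_ver:
  assumes F: "F \<in> tent_space 1"
  shows "tent1 (majorant (\<lambda>t s. norm (\<kappa> t s)) (ver F)) \<le> ennreal op_const * tent_norm 1 F"
    and "tent1 (majorant (\<lambda>t s. norm (\<kappa> t s)) (ver F)) < top"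
proof -
  have m: "ext0 F \<in> borel_measurable borel" and fin: "tent1 (\<lambda>z. enorm (ext0 F z)) < top"
    using F by (simp_all add: tent_space_1_iff)
  have tn: "tent_norm 1 F = tent1 (\<lambda>z. enorm (ext0 F z))"
    using m by (intro tent_norm_1) (simp add: borel_measurable_half_measure_iff)
  show le: "tent1 (majorant (\<lambda>t s. norm (\<kappa> t s)) (ver F)) \<le> ennreal op_const * tent_norm 1 F"
    unfolding op_const_def tn
    by (rule tent1_majorant_le[OF tent_space_1_slices[OF F] version_ver[OF F] fin])
  also have "\<dots> < top" using fin tn by (simp add: ennreal_mult_less_top)
  finally show "tent1 (majorant (\<lambda>t s. norm (\<kappa> t s)) (ver F)) < top" .
qed

lemma AE_set_integrable:
  assumes F: "F \<in> tent_space 1"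
  shows "AE z in lborel. 0 < fst z \<longrightarrow> set_integrable lborel {0<..} (integrand F z)"
proof -
  have [measurable]: "ver F \<in> borel_measurable borel" using F by (rule ver_borel)
  have "AE z in lborel. 0 < fst z \<longrightarrow> majorant (\<lambda>t s. norm (\<kappa> t s)) (ver F) z < top"
    by (rule AE_finite_of_tent1[OF _ tent1_majorant_ver(2)[OF F]]) measurable
  then show ?thesis
  proof eventually_elim
    case (elim z)
    show ?case
    proof
      assume "0 < fst z"
      with elim have "(\<integral>\<^sup>+ s. enorm (indicator {0<..} s *\<^sub>R integrand F z s) \<partial>lborel) < \<infinity>"
        by (simp only: nn_integral_integrand[OF F] infinity_ennreal_def)
      moreover have [measurable]: "integrand F z \<in> borel_measurable borel"
        by (rule integrand_measurable[OF F])
      ultimately show "set_integrable lborel {0<..} (integrand F z)"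
        unfolding set_integrable_def by (intro integrableI_bounded) measurable
    qed
  qed
qed

text \<open>Holds at every point: where the integrand is not integrable, the default value 0
  satisfies the bound.\<close>

lemma norm_op_le:
  assumes F: "F \<in> tent_space 1"
  shows "enorm (int_op F z) \<le> majorant (\<lambda>t s. norm (\<kappa> t s)) (ver F) z"
proof (cases "integrable lborel (\<lambda>s. indicator {0<..} s *\<^sub>R integrand F z s)")
  case True
  then show ?thesis
    using integral_norm_bound_ennreal[OF True] nn_integral_integrand[OF F, of z]
    by (simp add: int_op_def set_lebesgue_integral_def)
qed (simp add: int_op_def set_lebesgue_integral_def not_integrable_integral_eq)

lemma op_tent_space:
  assumes F: "F \<in> tent_space 1"
  shows "int_op F \<in> tent_space 1" "tent_norm 1 (int_op F) \<le> ennreal op_const * tent_norm 1 F"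
proof -
  have [measurable]: "int_op F \<in> borel_measurable borel" by (rule op_borel[OF F])
  have m: "ext0 (int_op F) \<in> borel_measurable borel"
    unfolding ext0_def[abs_def] by measurable
  have tn: "tent_norm 1 (int_op F) = tent1 (\<lambda>z. enorm (ext0 (int_op F) z))"
    using m by (intro tent_norm_1) (simp add: borel_measurable_half_measure_iff)
  have le: "tent1 (\<lambda>z. enorm (ext0 (int_op F) z)) \<le> tent1 (majorant (\<lambda>t s. norm (\<kappa> t s)) (ver F))"
    using norm_op_le[OF F]
    by (intro tent1_mono_AE AE_I2) (simp add: ext0_def upper_half_def mem_Times_iff)
  show "tent_norm 1 (int_op F) \<le> ennreal op_const * tent_norm 1 F"
    unfolding tn using le tent1_majorant_ver(1)[OF F] by (rule order_trans)
  show "int_op F \<in> tent_space 1"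
    unfolding tent_space_1_iff using m le tent1_majorant_ver(2)[OF F] by auto
qed

text \<open>The versions chosen for \<open>F\<close>, \<open>G\<close> and \<open>F + G\<close> are
  unrelated as functions. Here the chosen one is exchanged for any other version, such as the sum of
  the first two.\<close>

lemma AE_integrand_eq:
  assumes F: "F \<in> tent_space 1" and J: "version (ext0 F) J"
  shows "AE z in lborel. 0 < fst z \<longrightarrow>
    (AE s in lborel. 0 < s \<longrightarrow> integrand F z s = (1 / s) *\<^sub>R (\<kappa> (fst z) s *s J (fst z, s, snd z)))"
  using version_unique[OF tent_space_1_slices[OF F] version_ver[OF F] J]
proof eventually_elim
  case (elim z)
  show ?case
    using elim by (auto simp: integrand_def elim!: eventually_mono)
qed

lemma op_eq_integral:
  assumes ae: "AE s in lborel. 0 < s \<longrightarrow> integrand F z s = g s"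
    and F: "F \<in> tent_space 1" and [measurable]: "g \<in> borel_measurable borel"
  shows "int_op F z = (LINT s:{0<..}|lborel. g s)"
  unfolding int_op_def
proof (rule set_lebesgue_integral_cong_AE)
  show "AE s \<in> {0<..} in lborel. integrand F z s = g s" using ae by simp
qed (use integrand_measurable[OF F] in \<open>auto simp: set_borel_measurable_def\<close>)

lemma op_add:
  assumes F: "F \<in> tent_space 1" and G: "G \<in> tent_space 1"
  shows "AE z in half_measure. int_op (\<lambda>x. F x + G x) z = int_op F z + int_op G z"
proof -
  have FG: "(\<lambda>x. F x + G x) \<in> tent_space 1" by (rule tent_space_1_add[OF F G])
  have "version (ext0 (\<lambda>x. F x + G x)) (\<lambda>z. ver F z + ver G z)"
    unfolding ext0_add
    by (rule version_add[OF tent_space_1_slices[OF F] tent_space_1_slices[OF G] version_ver[OF F] version_ver[OF G]])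
  from AE_integrand_eq[OF FG this] AE_set_integrable[OF F] AE_set_integrable[OF G]
  have "AE z in lborel. 0 < fst z \<longrightarrow> int_op (\<lambda>x. F x + G x) z = int_op F z + int_op G z"
  proof eventually_elim
    case (elim z)
    show ?case
    proof
      assume z: "0 < fst z"
      have "int_op (\<lambda>x. F x + G x) z = (LINT s:{0<..}|lborel. integrand F z s + integrand G z s)"
      proof (rule op_eq_integral[OF _ FG])
        show "AE s in lborel. 0 < s \<longrightarrow> integrand (\<lambda>x. F x + G x) z s = integrand F z s + integrand G z s"
          using elim(1) z by (auto simp: integrand_def vector_add_ldistrib scaleR_add_right elim!: eventually_mono)
        show "(\<lambda>s. integrand F z s + integrand G z s) \<in> borel_measurable borel"
          by (intro borel_measurable_add integrand_measurable F G)
      qed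
      also have "\<dots> = int_op F z + int_op G z"
        unfolding int_op_def using elim z by (intro set_integral_add) auto
      finally show "int_op (\<lambda>x. F x + G x) z = int_op F z + int_op G z" .
    qed
  qed
  then show ?thesis by (simp add: AE_half_measure)
qed

lemma op_scale:
  assumes F: "F \<in> tent_space 1"
  shows "AE z in half_measure. int_op (\<lambda>x. c *s F x) z = c *s int_op F z"
proof -
  have cF: "(\<lambda>x. c *s F x) \<in> tent_space 1" by (rule tent_space_1_scale[OF F])
  have "version (ext0 (\<lambda>x. c *s F x)) (\<lambda>z. c *s ver F z)"
    unfolding ext0_scale by (rule version_scale[OF tent_space_1_slices[OF F] version_ver[OF F]])
  from AE_integrand_eq[OF cF this] AE_set_integrable[OF F]
  have "AE z in lborel. 0 < fst z \<longrightarrow> int_op (\<lambda>x. c *s F x) z = c *s int_op F z"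
  proof eventually_elim
    case (elim z)
    show ?case
    proof
      assume z: "0 < fst z"
      note [measurable] = integrand_measurable[OF F, of z]
      have "int_op (\<lambda>x. c *s F x) z = (LINT s:{0<..}|lborel. c *s integrand F z s)"
      proof (rule op_eq_integral[OF _ cF])
        show "AE s in lborel. 0 < s \<longrightarrow> integrand (\<lambda>x. c *s F x) z s = c *s integrand F z s"
          using elim(1) z by (auto simp: integrand_def vec_eq_iff mult_ac elim!: eventually_mono)
      qed measurable
      also have "\<dots> = (\<integral>s. c *s (indicator {0<..} s *\<^sub>R integrand F z s) \<partial>lborel)"
        unfolding set_lebesgue_integral_def
        by (intro Bochner_Integration.integral_cong) (auto simp: vec_eq_iff)
      also have "\<dots> = c *s int_op F z"
        unfolding int_op_def set_lebesgue_integral_def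
        using elim(2) z by (intro integral_vector_scalar_mult) (simp add: set_integrable_def)
      finally show "int_op (\<lambda>x. c *s F x) z = c *s int_op F z" .
    qed
  qed
  then show ?thesis by (simp add: AE_half_measure)
qed

lemma tent_op_norm_op: "tent_op_norm 1 int_op \<le> ennreal op_const"
  unfolding tent_op_norm_def op_norm_def
  by (rule Inf_lower) (use op_tent_space(2) in auto)

lemma op_tent_ops: "int_op \<in> tent_ops 1"
  unfolding bounded_ops_def
  using op_tent_space(1) op_add op_scale
    order_le_less_trans[OF tent_op_norm_op ennreal_less_top]
  by (auto simp: tent_op_norm_def)

lemma integral_op_op:
  assumes F: "F \<in> tent_space 1"
    and L: "\<And>t s f. 0 < t \<Longrightarrow> 0 < s \<Longrightarrow> L t s f = (\<lambda>x. \<kappa> t s *s K t s f x)"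
  shows "integral_op L F (int_op F)"
proof -
  have [measurable]: "ver F \<in> borel_measurable borel" by (rule ver_borel[OF F])
  define H where "H z = \<kappa> (fst z) (fst (snd z)) *s ver F z" for z :: "real \<times> real \<times> (real ^ 'n)"
  have "AE ts in lborel. 0 < fst ts \<and> 0 < snd ts \<longrightarrow>
     (AE x in lborel. H (fst ts, snd ts, x) = L (fst ts) (snd ts) (\<lambda>y. F (snd ts, y)) x)"
    using versionD(2)[OF version_ver[OF F]]
  proof eventually_elim
    case (elim ts)
    show ?case
    proof
      assume ts: "0 < fst ts \<and> 0 < snd ts"
      then have "(\<lambda>y. ext0 F (snd ts, y)) = (\<lambda>y. F (snd ts, y))"
        by (simp add: ext0_def upper_half_def)
      then have "AE x in lborel. ver F (fst ts, snd ts, x) = K (fst ts) (snd ts) (\<lambda>y. F (snd ts, y)) x"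
        using elim ts by simp
      then show "AE x in lborel. H (fst ts, snd ts, x) = L (fst ts) (snd ts) (\<lambda>y. F (snd ts, y)) x"
        by eventually_elim (use ts in \<open>simp add: H_def L\<close>)
    qed
  qed
  moreover have "H \<in> borel_measurable borel" unfolding H_def by measurable
  ultimately have "measurable_version (\<lambda>t s. L t s (\<lambda>y. F (s, y))) H"
    by (simp add: measurable_version_def)
  moreover have "AE z in half_measure.
      set_integrable lborel {0<..} (\<lambda>s. (1 / s) *\<^sub>R H (fst z, s, snd z)) \<and>
      int_op F z = (LINT s:{0<..}|lborel. (1 / s) *\<^sub>R H (fst z, s, snd z))"
    using AE_set_integrable[OF F] by (simp add: AE_half_measure H_def int_op_def integrand_def[abs_def])
  ultimately show ?thesis
    unfolding integral_op_def by blast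
qed

end

context tent_kernel
begin

text \<open>The bound on the norm depends on \<open>\<kappa>\<close> only through \<sigma> and
  \<delta>, so it is common to all factors with the same pointwise majorant.\<close>

lemma bounded_integral_op:
  assumes \<kappa>: "(\<lambda>q. \<kappa> (fst q) (snd q)) \<in> borel_measurable borel"
    and le: "\<And>t s. 0 < t \<Longrightarrow> 0 < s \<Longrightarrow> norm (\<kappa> t s) \<le> min 1 (s / t) powr \<sigma> * schur \<delta> t s"
    and \<delta>: "0 < \<delta>" and \<sigma>: "real CARD('n) * (1 - 1 / p) < \<sigma>"
    and L: "\<And>t s f. 0 < t \<Longrightarrow> 0 < s \<Longrightarrow> L t s f = (\<lambda>x. \<kappa> t s *s K t s f x)"
  shows "\<exists>S\<in>tent_ops 1. extends_integral_op 1 L S \<and>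
    tent_op_norm 1 S \<le> ennreal (atom_const \<sigma> \<delta> * (4 * dyadic_const CARD('n)))"
proof -
  interpret integral_kernel K M p N' C \<kappa> \<sigma> \<delta>
    by unfold_locales (use assms in \<open>auto intro!: borel_measurable_norm\<close>)
  show ?thesis
    using op_tent_ops integral_op_op[OF _ L] tent_op_norm_op
    by (intro bexI[of _ int_op]) (auto simp: extends_integral_op_def op_const_def)
qed

end

section \<open>The two kernels\<close>

lemma of_real_powr:
  assumes "0 < x" shows "complex_of_real x powr z = exp (z * of_real (ln x))"
  using assms by (simp add: powr_def Ln_of_real)

lemma norm_exp_ln:
  assumes "0 < x" shows "norm (exp (z * complex_of_real (ln x))) = x powr Re z"
  using assms by (simp add: powr_def)

theorem proposition10p1:
  fixes K :: "('n::finite, 'm::finite) kernel" and p N' C :: real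
  assumes "1 \<le> p" and "p \<le> 2"
    and "N' > real CARD('n) / 2"
    and "\<And>t s. 0 < t \<Longrightarrow> 0 < s \<Longrightarrow> K t s \<in> bounded_ops lborel (Lp 2) (Lp_norm 2)"
    and "\<exists>M::real. \<forall>t>0. \<forall>s>0. op_norm (Lp 2) (Lp_norm 2) (Lp_norm 2) (K t s) \<le> ennreal M"
    and "measurable_kernel K"
    and "C > 0"
    and "\<And>E F t s. E \<in> sets borel \<Longrightarrow> F \<in> sets borel \<Longrightarrow> 0 < t \<Longrightarrow> 0 < s \<Longrightarrow>
           Lp_L2_norm p (\<lambda>f. cutoff E (K t s (cutoff F f)))
             \<le> ennreal (C * max t s powr (- real CARD('n) * (1 / p - 1 / 2))
                         * (1 + setdist E F / max t s) powr (- N'))"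
  shows "(\<forall>\<alpha>::real. \<alpha> > 0 \<longrightarrow>
            (\<exists>S\<in>tent_ops 1. extends_integral_op 1 (kernel_minus (complex_of_real \<alpha>) K) S)) \<and>
         (\<forall>\<beta>::real. \<beta> > real CARD('n) * (1 - 1 / p) \<longrightarrow>
            (\<exists>S :: real \<Rightarrow> ('n, 'm) tfun \<Rightarrow> ('n, 'm) tfun.
               (\<forall>\<gamma>. S \<gamma> \<in> tent_ops 1 \<and> extends_integral_op 1 (kernel_plus (Complex \<beta> \<gamma>) K) (S \<gamma>)) \<and>
               (SUP \<gamma>. tent_op_norm 1 (S \<gamma>)) < \<infinity>))"
proof -
  obtain M where M: "\<And>t s. 0 < t \<Longrightarrow> 0 < s \<Longrightarrow> op_norm (Lp 2) (Lp_norm 2) (Lp_norm 2) (K t s) \<le> ennreal M"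
    using assms(5) by blast
  \<comment> \<open>The given \<open>M\<close> may be negative, which \<open>ennreal\<close> reads
    as 0; the locale asks for a nonnegative real.\<close>
  interpret tent_kernel K "max M 0" p N' C
  proof
    fix t s :: real assume "0 < t" "0 < s"
    from M[OF this] show "op_norm (Lp 2) (Lp_norm 2) (Lp_norm 2) (K t s) \<le> ennreal (max M 0)"
      by (rule order_trans) (simp add: ennreal_leI)
  qed (use assms in auto)
  show ?thesis
  proof (intro conjI allI impI)
    fix \<alpha> :: real assume \<alpha>: "0 < \<alpha>"
    \<comment> \<open>The complex power is written through the real logarithm: it agrees with
      \<open>powr\<close> at positive arguments and its Borel measurability is immediate.\<close>
    define \<kappa> where "\<kappa> t s = indicator {0<..} (s - t) * exp (complex_of_real \<alpha> * of_real (ln (t / s)))" for t s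
    have "\<exists>S\<in>tent_ops 1. extends_integral_op 1 (kernel_minus (complex_of_real \<alpha>) K) S \<and>
      tent_op_norm 1 S \<le> ennreal (atom_const (real CARD('n) * (1 - 1 / p) + 1) \<alpha> * (4 * dyadic_const CARD('n)))"
    proof (rule bounded_integral_op[where \<kappa> = \<kappa>])
      show "(\<lambda>q. \<kappa> (fst q) (snd q)) \<in> borel_measurable borel"
        unfolding \<kappa>_def by measurable
      fix t s :: real assume ts: "0 < t" "0 < s"
      show "norm (\<kappa> t s) \<le> min 1 (s / t) powr (real CARD('n) * (1 - 1 / p) + 1) * schur \<alpha> t s"
      proof (cases "t < s")
        case True
        then have "1 \<le> s / t" "t / s \<le> 1" using ts by simp_all
        then have "t / s \<le> s / t" by linarith
        have "norm (\<kappa> t s) = (t / s) powr \<alpha>"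
          using True ts norm_exp_ln[of "t / s" "complex_of_real \<alpha>"] by (simp add: \<kappa>_def)
        with \<open>1 \<le> s / t\<close> \<open>t / s \<le> s / t\<close> show ?thesis by (simp add: schur_def)
      qed (simp add: \<kappa>_def schur_nonneg)
      show "kernel_minus (complex_of_real \<alpha>) K t s f = (\<lambda>x. \<kappa> t s *s K t s f x)" for f
        using ts of_real_powr[of "t / s" "complex_of_real \<alpha>"] by (simp add: kernel_minus_def \<kappa>_def)
    qed (use \<alpha> in auto)
    then show "\<exists>S\<in>tent_ops 1. extends_integral_op 1 (kernel_minus (complex_of_real \<alpha>) K) S" by blast
  next
    fix \<beta> :: real assume \<beta>: "real CARD('n) * (1 - 1 / p) < \<beta>"
    \<comment> \<open>The excess of \<beta> over n/p' is shared equally: one half puts \<sigma>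
      above n/p', the other is \<delta>. Since the modulus of the power is
      \<open>(s / t) powr \<beta>\<close>, the bound \<open>?B\<close> is free of \<gamma>.\<close>
    define \<sigma> \<delta> where "\<sigma> = (\<beta> + real CARD('n) * (1 - 1 / p)) / 2"
      and "\<delta> = (\<beta> - real CARD('n) * (1 - 1 / p)) / 2"
    let ?B = "ennreal (atom_const \<sigma> \<delta> * (4 * dyadic_const CARD('n)))"
    have "\<exists>S\<in>tent_ops 1. extends_integral_op 1 (kernel_plus (Complex \<beta> \<gamma>) K) S \<and> tent_op_norm 1 S \<le> ?B" for \<gamma>
    proof -
      define \<kappa> where "\<kappa> t s = indicator {0<..} (t - s) * exp (Complex \<beta> \<gamma> * of_real (ln (s / t)))" for t s
      show ?thesis
      proof (rule bounded_integral_op[where \<kappa> = \<kappa>])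
        show "(\<lambda>q. \<kappa> (fst q) (snd q)) \<in> borel_measurable borel"
          unfolding \<kappa>_def by measurable
        fix t s :: real assume ts: "0 < t" "0 < s"
        show "norm (\<kappa> t s) \<le> min 1 (s / t) powr \<sigma> * schur \<delta> t s"
        proof (cases "s < t")
          case True
          then have "1 \<le> t / s" "s / t \<le> 1" using ts by simp_all
          then have *: "min 1 (s / t) = s / t" "min (s / t) (t / s) = s / t" by linarith+
          have "norm (\<kappa> t s) = (s / t) powr \<beta>"
            using True ts norm_exp_ln[of "s / t" "Complex \<beta> \<gamma>"] by (simp add: \<kappa>_def norm_mult)
          also have "\<beta> = \<sigma> + \<delta>" by (simp add: \<sigma>_def \<delta>_def field_simps)
          finally show ?thesis unfolding schur_def * by (simp add: powr_add)
        qed (simp add: \<kappa>_def schur_nonneg)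
        show "kernel_plus (Complex \<beta> \<gamma>) K t s f = (\<lambda>x. \<kappa> t s *s K t s f x)" for f
          using ts of_real_powr[of "s / t" "Complex \<beta> \<gamma>"] by (simp add: kernel_plus_def \<kappa>_def)
      qed (use \<beta> in \<open>auto simp: \<sigma>_def \<delta>_def field_simps\<close>)
    qed
    then obtain S where S: "\<And>\<gamma>. S \<gamma> \<in> tent_ops 1"
      "\<And>\<gamma>. extends_integral_op 1 (kernel_plus (Complex \<beta> \<gamma>) K) (S \<gamma>)" "\<And>\<gamma>. tent_op_norm 1 (S \<gamma>) \<le> ?B"
      by metis
    have "(SUP \<gamma>. tent_op_norm 1 (S \<gamma>)) \<le> ?B"
      by (rule SUP_least) (rule S(3))
    also have "\<dots> < \<infinity>" by simp
    finally show "\<exists>S :: real \<Rightarrow> ('n, 'm) tfun \<Rightarrow> ('n, 'm) tfun.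
        (\<forall>\<gamma>. S \<gamma> \<in> tent_ops 1 \<and> extends_integral_op 1 (kernel_plus (Complex \<beta> \<gamma>) K) (S \<gamma>)) \<and>
        (SUP \<gamma>. tent_op_norm 1 (S \<gamma>)) < \<infinity>"
      using S(1,2) by blast
  qed
qed

end
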